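(* Let $\mathcal{A}=\{A_i\}_{i\in \mathcal{I}}$ be a finite set of invertible $d\times d$ real matrices such that: there exists a positive diagonal matrix $A$, with diagonal entries $\lambda_1,\ldots,\lambda_d>0$, such that $A_i=A$ for all $i\in \mathcal{I}$; $\|A\|<1/2$; and $\lambda(\mathcal{A})>1$. Let $U\subset \mathbb{R}^{\#\mathcal{I}\cdot d}$ be an open set such that $X_{\mathbf{t}}$ has non-empty interior for Lebesgue almost every $\mathbf{t}\in U$. Let $s>1$. Then for any $\mathbf{j}\in \mathcal{I}^{\mathbb{N}}$, for Lebesgue almost every $\mathbf{t}\in U$, for any ball $B$ centred at a point of $X_{\mathbf{t}}$, $$\dim_{H}\left(W_{s}(\mathcal{S}_{\mathbf{t}},\pi_{\mathbf{t}}(\mathbf{j}))\cap B\right)\geq \min_{p\in P}\left\{\# K_{1} + \# K_{2}\left(1-\frac{s-1}{dp}\right)+\frac{\# K_{3}}{dp}+\sum_{i\in K_{3}}\frac{\log \lambda_i} {p\log(\lambda(\mathcal{A})^{-1})}\right\},$$ where $a_i=\frac{\log \lambda_i}{\log(\lambda(\mathcal{A})^{-1})}+\frac{1}{d}$ for $1\le i\le d$, $P=\{a_i,\ a_i+\frac{s-1}{d}:1\leq i\leq d\}$, and, for each $p\in P$, $$K_{1}=\{i:a_i\geq p\},\quad K_{2}=\left\{i:a_i+\tfrac{s-1}{d}\leq p\right\},\quad K_{3}=\{1,\ldots,d\}\setminus (K_{1}\cup K_{2}).$$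
   Context: $\dim_H$ is Hausdorff dimension; $\|\cdot\|$ is the operator norm for the Euclidean norm; $B(x,r)$ is the closed Euclidean ball with centre $x$ and radius $r$; balls have positive radius. $\lambda(\mathcal{A})=\sum_{i\in\mathcal{I}}|\det(A_i)|$. For $\mathbf{t}=(t_i)_{i\in\mathcal{I}}\in(\mathbb{R}^d)^{\mathcal{I}}\cong\mathbb{R}^{\#\mathcal{I}\cdot d}$ let $\mathcal{S}_{\mathbf{t}}=\{S_{i,\mathbf{t}}\}_{i\in\mathcal{I}}$ with $S_{i,\mathbf{t}}(x)=A_ix+t_i$, let $T_{i,\mathbf{t}}=S_{i,\mathbf{t}}^{-1}$, and let $X_{\mathbf{t}}$ be the self-affine set, i.e. the unique non-empty compact set with $X_{\mathbf{t}}=\bigcup_{i\in\mathcal{I}}S_{i,\mathbf{t}}(X_{\mathbf{t}})$. The projection $\pi_{\mathbf{t}}:\mathcal{I}^{\mathbb{N}}\to X_{\mathbf{t}}$ is $\pi_{\mathbf{t}}((i_n)_{n\ge1})=\lim_{n\to\infty}(S_{i_1,\mathbf{t}}\circ\cdots\circ S_{i_n,\mathbf{t}})(0)$. For $y\in X_{\mathbf{t}}$ and $s>1$, $W_s(\mathcal{S}_{\mathbf{t}},y)$ is the set of $x\in X_{\mathbf{t}}$ such that $$(T_{i_N,\mathbf{t}}\circ\cdots\circ T_{i_1,\mathbf{t}})(x)\in B\left(y,\left(\frac{1}{\lambda(\mathcal{A})^{sN}}\right)^{1/d}\right)$$ for infinitely many words $(i_1,\ldots,i_N)\in\bigcup_{n\ge1}\mathcal{I}^n$.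 *)

theory Defs
  imports "HOL-Analysis.Analysis"
begin

section \<open>Hausdorff measure and dimension\<close>

text \<open>The \<open>s\<close>-th power of the diameter, with the conventions that the empty set contributes \<open>0\<close>
  and that \<open>0\<close> to the power \<open>0\<close> is \<open>1\<close> (whereas \<open>0 powr 0 = 0\<close>), so that for \<open>s = 0\<close> one obtains
  the counting measure.\<close>

definition diam_pow :: "real \<Rightarrow> 'a::metric_space set \<Rightarrow> ennreal" where
  "diam_pow s V =
     (if V = {} then 0 else if s = 0 then 1 else ennreal (diameter V powr s))"

text \<open>Boundedness of the covering sets is required explicitly because \<^const>\<open>diameter\<close> is
  meaningless on unbounded sets. Finite covers are included, since the \<open>V n\<close> may be empty.\<close>

definition hausdorff_premeasure :: "real \<Rightarrow> real \<Rightarrow> 'a::metric_space set \<Rightarrow> ennreal" where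
  "hausdorff_premeasure s \<delta> E =
     (INF V \<in> {V :: nat \<Rightarrow> 'a set. (\<forall>n. bounded (V n) \<and> diameter (V n) \<le> \<delta>) \<and> E \<subseteq> (\<Union>n. V n)}.
        \<Sum>n. diam_pow s (V n))"

definition hausdorff_measure :: "real \<Rightarrow> 'a::metric_space set \<Rightarrow> ennreal" where
  "hausdorff_measure s E = (SUP \<delta> \<in> {0<..}. hausdorff_premeasure s \<delta> E)"

definition hausdorff_dim :: "'a::metric_space set \<Rightarrow> ereal" where
  "hausdorff_dim E = Inf (ereal ` {s. 0 \<le> s \<and> hausdorff_measure s E = 0})"

section \<open>Self-affine systems\<close>

definition diag_matrix :: "('d \<Rightarrow> real) \<Rightarrow> real ^ 'd ^ 'd" where
  "diag_matrix l = (\<chi> i j. if i = j then l i else 0)"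

definition lambda_sum :: "('i::finite \<Rightarrow> real ^ 'd ^ 'd) \<Rightarrow> real" where
  "lambda_sum A = (\<Sum>i\<in>UNIV. \<bar>det (A i)\<bar>)"

definition S_map :: "('i::finite \<Rightarrow> real ^ 'd ^ 'd) \<Rightarrow> real ^ 'd ^ 'i \<Rightarrow> 'i \<Rightarrow> real ^ 'd \<Rightarrow> real ^ 'd" where
  "S_map A t i x = A i *v x + t $ i"

definition T_map :: "('i::finite \<Rightarrow> real ^ 'd ^ 'd) \<Rightarrow> real ^ 'd ^ 'i \<Rightarrow> 'i \<Rightarrow> real ^ 'd \<Rightarrow> real ^ 'd" where
  "T_map A t i = inv (S_map A t i)"

text \<open>The description below determines a set when all the matrices have operator norm less than \<open>1\<close>.\<close>

definition self_affine_set :: "('i::finite \<Rightarrow> real ^ 'd ^ 'd) \<Rightarrow> real ^ 'd ^ 'i \<Rightarrow> (real ^ 'd) set" where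
  "self_affine_set A t =
     (THE X. X \<noteq> {} \<and> compact X \<and> X = (\<Union>i. S_map A t i ` X))"

text \<open>Sequences are indexed from \<open>0\<close>. On a word, \<^const>\<open>foldr\<close> applies the map of the last letter
  first and \<^const>\<open>fold\<close> that of the first letter first: \<open>foldr S [i\<^sub>1, \<dots>, i\<^sub>n]\<close> is
  \<open>S i\<^sub>1 \<circ> \<dots> \<circ> S i\<^sub>n\<close>, and \<open>fold T [i\<^sub>1, \<dots>, i\<^sub>n]\<close> is \<open>T i\<^sub>n \<circ> \<dots> \<circ> T i\<^sub>1\<close>.\<close>

definition proj :: "('i::finite \<Rightarrow> real ^ 'd ^ 'd) \<Rightarrow> real ^ 'd ^ 'i \<Rightarrow> (nat \<Rightarrow> 'i) \<Rightarrow> real ^ 'd" where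
  "proj A t j = lim (\<lambda>n. foldr (S_map A t) (map j [0..<n]) 0)"

definition W_set :: "real \<Rightarrow> ('i::finite \<Rightarrow> real ^ 'd ^ 'd) \<Rightarrow> real ^ 'd ^ 'i \<Rightarrow> real ^ 'd \<Rightarrow> (real ^ 'd) set" where
  "W_set s A t y =
     {x \<in> self_affine_set A t.
        infinite {w :: 'i list. w \<noteq> [] \<and>
          fold (T_map A t) w x
            \<in> cball y ((1 / lambda_sum A powr (s * real (length w))) powr (1 / real CARD('d)))}}"

section \<open>The dimension bound\<close>

text \<open>Here \<open>L\<close> stands for \<^term>\<open>lambda_sum A\<close>, and \<open>a\<close> for the function \<^term>\<open>a_coeff L l\<close>.\<close>

definition a_coeff :: "real \<Rightarrow> ('d::finite \<Rightarrow> real) \<Rightarrow> 'd \<Rightarrow> real" where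
  "a_coeff L l i = ln (l i) / ln (inverse L) + 1 / real CARD('d)"

definition P_set :: "real \<Rightarrow> ('d::finite \<Rightarrow> real) \<Rightarrow> real set" where
  "P_set s a = (\<Union>i. {a i, a i + (s - 1) / real CARD('d)})"

definition K1 :: "('d::finite \<Rightarrow> real) \<Rightarrow> real \<Rightarrow> 'd set" where
  "K1 a p = {i. a i \<ge> p}"

definition K2 :: "real \<Rightarrow> ('d::finite \<Rightarrow> real) \<Rightarrow> real \<Rightarrow> 'd set" where
  "K2 s a p = {i. a i + (s - 1) / real CARD('d) \<le> p}"

definition K3 :: "real \<Rightarrow> ('d::finite \<Rightarrow> real) \<Rightarrow> real \<Rightarrow> 'd set" where
  "K3 s a p = UNIV - (K1 a p \<union> K2 s a p)"

definition dim_bound :: "real \<Rightarrow> real \<Rightarrow> ('d::finite \<Rightarrow> real) \<Rightarrow> real" where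
  "dim_bound s L l =
     (let a = a_coeff L l; d = real CARD('d) in
      Min ((\<lambda>p. real (card (K1 a p))
              + real (card (K2 s a p)) * (1 - (s - 1) / (d * p))
              + real (card (K3 s a p)) / (d * p)
              + (\<Sum>i\<in>K3 s a p. ln (l i) / (p * ln (inverse L)))) ` P_set s a))"

end

theory Submission
  imports Defs
begin

text \<open>All the maps have the same linear part, so the level \<open>n\<close> consists of \<open>k ^ n\<close> translates of a single box
  (\<open>k\<close> is the number of maps), centred at the points \<open>S\<^sub>w (y)\<close> with \<open>y = \<pi> (j)\<close>, whose half-widths are
  \<open>l i ^ n\<close> times the target radius divided by the dimension \<open>d\<close>. The limsup set of these boxes is bounded below by a potential-theoretic
  argument rather than by a mass transference principle.

  \<^emph>\<open>Energies.\<close> A measure \<open>\<mu>\<close> is measured by its dyadic \<open>u\<close>-energy, the sum over all dyadic cubes \<open>Q\<close> of side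
  \<open>2 ^ -j\<close> of \<open>2 ^ (u j) \<mu>(Q)\<^sup>2\<close>. If nested compact sets carry measures of bounded energy and of mass bounded below,
  their intersection has positive \<open>u\<close>-dimensional Hausdorff measure
  (\<open>hausdorff_measure_nonzero_of_energy\<close>). It therefore suffices that Lebesgue measure on any box
  inside the attractor can be approximated in energy norm by step densities supported in boxes of arbitrarily
  high level: iterating this (\<open>hausdorff_measure_nonzero_of_refinement\<close>) produces the nested sets.

  \<^emph>\<open>Approximating Lebesgue measure.\<close> The given box is filled with dyadic cells \<open>g\<close> of roughly the shape of the
  linear part to the power \<open>m\<close>. The centre of a cell lies in the attractor, so the cell contains a piece \<open>S\<^sub>v (X)\<close> with
  \<open>|v| = m\<close>, and the mass of \<open>g\<close> is spread evenly over the boxes with the words \<open>v w\<close>, \<open>|w| = n\<close>. On cubes larger than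
  the cells nothing changes. On smaller cubes the energy is a diagonal part, coming from single
  boxes, plus a part governed by the number of pairs of words whose centres are close
  (\<open>word_boxes_level_energy\<close>, \<open>cellwise_level_energy\<close>, \<open>box_refinement\<close>).

  \<^emph>\<open>Close pairs.\<close> Since \<open>l i < 1 / 2\<close>, the difference of the centres of two words depends on the translation at their
  first difference with a coefficient of the order \<open>l i ^ m\<close>. Hence the set of
  parameters for which the centres are \<open>\<delta> i\<close>-close in every coordinate has measure of the order of the product of all
  \<open>\<delta> i / l i ^ m\<close>, and since \<open>L = k * (\<Prod>i. l i) > 1\<close> the expected number of close pairs is at most a constant times that of
  independent uniformly distributed points. Fatou's lemma makes this almost sure for infinitely many \<open>n\<close>
  (\<open>nn_integral_close_pairs\<close>, \<open>ae_few_close_pairs\<close>).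

  \<^emph>\<open>The exponent.\<close> Let \<open>b i = a i + (s - 1) / d\<close>, so that a box of level \<open>n\<close> has sides \<open>L powr (- n * b i)\<close> up to a
  constant, while \<open>k ^ n\<close> is \<open>L powr (n * \<Sum>i. a i)\<close>. The diagonal part tends to \<open>0\<close> if
  \<open>u * p < (\<Sum>i. a i) + (\<Sum>i. max 0 (p - b i))\<close> at each \<open>p = b i\<close>, and the terms of the stated minimum at these \<open>p\<close>
  are at most the quotient of the right-hand side by \<open>p\<close> (\<open>dim_value_times\<close>,
  \<open>convex_exponent_gap\<close>, \<open>diagonal_energy_small\<close>).\<close>

section \<open>Dyadic boxes\<close>

abbreviation leb :: "'a::euclidean_space set \<Rightarrow> real" where
  "leb \<equiv> measure lborel"

text \<open>The sides may differ from coordinate to coordinate: the cells used later have, up to a factor of \<open>2\<close>, the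
  shape of a power of the linear part. Half-open boxes partition the space for fixed \<open>e\<close>, and two boxes with
  comparable exponents are nested or disjoint.\<close>

definition dyadic_box :: "('d \<Rightarrow> nat) \<Rightarrow> ('d \<Rightarrow> int) \<Rightarrow> (real ^ 'd::finite) set" where
  "dyadic_box e z = {x. \<forall>i. \<lfloor>2 ^ e i * x $ i\<rfloor> = z i}"

abbreviation dyadic_cube :: "nat \<Rightarrow> ('d \<Rightarrow> int) \<Rightarrow> (real ^ 'd::finite) set" where
  "dyadic_cube j \<equiv> dyadic_box (\<lambda>_. j)"

lemma dyadic_box_disjoint: "z \<noteq> z' \<Longrightarrow> dyadic_box e z \<inter> dyadic_box e z' = {}"
  by (auto simp: dyadic_box_def)

lemma floor_dyadic_iff:
  "\<lfloor>2 ^ n * x\<rfloor> = z \<longleftrightarrow> real_of_int z / 2 ^ n \<le> x \<and> x < (real_of_int z + 1) / 2 ^ n"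
  for x :: real
  by (simp add: floor_eq_iff divide_le_eq less_divide_eq mult.commute)

lemma dyadic_box_alt:
  "dyadic_box e z = {x. \<forall>i. real_of_int (z i) / 2 ^ e i \<le> x $ i \<and> x $ i < (real_of_int (z i) + 1) / 2 ^ e i}"
  by (simp only: dyadic_box_def floor_dyadic_iff)

lemma dyadic_box_sets [measurable]: "dyadic_box e z \<in> sets borel"
  unfolding dyadic_box_def by measurable

lemma measure_cbox_vec:
  fixes a b :: "real ^ 'd"
  assumes "\<And>i. a $ i \<le> b $ i"
  shows "leb (cbox a b) = (\<Prod>i\<in>UNIV. b $ i - a $ i)"
proof -
  have "cbox a b \<noteq> {}" using assms by (auto simp: interval_ne_empty_cart)
  then show ?thesis using content_cbox_cart[of a b] by simp
qed

lemma measure_dyadic_box: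
  fixes e :: "'d::finite \<Rightarrow> nat"
  shows "leb (dyadic_box e z) = (\<Prod>i\<in>UNIV. 1 / 2 ^ e i)"
proof -
  define a b :: "real ^ 'd" where "a = (\<chi> i. real_of_int (z i) / 2 ^ e i)"
    and "b = (\<chi> i. (real_of_int (z i) + 1) / 2 ^ e i)"
  have le: "a $ i \<le> b $ i" for i by (auto simp: a_def b_def divide_right_mono)
  have 1: "box a b \<subseteq> dyadic_box e z" "dyadic_box e z \<subseteq> cbox a b"
    by (auto simp: dyadic_box_alt a_def b_def mem_box_cart less_imp_le)
  have "leb (box a b) \<le> leb (dyadic_box e z)"
    using 1 by (intro measure_mono_fmeasurable)
      (auto intro: fmeasurableI2[OF fmeasurable_cbox])
  moreover have "leb (dyadic_box e z) \<le> leb (cbox a b)"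
    using 1 by (intro measure_mono_fmeasurable) auto
  moreover have "leb (box a b) = leb (cbox a b)"
    by (simp add: measure_lborel_box_eq measure_lborel_cbox_eq)
  ultimately have "leb (dyadic_box e z) = leb (cbox a b)" by simp
  also have "\<dots> = (\<Prod>i\<in>UNIV. b $ i - a $ i)" using le by (rule measure_cbox_vec)
  finally show ?thesis by (simp add: a_def b_def diff_divide_distrib[symmetric])
qed

lemma dyadic_box_fmeasurable [simp]: "dyadic_box e z \<in> fmeasurable lborel"
proof -
  have "dyadic_box e z \<subseteq> cbox (\<chi> i. real_of_int (z i) / 2 ^ e i) (\<chi> i. (real_of_int (z i) + 1) / 2 ^ e i)"
    by (auto simp: dyadic_box_alt mem_box_cart less_imp_le)
  then show ?thesis by (rule fmeasurableI2[OF fmeasurable_cbox]) simp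
qed

lemma floor_coarser_dyadic:
  fixes x :: real
  assumes "m \<le> n"
  shows "\<lfloor>2 ^ m * x\<rfloor> = \<lfloor>2 ^ n * x\<rfloor> div 2 ^ (n - m)"
proof -
  have "(2::real) ^ n = 2 ^ m * 2 ^ (n - m)"
    using assms by (simp flip: power_add)
  then have "2 ^ m * x = (2 ^ n * x) / real_of_int (2 ^ (n - m))"
    by simp
  then show ?thesis by (simp only: floor_divide_real_eq_div zero_le_power zero_le_numeral)
qed

lemma dyadic_box_component_close:
  assumes "x \<in> dyadic_box e z" "y \<in> dyadic_box e z"
  shows "\<bar>x $ i - y $ i\<bar> < 1 / 2 ^ e i"
proof -
  have "\<lfloor>2 ^ e i * x $ i\<rfloor> = \<lfloor>2 ^ e i * y $ i\<rfloor>" using assms by (simp add: dyadic_box_def)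
  then have "\<bar>2 ^ e i * x $ i - 2 ^ e i * y $ i\<bar> < 1" by linarith
  then have "2 ^ e i * \<bar>x $ i - y $ i\<bar> < 1" by (simp add: abs_mult right_diff_distrib[symmetric])
  then show ?thesis by (simp add: field_simps)
qed

lemma dyadic_box_subset_or_disjoint:
  assumes "\<And>i. e' i \<le> e i"
  shows "dyadic_box e z \<subseteq> dyadic_box e' z' \<or> dyadic_box e z \<inter> dyadic_box e' z' = {}"
proof -
  have "dyadic_box e z \<subseteq> dyadic_box e' z'" if "x \<in> dyadic_box e z" "x \<in> dyadic_box e' z'" for x
    using that by (auto simp: dyadic_box_def floor_coarser_dyadic[OF assms])
  then show ?thesis by auto
qed

lemma finite_card_int_boxes:
  fixes S :: "'d::finite \<Rightarrow> int set"
  assumes "\<And>i. finite (S i)"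
  shows "finite {z. \<forall>i. z i \<in> S i}" "card {z. \<forall>i. z i \<in> S i} = (\<Prod>i\<in>UNIV. card (S i))"
proof -
  have "{z. \<forall>i. z i \<in> S i} = Pi\<^sub>E UNIV S" by (auto simp: PiE_def)
  then show "finite {z. \<forall>i. z i \<in> S i}" "card {z. \<forall>i. z i \<in> S i} = (\<Prod>i\<in>UNIV. card (S i))"
    using assms by (simp_all add: card_PiE finite_PiE)
qed

lemma ball_covered_by_cubes:
  fixes x :: "real ^ 'd"
  assumes "r \<le> 1 / 2 ^ j"
  shows "\<exists>Z. finite Z \<and> card Z \<le> 3 ^ CARD('d) \<and> ball x r \<subseteq> (\<Union>z\<in>Z. dyadic_cube j z)"
proof -
  define S where "S i = {\<lfloor>2 ^ j * x $ i\<rfloor> - 1..\<lfloor>2 ^ j * x $ i\<rfloor> + 1}" for i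
  have S: "finite (S i)" "card (S i) = 3" for i by (auto simp: S_def)
  have "ball x r \<subseteq> (\<Union>z\<in>{z. \<forall>i. z i \<in> S i}. dyadic_cube j z)"
  proof
    fix y assume y: "y \<in> ball x r"
    have "\<lfloor>2 ^ j * y $ i\<rfloor> \<in> S i" for i
    proof -
      have "\<bar>x $ i - y $ i\<bar> < r"
        using y component_le_norm_cart[of "x - y" i] by (simp add: dist_norm)
      then have "\<bar>x $ i - y $ i\<bar> < 1 / 2 ^ j" using assms by simp
      then have "2 ^ j * \<bar>x $ i - y $ i\<bar> < 1" by (simp add: field_simps)
      then have "\<bar>2 ^ j * x $ i - 2 ^ j * y $ i\<bar> < 1"
        by (simp add: abs_mult right_diff_distrib[symmetric])
      then show ?thesis unfolding S_def by simp linarith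
    qed
    then show "y \<in> (\<Union>z\<in>{z. \<forall>i. z i \<in> S i}. dyadic_cube j z)"
      by (auto simp: dyadic_box_def intro!: exI[of _ "\<lambda>i. \<lfloor>2 ^ j * y $ i\<rfloor>"])
  qed
  then show ?thesis
    using finite_card_int_boxes[of S] S by (intro exI[of _ "{z. \<forall>i. z i \<in> S i}"]) simp
qed

lemma dyadic_scale_exists:
  fixes r :: real
  assumes "0 < r" "r \<le> 1"
  shows "\<exists>j::nat. r \<le> 1 / 2 ^ j \<and> 1 / 2 ^ j < 2 * r"
proof -
  obtain n :: nat where "(1/2) ^ n < r" using real_arch_pow_inv[of r "1/2"] assms by auto
  then have ex: "\<exists>n::nat. 1 / 2 ^ n < r" by (auto simp: power_divide)
  define n where "n = (LEAST n::nat. 1 / 2 ^ n < r)"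
  have n: "1 / 2 ^ n < r" unfolding n_def using ex by (rule LeastI_ex)
  have "n \<noteq> 0" using n assms by (cases n) auto
  then obtain j where j: "n = Suc j" by (cases n) auto
  have "\<not> 1 / 2 ^ j < r" using not_less_Least[of j "\<lambda>n. 1 / 2 ^ n < r"] j n_def by auto
  then show ?thesis using n j by (intro exI[of _ j]) (auto simp: field_simps)
qed

section \<open>Dyadic energy and Hausdorff content\<close>

text \<open>Distances are taken in the Hilbert norm whose square is the dyadic \<open>u\<close>-energy. Finite families of cubes
  keep everything in finite sums; against \<open>\<nu> = 0\<close> it is a bound for the energy of \<open>\<mu>\<close>. Set functions are used
  instead of measures because \<open>\<mu> - \<nu>\<close> is signed.\<close>

definition energy_close :: "real \<Rightarrow> ((real ^ 'd::finite) set \<Rightarrow> real) \<Rightarrow> ((real ^ 'd) set \<Rightarrow> real) \<Rightarrow> real \<Rightarrow> bool" where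
  "energy_close u \<mu> \<nu> \<epsilon> \<longleftrightarrow>
     (\<forall>F. finite F \<longrightarrow>
        L2_set (\<lambda>(j, z). 2 powr (u * real j / 2) * (\<mu> (dyadic_cube j z) - \<nu> (dyadic_cube j z))) F \<le> \<epsilon>)"

lemma energy_close_add:
  assumes "energy_close u \<mu> \<nu> \<epsilon>" "energy_close u \<mu>' \<nu>' \<delta>"
  shows "energy_close u (\<lambda>Q. \<mu> Q + \<mu>' Q) (\<lambda>Q. \<nu> Q + \<nu>' Q) (\<epsilon> + \<delta>)"
  unfolding energy_close_def
proof (intro allI impI)
  fix F :: "(nat \<times> ('a \<Rightarrow> int)) set" assume F: "finite F"
  let ?f = "\<lambda>\<mu> \<nu>. \<lambda>(j, z::'a \<Rightarrow> int). 2 powr (u * real j / 2) * ((\<mu> (dyadic_cube j z)::real) - \<nu> (dyadic_cube j z))"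
  have "L2_set (?f (\<lambda>Q. \<mu> Q + \<mu>' Q) (\<lambda>Q. \<nu> Q + \<nu>' Q)) F = L2_set (\<lambda>x. ?f \<mu> \<nu> x + ?f \<mu>' \<nu>' x) F"
    by (intro L2_set_cong) (auto simp: algebra_simps)
  also have "\<dots> \<le> L2_set (?f \<mu> \<nu>) F + L2_set (?f \<mu>' \<nu>') F" by (rule L2_set_triangle_ineq)
  also have "\<dots> \<le> \<epsilon> + \<delta>" using assms F unfolding energy_close_def by (intro add_mono) blast+
  finally show "L2_set (?f (\<lambda>Q. \<mu> Q + \<mu>' Q) (\<lambda>Q. \<nu> Q + \<nu>' Q)) F \<le> \<epsilon> + \<delta>" .
qed

lemma energy_close_trans:
  assumes "energy_close u \<mu> \<nu> \<epsilon>" "energy_close u \<nu> \<rho> \<delta>"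
  shows "energy_close u \<mu> \<rho> (\<epsilon> + \<delta>)"
  using energy_close_add[OF assms] by (simp add: energy_close_def)

lemma energy_close_scale:
  assumes "energy_close u \<mu> \<nu> \<epsilon>" "0 \<le> c"
  shows "energy_close u (\<lambda>Q. c * \<mu> Q) (\<lambda>Q. c * \<nu> Q) (c * \<epsilon>)"
  unfolding energy_close_def
proof (intro allI impI)
  fix F :: "(nat \<times> ('a \<Rightarrow> int)) set" assume F: "finite F"
  let ?f = "\<lambda>\<mu> \<nu>. \<lambda>(j, z::'a \<Rightarrow> int). 2 powr (u * real j / 2) * ((\<mu> (dyadic_cube j z)::real) - \<nu> (dyadic_cube j z))"
  have "L2_set (?f (\<lambda>Q. c * \<mu> Q) (\<lambda>Q. c * \<nu> Q)) F = c * L2_set (?f \<mu> \<nu>) F"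
    unfolding L2_set_right_distrib[OF assms(2)] by (intro L2_set_cong) (auto simp: algebra_simps)
  also have "\<dots> \<le> c * \<epsilon>" using assms F unfolding energy_close_def by (intro mult_left_mono) blast+
  finally show "L2_set (?f (\<lambda>Q. c * \<mu> Q) (\<lambda>Q. c * \<nu> Q)) F \<le> c * \<epsilon>" .
qed

lemma energy_close_mono: "energy_close u \<mu> \<nu> \<epsilon> \<Longrightarrow> \<epsilon> \<le> \<delta> \<Longrightarrow> energy_close u \<mu> \<nu> \<delta>"
  unfolding energy_close_def by (meson order_trans)

lemma energy_close_refl: "0 \<le> \<epsilon> \<Longrightarrow> energy_close u \<mu> \<mu> \<epsilon>"
  unfolding energy_close_def by (simp add: L2_set_def case_prod_unfold)

lemma energy_close_unit_cube:
  assumes "energy_close u \<mu> \<nu> \<epsilon>"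
  shows "\<bar>\<mu> (dyadic_cube 0 z) - \<nu> (dyadic_cube 0 z)\<bar> \<le> \<epsilon>"
  using assms[unfolded energy_close_def, rule_format, of "{(0, z)}"] by (simp add: L2_set_def)

text \<open>By Cauchy--Schwarz, a measure of energy at most \<open>C\<^sup>2\<close> cannot put mass \<open>m\<close> on few small cubes:
  this is how an energy bound turns into a lower bound on coverings.\<close>

lemma energy_covering_bound:
  fixes x :: "nat \<Rightarrow> real ^ 'd" and \<mu> :: "(real ^ 'd) set \<Rightarrow> real"
  assumes energy: "energy_close u \<mu> (\<lambda>_. 0) C"
    and mass: "\<And>F. finite F \<Longrightarrow> K \<subseteq> (\<Union>(j, z)\<in>F. dyadic_cube j z) \<Longrightarrow> m \<le> (\<Sum>(j, z)\<in>F. \<mu> (dyadic_cube j z))"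
    and cover: "K \<subseteq> (\<Union>n<N. ball (x n) (r n))" and r: "\<And>n. n < N \<Longrightarrow> 0 < r n \<and> r n \<le> 1"
    and "0 \<le> m" "0 \<le> u" "0 \<le> C"
  shows "m\<^sup>2 \<le> 3 ^ CARD('d) * 2 powr u * C\<^sup>2 * (\<Sum>n<N. r n powr u)"
proof -
  have "\<exists>j Z. 1 / 2 ^ j < 2 * r n \<and> finite Z \<and> card Z \<le> 3 ^ CARD('d)
          \<and> ball (x n) (r n) \<subseteq> (\<Union>z\<in>Z. dyadic_cube j z)" if n: "n < N" for n
  proof -
    obtain j where j: "r n \<le> 1 / 2 ^ j" "1 / 2 ^ j < 2 * r n" using dyadic_scale_exists r[OF n] by blast
    then show ?thesis using ball_covered_by_cubes[OF j(1), of "x n"] by blast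
  qed
  then have "\<forall>n. \<exists>j Z. n < N \<longrightarrow> 1 / 2 ^ j < 2 * r n \<and> finite Z \<and> card Z \<le> 3 ^ CARD('d)
          \<and> ball (x n) (r n) \<subseteq> (\<Union>z\<in>Z. dyadic_cube j z)" by blast
  from choice[OF this] obtain j where "\<forall>n. \<exists>Z. n < N \<longrightarrow> 1 / 2 ^ j n < 2 * r n \<and> finite Z \<and> card Z \<le> 3 ^ CARD('d)
          \<and> ball (x n) (r n) \<subseteq> (\<Union>z\<in>Z. dyadic_cube (j n) z)" by blast
  from choice[OF this] obtain Z where jZ: "\<And>n. n < N \<Longrightarrow> 1 / 2 ^ j n < 2 * r n \<and> finite (Z n) \<and> card (Z n) \<le> 3 ^ CARD('d)
          \<and> ball (x n) (r n) \<subseteq> (\<Union>z\<in>Z n. dyadic_cube (j n) z)"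
    by blast
  define F where "F = (\<Union>n<N. {j n} \<times> Z n)"
  have F: "finite F" unfolding F_def using jZ by auto
  have "K \<subseteq> (\<Union>(j, z)\<in>F. dyadic_cube j z)"
  proof
    fix y assume "y \<in> K"
    then obtain n where n: "n < N" "y \<in> ball (x n) (r n)" using cover by auto
    then obtain z where "z \<in> Z n" "y \<in> dyadic_cube (j n) z" using jZ[OF n(1)] by auto
    then have "(j n, z) \<in> F" "y \<in> dyadic_cube (j n) z" using n(1) by (auto simp: F_def)
    then show "y \<in> (\<Union>(j, z)\<in>F. dyadic_cube j z)" by (auto intro!: bexI[of _ "(j n, z)"])
  qed
  then have "m \<le> (\<Sum>(j, z)\<in>F. \<mu> (dyadic_cube j z))" using mass F by blast
  also have "\<dots> = (\<Sum>(j, z)\<in>F. 2 powr (- u * real j / 2) * (2 powr (u * real j / 2) * \<mu> (dyadic_cube j z)))"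
    by (intro sum.cong refl) (simp add: case_prod_unfold powr_minus)
  also have "\<dots> \<le> (\<Sum>p\<in>F. \<bar>case p of (j, z) \<Rightarrow> 2 powr (- u * real j / 2)\<bar> *
                    \<bar>case p of (j, z) \<Rightarrow> 2 powr (u * real j / 2) * \<mu> (dyadic_cube j z)\<bar>)"
    by (intro sum_mono) (auto simp: abs_mult mult_left_mono)
  also have "\<dots> \<le> L2_set (\<lambda>(j, z). 2 powr (- u * real j / 2)) F *
                    L2_set (\<lambda>(j, z). 2 powr (u * real j / 2) * \<mu> (dyadic_cube j z)) F"
    by (rule L2_set_mult_ineq)
  also have "\<dots> \<le> L2_set (\<lambda>(j, z). 2 powr (- u * real j / 2)) F * C"
    using energy F unfolding energy_close_def by (intro mult_left_mono L2_set_nonneg) auto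
  finally have "m\<^sup>2 \<le> (L2_set (\<lambda>(j, z). 2 powr (- u * real j / 2)) F * C)\<^sup>2"
    using \<open>0 \<le> m\<close> by (rule power_mono)
  also have "\<dots> = (\<Sum>(j, z)\<in>F. 2 powr (- u * real j)) * C\<^sup>2"
    by (simp add: L2_set_def power_mult_distrib sum_nonneg power2_eq_square case_prod_unfold flip: powr_add)
  also have "(\<Sum>(j, z)\<in>F. 2 powr (- u * real j)) * C\<^sup>2 \<le> (\<Sum>n<N. \<Sum>(j, z)\<in>{j n} \<times> Z n. 2 powr (- u * real j)) * C\<^sup>2"
  proof -
    have F_eq: "F = snd ` (SIGMA n:{..<N}. {j n} \<times> Z n)" unfolding F_def by force
    have fin: "finite (SIGMA n:{..<N}. {j n} \<times> Z n)" using jZ by auto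
    have "(\<Sum>(j, z)\<in>F. 2 powr (- u * real j)) \<le> sum ((\<lambda>(j, z). 2 powr (- u * real j)) \<circ> snd) (SIGMA n:{..<N}. {j n} \<times> Z n)"
      unfolding F_eq by (rule sum_image_le) (use fin in auto)
    also have "\<dots> = (\<Sum>n<N. \<Sum>(j, z)\<in>{j n} \<times> Z n. 2 powr (- u * real j))"
      using jZ by (subst sum.Sigma) (auto intro!: sum.cong)
    finally show ?thesis by (rule mult_right_mono) simp
  qed
  also have "\<dots> \<le> (\<Sum>n<N. 3 ^ CARD('d) * (2 powr u * r n powr u)) * C\<^sup>2"
  proof (rule mult_right_mono[OF sum_mono])
    fix n assume n: "n \<in> {..<N}"
    then have jn: "1 / 2 ^ j n < 2 * r n" "card (Z n) \<le> 3 ^ CARD('d)" using jZ by auto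
    have "(\<Sum>(j, z)\<in>{j n} \<times> Z n. 2 powr (- u * real j)) = real (card (Z n)) * 2 powr (- u * real (j n))"
      by (simp add: sum.cartesian_product[symmetric])
    also have "\<dots> \<le> 3 ^ CARD('d) * 2 powr (- u * real (j n))"
      using jn(2) by (intro mult_right_mono) (simp_all flip: of_nat_le_iff)
    also have "2 powr (- u * real (j n)) = (1 / 2 ^ j n) powr u"
      by (simp add: powr_divide powr_minus_divide powr_realpow[symmetric] powr_powr mult.commute)
    also have "\<dots> \<le> (2 * r n) powr u" using jn(1) \<open>0 \<le> u\<close> by (intro powr_mono2) auto
    also have "\<dots> = 2 powr u * r n powr u" by (rule powr_mult)
    finally show "(\<Sum>(j, z)\<in>{j n} \<times> Z n. 2 powr (- u * real j)) \<le> 3 ^ CARD('d) * (2 powr u * r n powr u)" by simp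
  qed simp
  finally show ?thesis
    by (simp add: sum_distrib_left sum_distrib_right mult_ac mult_right_mono)
qed

lemma diam_pow_lower:
  assumes "0 \<le> \<sigma>" "\<sigma> \<le> u" "0 < u" "V \<noteq> {}" "bounded V" "diameter V \<le> 1"
  shows "ennreal (diameter V powr u) \<le> diam_pow \<sigma> V"
proof -
  have d0: "0 \<le> diameter V" using assms by (simp add: diameter_ge_0)
  have "diameter V powr u \<le> diameter V powr \<sigma>"
    using d0 assms by (cases "diameter V = 0") (auto intro: powr_mono')
  moreover have "diameter V powr u \<le> 1"
    using d0 assms powr_mono2[of u "diameter V" 1] by simp
  ultimately show ?thesis
    using assms by (auto simp: diam_pow_def ennreal_leI intro: order_trans[OF _ ennreal_leI])
qed

lemma hausdorff_measure_nonzeroI: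
  assumes "0 < \<delta>" "0 < c"
    and "\<And>V. (\<And>n. bounded (V n) \<and> diameter (V n) \<le> \<delta>) \<Longrightarrow> E \<subseteq> (\<Union>n. V n) \<Longrightarrow> ennreal c \<le> (\<Sum>n. diam_pow \<sigma> (V n))"
  shows "hausdorff_measure \<sigma> E \<noteq> 0"
proof -
  have "ennreal c \<le> hausdorff_premeasure \<sigma> \<delta> E"
    unfolding hausdorff_premeasure_def using assms(3) by (intro INF_greatest) auto
  also have "\<dots> \<le> hausdorff_measure \<sigma> E"
    unfolding hausdorff_measure_def using assms(1) by (intro SUP_upper) auto
  finally show ?thesis using assms(2) by auto
qed

lemma decreasing_compact_subset_open:
  fixes K :: "nat \<Rightarrow> 'a::heine_borel set"
  assumes "\<And>n. compact (K n)" "\<And>n. K (Suc n) \<subseteq> K n" "open U" "(\<Inter>n. K n) \<subseteq> U"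
  shows "\<exists>n. K n \<subseteq> U"
proof (rule ccontr)
  assume "\<nexists>n. K n \<subseteq> U"
  then have ne: "K n - U \<noteq> {}" for n by auto
  have dec: "K n \<subseteq> K m" if "m \<le> n" for m n
    using decseqD[OF decseq_SucI[of K] that] assms(2) by blast
  have "\<Inter> (range (\<lambda>n. K n - U)) \<noteq> {}"
  proof (rule compact_nest)
    show "K n - U \<subseteq> K m - U" if "m \<le> n" for m n using dec[OF that] by blast
    show "compact (K n - U)" for n by (rule compact_diff[OF assms(1,3)])
    show "K n - U \<noteq> {}" for n by (rule ne)
  qed
  then show False using assms(4) by auto
qed

text \<open>The countable cover of the limit set is replaced by a cover by open balls of slightly larger
  diameters; by compactness finitely many of them cover some stage \<open>K n\<close> already, and the energy
  bound for that stage applies.\<close>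

lemma hausdorff_measure_nonzero_of_energy:
  fixes K :: "nat \<Rightarrow> (real ^ 'd) set" and \<mu> :: "nat \<Rightarrow> (real ^ 'd) set \<Rightarrow> real"
  assumes K: "\<And>n. compact (K n)" "\<And>n. K (Suc n) \<subseteq> K n" "(\<Inter>n. K n) \<subseteq> E"
    and energy: "\<And>n. energy_close u (\<mu> n) (\<lambda>_. 0) C"
    and mass: "\<And>n F. finite F \<Longrightarrow> K n \<subseteq> (\<Union>(j, z)\<in>F. dyadic_cube j z) \<Longrightarrow>
        m \<le> (\<Sum>(j, z)\<in>F. \<mu> n (dyadic_cube j z))"
    and "0 < m" "0 \<le> C" "0 < u" "0 \<le> \<sigma>" "\<sigma> \<le> u"
  shows "hausdorff_measure \<sigma> E \<noteq> 0"
proof -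
  define A where "A = 3 ^ CARD('d) * 2 powr u * C\<^sup>2"
  have A: "0 \<le> A" unfolding A_def by simp
  define c where "c = min (m\<^sup>2 / (4 * (A + 1))) (1 - (1/2) powr u)"
  have half: "(1/2::real) powr u < 1" using \<open>0 < u\<close> by (simp add: powr_divide)
  have c: "0 < c" "c \<le> 1 - (1/2) powr u" using half \<open>0 < m\<close> A by (auto simp: c_def)
  have cA: "A * (2 * c) < m\<^sup>2"
  proof -
    have "c \<le> m\<^sup>2 / (4 * (A + 1))" by (simp add: c_def)
    then have "c * (4 * (A + 1)) \<le> m\<^sup>2" using A by (simp add: pos_le_divide_eq)
    moreover have "c * (4 * (A + 1)) = A * (2 * c) + 2 * (c * A) + 4 * c" by (simp add: algebra_simps)
    moreover have "0 \<le> c * A" using c A by simp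
    ultimately show ?thesis using c(1) by linarith
  qed
  show ?thesis
  proof (rule hausdorff_measure_nonzeroI[of "1/2" c])
    fix V :: "nat \<Rightarrow> (real ^ 'd) set"
    assume V: "\<And>n. bounded (V n) \<and> diameter (V n) \<le> 1 / 2" and cov: "E \<subseteq> (\<Union>n. V n)"
    show "ennreal c \<le> (\<Sum>n. diam_pow \<sigma> (V n))"
    proof (rule ccontr)
      assume "\<not> ?thesis"
      then have small: "(\<Sum>n. diam_pow \<sigma> (V n)) < ennreal c" by simp
      define g where "g n = (if V n = {} then 0 else diameter (V n) powr u)" for n
      have g0: "0 \<le> g n" for n by (simp add: g_def)
      have g1: "g n \<le> (1/2) powr u" for n
        using V[of n] \<open>0 < u\<close> by (auto simp: g_def diameter_ge_0 intro!: powr_mono2)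
      have gsum: "(\<Sum>n<N. g n) \<le> c" for N
      proof -
        have "ennreal (\<Sum>n<N. g n) = (\<Sum>n<N. ennreal (g n))" using g0 by (simp add: sum_ennreal)
        also have "\<dots> \<le> (\<Sum>n<N. diam_pow \<sigma> (V n))"
        proof (rule sum_mono)
          fix n
          have "diameter (V n) \<le> 1" using V[of n] by linarith
          then show "ennreal (g n) \<le> diam_pow \<sigma> (V n)"
            using V[of n] assms by (auto simp: g_def intro!: diam_pow_lower)
        qed
        also have "\<dots> \<le> (\<Sum>n. diam_pow \<sigma> (V n))" by (rule sum_le_suminf) auto
        finally show ?thesis using small c(1) by (metis ennreal_le_iff less_imp_le order.strict_trans1)
      qed
      \<comment> \<open>Chosen so that the \<open>u\<close>-th powers exceed those of the diameters by a summable amount.\<close>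
  define r where "r n = (g n + c / 2 ^ Suc n) powr (1 / u)" for n
      have pos: "0 < g n + c / 2 ^ Suc n" for n using g0[of n] c(1) by (simp add: add_nonneg_pos)
      have r_u: "r n powr u = g n + c / 2 ^ Suc n" for n
        using pos[of n] \<open>0 < u\<close> by (simp add: r_def powr_powr)
      have r0: "0 < r n" for n using pos[of n] by (simp add: r_def)
      have r1: "r n \<le> 1" for n
      proof -
        have "c / 2 ^ Suc n \<le> c / 1" using c(1) by (intro divide_left_mono one_le_power) auto
        then have "g n + c / 2 ^ Suc n \<le> 1" using g1[of n] c(2) by simp
        then show ?thesis
          unfolding r_def using pos[of n] \<open>0 < u\<close> powr_mono2[of "1/u" "g n + c / 2 ^ Suc n" 1] by simp
      qed
      define x where "x n = (SOME x. x \<in> V n)" for n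
      have V_ball: "V n \<subseteq> ball (x n) (r n)" for n
      proof
        fix y assume y: "y \<in> V n"
        then have xn: "x n \<in> V n" unfolding x_def by (metis someI)
        have "diameter (V n) < r n"
        proof (rule ccontr)
          assume "\<not> ?thesis"
          then have "r n powr u \<le> diameter (V n) powr u" using r0[of n] \<open>0 < u\<close> by (intro powr_mono2) auto
          moreover have "V n \<noteq> {}" using y by auto
          moreover have "0 < c / 2 ^ Suc n" using c(1) by simp
          ultimately show False by (simp only: r_u g_def if_False)
        qed
        moreover have "dist (x n) y \<le> diameter (V n)" using V xn y by (intro diameter_bounded_bound) auto
        ultimately show "y \<in> ball (x n) (r n)" by simp
      qed
      have "(\<Union>n. V n) \<subseteq> (\<Union>n. ball (x n) (r n))" by (intro UN_mono V_ball subset_refl)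
      then have sub: "(\<Inter>n. K n) \<subseteq> (\<Union>n. ball (x n) (r n))"
        by (rule subset_trans[OF subset_trans[OF K(3) cov]])
      have "open (\<Union>n. ball (x n) (r n))" by (intro open_UN ballI open_ball)
      from decreasing_compact_subset_open[of K, OF K(1) K(2) this sub]
      obtain k where k: "K k \<subseteq> (\<Union>n. ball (x n) (r n))" by (elim exE)
      obtain I where I: "finite I" "K k \<subseteq> (\<Union>n\<in>I. ball (x n) (r n))"
        by (rule compactE_image[OF K(1)[of k] _ k]) auto
      define N where "N = Suc (Max (insert 0 I))"
      have "I \<subseteq> {..<N}" 
        using Max_ge[of "insert 0 I"] I(1) unfolding N_def by (simp add: subset_eq less_Suc_eq_le)
      then have KN: "K k \<subseteq> (\<Union>n<N. ball (x n) (r n))" using I(2) by blast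
      have "m\<^sup>2 \<le> A * (\<Sum>n<N. r n powr u)"
        unfolding A_def
        by (rule energy_covering_bound[OF energy mass KN])
           (use r0 r1 \<open>0 < m\<close> \<open>0 \<le> C\<close> \<open>0 < u\<close> in \<open>auto intro: less_imp_le\<close>)
      also have "A * (\<Sum>n<N. r n powr u) \<le> A * (2 * c)"
      proof -
        have "(\<Sum>n<N. c / 2 ^ Suc n) = c * (1 - 1 / 2 ^ N)"
          by (induction N) (simp_all add: field_simps)
        also have "\<dots> \<le> c" using c(1) by (simp add: mult_le_cancel_left1)
        finally have "(\<Sum>n<N. r n powr u) \<le> 2 * c" using gsum[of N] by (simp add: r_u sum.distrib)
        then show ?thesis using A by (rule mult_left_mono)
      qed
      finally show False using cA by simp
    qed
  qed (use c in auto)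
qed

section \<open>Step densities and their refinement\<close>

text \<open>A step density is a list of triples \<open>(c, a, b)\<close>, standing for the sum of the functions with the
  constant value \<open>c\<close> on the box \<open>cbox a b\<close>.\<close>

type_synonym 'd step_density = "(real \<times> (real ^ 'd) \<times> (real ^ 'd)) list"

definition step_mass :: "'d::finite step_density \<Rightarrow> (real ^ 'd) set \<Rightarrow> real" where
  "step_mass S Q = (\<Sum>(c, a, b)\<leftarrow>S. c * leb (cbox a b \<inter> Q))"

definition step_support :: "'d::finite step_density \<Rightarrow> (real ^ 'd) set" where
  "step_support S = (\<Union>(c, a, b)\<in>set S. cbox a b)"

definition step_valid :: "'d::finite step_density \<Rightarrow> bool" where
  "step_valid S \<longleftrightarrow> (\<forall>(c, a, b)\<in>set S. 0 \<le> c \<and> (\<forall>i. a $ i < b $ i))"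

lemma step_simps:
  "step_mass [] Q = 0" "step_mass ((c, a, b) # S) Q = c * leb (cbox a b \<inter> Q) + step_mass S Q"
  "step_mass (S @ S') Q = step_mass S Q + step_mass S' Q"
  "step_support [] = {}" "step_support ((c, a, b) # S) = cbox a b \<union> step_support S"
  "step_support (S @ S') = step_support S \<union> step_support S'"
  "step_valid []" "step_valid ((c, a, b) # S) \<longleftrightarrow> 0 \<le> c \<and> (\<forall>i. a $ i < b $ i) \<and> step_valid S"
  "step_valid (S @ S') \<longleftrightarrow> step_valid S \<and> step_valid S'"
  by (auto simp: step_mass_def step_support_def step_valid_def ball_Un)

lemma step_scale:
  shows "step_mass (map (\<lambda>(c, a, b). (r * c, a, b)) S) Q = r * step_mass S Q"
    and "step_support (map (\<lambda>(c, a, b). (r * c, a, b)) S) = step_support S"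
    and "0 \<le> r \<Longrightarrow> step_valid S \<Longrightarrow> step_valid (map (\<lambda>(c, a, b). (r * c, a, b)) S)"
  by (induction S) (auto simp: step_simps algebra_simps)

lemma compact_step_support: "compact (step_support S)"
  unfolding step_support_def by (intro compact_UN) auto

lemma step_mass_le_cover:
  assumes "step_valid S" "finite F" "\<And>i. i \<in> F \<Longrightarrow> D i \<in> sets borel" "D0 \<in> sets borel"
    and "step_support S \<subseteq> (\<Union>i\<in>F. D i)"
  shows "step_mass S D0 \<le> (\<Sum>i\<in>F. step_mass S (D i))"
  using assms(1,5)
proof (induction S)
  case (Cons t S)
  obtain c a b where t: "t = (c, a, b)" by (cases t) auto
  have "leb (cbox a b \<inter> D0) \<le> leb (\<Union>i\<in>F. cbox a b \<inter> D i)"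
    using Cons.prems assms(2,3,4)
    by (intro measure_mono_fmeasurable)
       (auto simp: t step_simps intro!: fmeasurableI2[OF fmeasurable_cbox[of a b]])
  also have "\<dots> \<le> (\<Sum>i\<in>F. leb (cbox a b \<inter> D i))"
    using assms(2,3) by (intro measure_UNION_le) auto
  finally have "c * leb (cbox a b \<inter> D0) \<le> (\<Sum>i\<in>F. c * leb (cbox a b \<inter> D i))"
    using Cons.prems(1) by (simp add: t step_simps sum_distrib_left[symmetric] mult_left_mono)
  moreover have "step_mass S D0 \<le> (\<Sum>i\<in>F. step_mass S (D i))"
    using Cons by (auto simp: t step_simps)
  ultimately show ?case by (simp add: t step_simps sum.distrib)
qed (simp add: step_simps)

lemma sum_measure_dyadic_le:
  assumes "finite Z" "B \<in> fmeasurable lborel"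
  shows "(\<Sum>z\<in>Z. leb (B \<inter> dyadic_box e z)) \<le> leb B"
proof -
  have B: "B \<in> sets lborel" using assms(2) by auto
  have "(\<Sum>z\<in>Z. leb (B \<inter> dyadic_box e z)) = leb (\<Union>z\<in>Z. B \<inter> dyadic_box e z)"
  proof (rule measure_finite_Union[symmetric])
    show "disjoint_family_on (\<lambda>z. B \<inter> dyadic_box e z) Z"
      using dyadic_box_disjoint by (force simp: disjoint_family_on_def)
    show "emeasure lborel (B \<inter> dyadic_box e z) \<noteq> \<infinity>" for z
      using fmeasurable_Int_fmeasurable[OF assms(2), of "dyadic_box e z"] by (auto simp: fmeasurable_def)
  qed (use assms B in auto)
  also have "\<dots> \<le> leb B" using assms B by (intro measure_mono_fmeasurable) auto
  finally show ?thesis .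
qed

lemma energy_close_by_levels:
  assumes level: "\<And>j Z. finite Z \<Longrightarrow> (\<Sum>z\<in>Z. (\<mu> (dyadic_cube j z) - \<nu> (dyadic_cube j z))\<^sup>2) \<le> E j"
    and total: "\<And>J. (\<Sum>j<J. 2 powr (u * real j) * E j) \<le> \<epsilon>\<^sup>2" and "0 \<le> \<epsilon>"
  shows "energy_close u \<mu> \<nu> \<epsilon>"
  unfolding energy_close_def
proof (intro allI impI)
  fix F :: "(nat \<times> ('a \<Rightarrow> int)) set" assume F: "finite F"
  define J where "J = Suc (Max (insert 0 (fst ` F)))"
  have sub: "F \<subseteq> {..<J} \<times> snd ` F"
  proof
    fix p assume p: "p \<in> F"
    then have "fst p \<le> Max (insert 0 (fst ` F))" using F by (intro Max_ge) auto
    then show "p \<in> {..<J} \<times> snd ` F" using p by (cases p) (force simp: J_def)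
  qed
  have "(\<Sum>p\<in>F. (case p of (j, z) \<Rightarrow> 2 powr (u * real j / 2) * (\<mu> (dyadic_cube j z) - \<nu> (dyadic_cube j z)))\<^sup>2)
      \<le> (\<Sum>p\<in>{..<J} \<times> snd ` F. (case p of (j, z) \<Rightarrow> 2 powr (u * real j / 2) * (\<mu> (dyadic_cube j z) - \<nu> (dyadic_cube j z)))\<^sup>2)"
    using F sub by (intro sum_mono2) auto
  also have "\<dots> = (\<Sum>j<J. \<Sum>z\<in>snd ` F. (2 powr (u * real j / 2) * (\<mu> (dyadic_cube j z) - \<nu> (dyadic_cube j z)))\<^sup>2)"
    by (simp add: sum.cartesian_product case_prod_unfold)
  also have "\<dots> = (\<Sum>j<J. 2 powr (u * real j) * (\<Sum>z\<in>snd ` F. (\<mu> (dyadic_cube j z) - \<nu> (dyadic_cube j z))\<^sup>2))"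
  proof -
    have "(2 powr (u * real j / 2))\<^sup>2 = 2 powr (u * real j)" for j
      by (simp add: power2_eq_square flip: powr_add)
    then show ?thesis by (simp add: power_mult_distrib sum_distrib_left)
  qed
  also have "\<dots> \<le> (\<Sum>j<J. 2 powr (u * real j) * E j)"
    using F by (intro sum_mono mult_left_mono level) auto
  also have "\<dots> \<le> \<epsilon>\<^sup>2" by (rule total)
  finally show "L2_set (\<lambda>(j, z). 2 powr (u * real j / 2) * (\<mu> (dyadic_cube j z) - \<nu> (dyadic_cube j z))) F \<le> \<epsilon>"
    unfolding L2_set_def using \<open>0 \<le> \<epsilon>\<close> by (intro real_le_lsqrt) (auto simp: sum_nonneg)
qed

lemma geometric_partial_sum_le:
  fixes q :: real
  assumes "0 \<le> q" "q < 1"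
  shows "(\<Sum>j<J. q ^ j) \<le> 1 / (1 - q)"
proof -
  have "(\<Sum>j<J. q ^ j) = (1 - q ^ J) / (1 - q)" using assms by (simp add: sum_gp_strict)
  also have "\<dots> \<le> 1 / (1 - q)" using assms by (intro divide_right_mono) auto
  finally show ?thesis .
qed

lemma box_level_energy:
  fixes B :: "(real ^ 'd) set"
  assumes "finite Z" "B \<in> fmeasurable lborel"
  shows "(\<Sum>z\<in>Z. (leb (B \<inter> dyadic_cube j z))\<^sup>2) \<le> leb B * (1 / 2 ^ CARD('d)) ^ j"
proof -
  have le: "leb (B \<inter> dyadic_cube j z) \<le> (1 / 2 ^ CARD('d)) ^ j" for z
  proof -
    have "leb (B \<inter> dyadic_cube j z) \<le> leb (dyadic_cube j z)"
      using assms(2) by (intro measure_mono_fmeasurable) auto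
    also have "\<dots> = (1 / 2 ^ CARD('d)) ^ j"
      by (simp add: measure_dyadic_box power_divide flip: power_mult)
    finally show ?thesis .
  qed
  have "(\<Sum>z\<in>Z. (leb (B \<inter> dyadic_cube j z))\<^sup>2) \<le> (\<Sum>z\<in>Z. leb (B \<inter> dyadic_cube j z) * (1 / 2 ^ CARD('d)) ^ j)"
    unfolding power2_eq_square using le by (intro sum_mono mult_left_mono) auto
  also have "\<dots> = (\<Sum>z\<in>Z. leb (B \<inter> dyadic_cube j z)) * (1 / 2 ^ CARD('d)) ^ j"
    by (simp add: sum_distrib_right)
  also have "\<dots> \<le> leb B * (1 / 2 ^ CARD('d)) ^ j"
    using sum_measure_dyadic_le[OF assms] by (intro mult_right_mono) auto
  finally show ?thesis .
qed

lemma powr_mult_power_dim: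
  "2 powr (u * real j) * (1 / 2 ^ d) ^ j = (2 powr (u - real d)) ^ j"
  by (simp add: powr_diff powr_realpow[symmetric] power_divide powr_powr mult.commute flip: powr_mult_base)

lemma energy_box_finite:
  fixes a b :: "real ^ 'd"
  assumes "u < real CARD('d)"
  shows "\<exists>C\<ge>0. energy_close u (\<lambda>Q. leb (cbox a b \<inter> Q)) (\<lambda>_. 0) C"
proof -
  define q where "q = 2 powr (u - real CARD('d))"
  have q: "0 \<le> q" "q < 1" using assms by (auto simp: q_def powr_less_one)
  define V where "V = leb (cbox a b)"
  have V: "0 \<le> V" by (simp add: V_def)
  have "energy_close u (\<lambda>Q. leb (cbox a b \<inter> Q)) (\<lambda>_. 0) (sqrt (V / (1 - q)))"
  proof (rule energy_close_by_levels)
    show "(\<Sum>z\<in>Z. (leb (cbox a b \<inter> dyadic_cube j z) - 0)\<^sup>2) \<le> V * (1 / 2 ^ CARD('d)) ^ j"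
      if "finite Z" for j and Z :: "('d \<Rightarrow> int) set"
      using box_level_energy[OF that fmeasurable_cbox[of a b]] by (simp add: V_def)
    fix J
    have "(\<Sum>j<J. 2 powr (u * real j) * (V * (1 / 2 ^ CARD('d)) ^ j)) = V * (\<Sum>j<J. q ^ j)"
      unfolding q_def powr_mult_power_dim[symmetric] by (simp add: sum_distrib_left mult_ac)
    also have "\<dots> \<le> V * (1 / (1 - q))" using geometric_partial_sum_le[OF q] V by (rule mult_left_mono)
    also have "\<dots> = (sqrt (V / (1 - q)))\<^sup>2" using V q by simp
    finally show "(\<Sum>j<J. 2 powr (u * real j) * (V * (1 / 2 ^ CARD('d)) ^ j)) \<le> (sqrt (V / (1 - q)))\<^sup>2" .
  qed (use V q in auto)
  moreover have "0 \<le> sqrt (V / (1 - q))" using V q by simp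
  ultimately show ?thesis by blast
qed

lemma exists_charged_unit_cube:
  fixes a b :: "real ^ 'd"
  assumes "\<And>i. a $ i < b $ i"
  shows "\<exists>z. 0 < leb (cbox a b \<inter> dyadic_cube 0 z)"
proof (rule ccontr)
  assume "\<not> ?thesis"
  then have zero: "leb (cbox a b \<inter> dyadic_cube 0 z) = 0" for z
    by (metis measure_nonneg order.not_eq_order_implies_strict)
  have "cbox a b \<inter> dyadic_cube 0 z \<in> null_sets lborel" for z
  proof -
    have "cbox a b \<inter> dyadic_cube 0 z \<in> fmeasurable lborel" by (rule fmeasurable_Int_fmeasurable) auto
    then have "emeasure lborel (cbox a b \<inter> dyadic_cube 0 z) \<noteq> \<infinity>" by (auto simp: fmeasurable_def)
    then show ?thesis using zero[of z] by (auto simp: null_sets_def emeasure_eq_ennreal_measure)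
  qed
  then have "(\<Union>z. cbox a b \<inter> dyadic_cube 0 z) \<in> null_sets lborel" by (rule null_sets_UN)
  moreover have "(\<Union>z. cbox a b \<inter> dyadic_cube 0 z) = cbox a b" by (auto simp: dyadic_box_def)
  ultimately have "leb (cbox a b) = 0" by (simp add: measure_eq_0_null_sets)
  moreover have "0 < leb (cbox a b)"
    using assms by (subst measure_cbox_vec) (auto intro: less_imp_le prod_pos)
  ultimately show False by simp
qed

text \<open>Energy distances are homogeneous and satisfy the triangle inequality, so a whole step density can be
  refined once every single box can.\<close>

lemma step_refine:
  fixes G :: "nat \<Rightarrow> (real ^ 'd) set"
  assumes refine: "\<And>a b \<epsilon> n. cbox a b \<subseteq> X \<Longrightarrow> (\<And>i. a $ i < b $ i) \<Longrightarrow> 0 < \<epsilon> \<Longrightarrow>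
      \<exists>S. step_valid S \<and> step_support S \<subseteq> cbox a b \<inter> G n \<and>
          energy_close u (step_mass S) (\<lambda>Q. leb (cbox a b \<inter> Q)) \<epsilon>"
    and "step_valid S" "step_support S \<subseteq> X" "0 < \<epsilon>"
  shows "\<exists>S'. step_valid S' \<and> step_support S' \<subseteq> step_support S \<inter> G n \<and> energy_close u (step_mass S') (step_mass S) \<epsilon>"
  using assms(2-)
proof (induction S arbitrary: \<epsilon>)
  case Nil
  then show ?case by (intro exI[of _ "[]"]) (auto simp: step_simps energy_close_refl)
next
  case (Cons t S)
  obtain c a b where t: "t = (c, a, b)" by (cases t) auto
  have c: "0 \<le> c" "\<And>i. a $ i < b $ i" "cbox a b \<subseteq> X" and S: "step_valid S" "step_support S \<subseteq> X"
    using Cons.prems by (auto simp: t step_simps)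
  obtain S1 where S1: "step_valid S1" "step_support S1 \<subseteq> step_support S \<inter> G n"
    "energy_close u (step_mass S1) (step_mass S) (\<epsilon> / 2)"
    using Cons.IH[OF S, of "\<epsilon> / 2"] Cons.prems by auto
  obtain S2 where S2: "step_valid S2" "step_support S2 \<subseteq> cbox a b \<inter> G n"
    "energy_close u (step_mass S2) (\<lambda>Q. leb (cbox a b \<inter> Q)) (\<epsilon> / (2 * (c + 1)))"
    using refine[OF c(3,2), of "\<epsilon> / (2 * (c + 1))" n] Cons.prems c(1) by auto
  define S2' where "S2' = map (\<lambda>(r, a, b). (c * r, a, b)) S2"
  have "energy_close u (step_mass S2') (\<lambda>Q. c * leb (cbox a b \<inter> Q)) (c * (\<epsilon> / (2 * (c + 1))))"
  proof -
    have "step_mass S2' = (\<lambda>Q. c * step_mass S2 Q)" by (rule ext) (simp only: S2'_def step_scale(1))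
    then show ?thesis using energy_close_scale[OF S2(3) c(1)] by simp
  qed
  moreover have "c * (\<epsilon> / (2 * (c + 1))) \<le> \<epsilon> / 2" using c(1) Cons.prems(3) by (simp add: field_simps)
  ultimately have "energy_close u (step_mass S2') (\<lambda>Q. c * leb (cbox a b \<inter> Q)) (\<epsilon> / 2)"
    by (rule energy_close_mono)
  from energy_close_add[OF this S1(3)]
  have "energy_close u (step_mass (S2' @ S1)) (step_mass (t # S)) \<epsilon>"
    by (simp add: t step_simps energy_close_def)
  moreover have "step_valid (S2' @ S1)"
    using S1(1) step_scale(3)[OF c(1) S2(1)] by (simp only: step_simps S2'_def)
  moreover have "step_support (S2' @ S1) \<subseteq> step_support (t # S) \<inter> G n"
    using S1(2) S2(2) unfolding t step_simps S2'_def step_scale(2) by blast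
  ultimately show ?case by blast
qed

text \<open>Refining again and again, with errors that add up to little, gives nested supports that
  converge to a compact subset of every \<open>G n\<close>, while the energies stay bounded and a fixed unit cube
  keeps half of its mass.\<close>

lemma hausdorff_measure_nonzero_of_refinement:
  fixes G :: "nat \<Rightarrow> (real ^ 'd) set"
  assumes refine: "\<And>a b \<epsilon> n. cbox a b \<subseteq> X \<Longrightarrow> (\<And>i. a $ i < b $ i) \<Longrightarrow> 0 < \<epsilon> \<Longrightarrow>
      \<exists>S. step_valid S \<and> step_support S \<subseteq> cbox a b \<inter> G n \<and>
          energy_close u (step_mass S) (\<lambda>Q. leb (cbox a b \<inter> Q)) \<epsilon>"
    and box: "cbox a b \<subseteq> X" "\<And>i. a $ i < b $ i"
    and u: "0 < u" "u < real CARD('d)" and \<sigma>: "0 \<le> \<sigma>" "\<sigma> \<le> u"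
  shows "hausdorff_measure \<sigma> (cbox a b \<inter> (\<Inter>n. G n)) \<noteq> 0"
proof -
  obtain z where z: "0 < leb (cbox a b \<inter> dyadic_cube 0 z)"
    using exists_charged_unit_cube box(2) by blast
  define m where "m = leb (cbox a b \<inter> dyadic_cube 0 z) / 2"
  have m: "0 < m" using z by (simp add: m_def)
  define good where "good n S \<longleftrightarrow> step_valid S \<and> step_support S \<subseteq> X \<and> (n = (0::nat) \<longrightarrow> S = [(1, a, b)])" for n S
  have "\<exists>f. \<forall>n. good n (f n) \<and> (step_support (f (Suc n)) \<subseteq> step_support (f n) \<inter> G n \<and>
      energy_close u (step_mass (f (Suc n))) (step_mass (f n)) (m / 2 ^ Suc n))"
  proof (rule dependent_nat_choice)
    show "\<exists>S. good 0 S" using box by (auto simp: good_def step_simps)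
    show "\<exists>S'. good (Suc n) S' \<and> (step_support S' \<subseteq> step_support S \<inter> G n \<and>
        energy_close u (step_mass S') (step_mass S) (m / 2 ^ Suc n))" if "good n S" for S n
    proof -
      have "\<exists>S'. step_valid S' \<and> step_support S' \<subseteq> step_support S \<inter> G n \<and> energy_close u (step_mass S') (step_mass S) (m / 2 ^ Suc n)"
        by (rule step_refine[OF refine]) (use that m in \<open>auto simp: good_def\<close>)
      then show ?thesis using that by (auto simp: good_def)
    qed
  qed
  then obtain f where f: "\<And>n. good n (f n)" "\<And>n. step_support (f (Suc n)) \<subseteq> step_support (f n) \<inter> G n"
    "\<And>n. energy_close u (step_mass (f (Suc n))) (step_mass (f n)) (m / 2 ^ Suc n)" by blast
  have f0: "step_support (f 0) = cbox a b" "step_mass (f 0) = (\<lambda>Q. leb (cbox a b \<inter> Q))"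
    using f(1)[of 0] by (auto simp: good_def step_simps)
  have close0: "energy_close u (step_mass (f n)) (step_mass (f 0)) (m * (1 - 1 / 2 ^ n))" for n
  proof (induction n)
    case 0
    then show ?case by (simp add: energy_close_refl)
  next
    case (Suc n)
    show ?case
      by (rule energy_close_mono[OF energy_close_trans[OF f(3)[of n] Suc]]) (simp add: field_simps)
  qed
  have close: "energy_close u (step_mass (f n)) (step_mass (f 0)) m" for n
    by (rule energy_close_mono[OF close0]) (use m in \<open>simp add: algebra_simps\<close>)
  obtain C where C: "0 \<le> C" "energy_close u (step_mass (f 0)) (\<lambda>_. 0) C"
    using energy_box_finite[OF u(2), of a b] f0(2) by auto
  show ?thesis
  proof (rule hausdorff_measure_nonzero_of_energy[where K = "\<lambda>n. step_support (f n)" and \<mu> = "\<lambda>n. step_mass (f n)"])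
    show "energy_close u (step_mass (f n)) (\<lambda>_. 0) (m + C)" for n
      using energy_close_trans[OF close C(2)] .
    show "(\<Inter>n. step_support (f n)) \<subseteq> cbox a b \<inter> (\<Inter>n. G n)"
      using f(2) f0(1) by blast
    show "m \<le> (\<Sum>(j, z)\<in>F. step_mass (f n) (dyadic_cube j z))"
      if F: "finite F" "step_support (f n) \<subseteq> (\<Union>(j, z)\<in>F. dyadic_cube j z)" for n F
    proof -
      have "\<bar>step_mass (f n) (dyadic_cube 0 z) - step_mass (f 0) (dyadic_cube 0 z)\<bar> \<le> m"
        using close by (rule energy_close_unit_cube)
      then have "m \<le> step_mass (f n) (dyadic_cube 0 z)" by (simp only: f0(2) m_def abs_le_iff) (simp add: field_simps)
      also have "\<dots> \<le> (\<Sum>p\<in>F. step_mass (f n) (case p of (j, z) \<Rightarrow> dyadic_cube j z))"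
        using f(1)[of n] F by (intro step_mass_le_cover) (auto simp: good_def split: prod.splits)
      finally show ?thesis by (simp add: case_prod_unfold)
    qed
  qed (use f(2) u \<sigma> m C(1) in \<open>auto simp: compact_step_support\<close>)
qed

section \<open>The self-affine set of a diagonal system\<close>

text \<open>The point \<open>\<pi> (a)\<close>, written out in coordinates as a power series in the contraction ratios. It is linear in the
  parameter \<open>t\<close>, which is what the transversality argument uses.\<close>

definition code_point :: "('d::finite \<Rightarrow> real) \<Rightarrow> real ^ 'd ^ 'i \<Rightarrow> (nat \<Rightarrow> 'i::finite) \<Rightarrow> real ^ 'd" where
  "code_point l t a = (\<chi> i. \<Sum>q. l i ^ q * t $ a q $ i)"

definition prepend :: "'i list \<Rightarrow> (nat \<Rightarrow> 'i) \<Rightarrow> nat \<Rightarrow> 'i" where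
  "prepend w a q = (if q < length w then w ! q else a (q - length w))"

text \<open>The composition of the maps along the word \<open>w\<close>, first letter outermost.\<close>

definition word_map :: "('d::finite \<Rightarrow> real) \<Rightarrow> real ^ 'd ^ 'i \<Rightarrow> 'i::finite list \<Rightarrow> real ^ 'd \<Rightarrow> real ^ 'd" where
  "word_map l t w x = (\<chi> i. l i ^ length w * x $ i + (\<Sum>q<length w. l i ^ q * t $ (w ! q) $ i))"

lemma word_map_Nil [simp]: "word_map l t [] x = x"
  by (simp add: word_map_def)

lemma word_map_Cons_nth: "word_map l t (c # w) x $ i = l i * word_map l t w x $ i + t $ c $ i"
proof -
  have "(\<Sum>q<Suc (length w). l i ^ q * t $ ((c # w) ! q) $ i)
      = t $ c $ i + l i * (\<Sum>q<length w. l i ^ q * t $ (w ! q) $ i)"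
    unfolding sum.lessThan_Suc_shift by (simp add: sum_distrib_left mult.assoc)
  then show ?thesis by (simp only: word_map_def vec_lambda_beta length_Cons power_Suc) (simp add: algebra_simps)
qed

lemma word_map_append: "word_map l t (v @ w) x = word_map l t v (word_map l t w x)"
  by (induction v) (simp_all add: word_map_Cons_nth vec_eq_iff)

lemma word_map_diff_nth: "word_map l t w x $ i - word_map l t w y $ i = l i ^ length w * (x $ i - y $ i)"
  by (simp add: word_map_def algebra_simps)

lemma prepend_append: "prepend (v @ w) a = prepend v (prepend w a)"
  by (auto simp: prepend_def fun_eq_iff nth_append)

lemma diag_matrix_nth: "(diag_matrix l *v x) $ i = l i * x $ i"
proof -
  have "(\<Sum>j\<in>UNIV. (if i = j then l i else 0) * x $ j) = (\<Sum>j\<in>UNIV. if i = j then l i * x $ j else 0)"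
    by (intro sum.cong) auto
  then show ?thesis by (simp add: diag_matrix_def matrix_vector_mult_def)
qed

lemma det_diag_matrix: "det (diag_matrix l) = (\<Prod>i\<in>UNIV. l i)"
  by (subst det_diagonal) (auto simp: diag_matrix_def)

lemma parameter_component_le: "\<bar>t $ c $ i\<bar> \<le> norm t" for t :: "real ^ 'd ^ 'i"
  by (rule order_trans[OF component_le_norm_cart Finite_Cartesian_Product.norm_nth_le])

lemma power_times_eventually_small:
  fixes q :: real
  assumes "0 \<le> q" "q < 1" "0 < \<epsilon>"
  shows "\<exists>N. \<forall>n\<ge>N. q ^ n * K < \<epsilon>"
proof -
  have "(\<lambda>n. q ^ n * K) \<longlonglongrightarrow> 0 * K"
    using assms by (intro tendsto_mult LIMSEQ_power_zero tendsto_const) simp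
  then have "eventually (\<lambda>n. q ^ n * K < \<epsilon>) sequentially"
    using assms by (intro order_tendstoD(2)) auto
  then show ?thesis by (auto simp: eventually_sequentially)
qed

locale diagonal_contraction =
  fixes l :: "'d::finite \<Rightarrow> real"
  assumes l_pos: "0 < l i" and l_half: "l i < 1 / 2"
begin

lemma geometric_sums_mult: "(\<lambda>q. l i ^ q * R) sums (1 / (1 - l i) * R)"
  using l_pos[of i] l_half[of i] by (intro sums_mult2 geometric_sums) simp

lemma code_series_abs_summable: "summable (\<lambda>q. \<bar>l i ^ q * t $ a q $ i\<bar>)"
proof -
  show ?thesis
  proof (rule summable_comparison_test'[OF sums_summable[OF geometric_sums_mult[of i "norm t"]], of 0])
    fix q
    have "l i ^ q * \<bar>t $ a q $ i\<bar> \<le> l i ^ q * norm t"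
      by (intro mult_left_mono zero_le_power less_imp_le[OF l_pos] parameter_component_le)
    then show "norm \<bar>l i ^ q * t $ a q $ i\<bar> \<le> l i ^ q * norm t"
      using l_pos[of i] by (simp add: abs_mult power_abs)
  qed
qed

lemma code_series_summable: "summable (\<lambda>q. l i ^ q * t $ a q $ i)"
  by (rule summable_rabs_cancel[OF code_series_abs_summable])

lemma code_point_bound:
  assumes "\<And>c. \<bar>t $ c $ i\<bar> \<le> R"
  shows "\<bar>code_point l t a $ i\<bar> \<le> 2 * R"
proof -
  have R0: "0 \<le> R" using assms[of "a 0"] by linarith
  have "\<bar>\<Sum>q. l i ^ q * t $ a q $ i\<bar> \<le> (\<Sum>q. \<bar>l i ^ q * t $ a q $ i\<bar>)"
    by (rule summable_rabs[OF code_series_abs_summable])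
  also have "\<dots> \<le> (\<Sum>q. l i ^ q * R)"
  proof (rule suminf_le[OF _ code_series_abs_summable sums_summable[OF geometric_sums_mult]])
    fix q
    have "l i ^ q * \<bar>t $ a q $ i\<bar> \<le> l i ^ q * R"
      by (intro mult_left_mono zero_le_power less_imp_le[OF l_pos] assms)
    then show "\<bar>l i ^ q * t $ a q $ i\<bar> \<le> l i ^ q * R"
      using l_pos[of i] by (simp add: abs_mult power_abs)
  qed
  also have "\<dots> = 1 / (1 - l i) * R" by (rule sums_unique[OF geometric_sums_mult, symmetric])
  also have "\<dots> \<le> 2 * R"
    using l_half[of i] R0 by (intro mult_right_mono) (simp_all add: field_simps)
  finally show ?thesis by (simp add: code_point_def)
qed

lemma code_point_prepend: "code_point l t (prepend w a) = word_map l t w (code_point l t a)"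
proof -
  have "(\<Sum>q. l i ^ q * t $ prepend w a q $ i) =
      l i ^ length w * (\<Sum>q. l i ^ q * t $ a q $ i) + (\<Sum>q<length w. l i ^ q * t $ (w ! q) $ i)" for i
  proof -
    have "(\<Sum>q. l i ^ q * t $ prepend w a q $ i)
        = (\<Sum>q. l i ^ (q + length w) * t $ prepend w a (q + length w) $ i) + (\<Sum>q<length w. l i ^ q * t $ prepend w a q $ i)"
      by (rule suminf_split_initial_segment[OF code_series_summable])
    also have "(\<Sum>q. l i ^ (q + length w) * t $ prepend w a (q + length w) $ i) = l i ^ length w * (\<Sum>q. l i ^ q * t $ a q $ i)"
      by (subst suminf_mult[OF code_series_summable, symmetric]) (simp add: prepend_def power_add mult_ac)
    also have "(\<Sum>q<length w. l i ^ q * t $ prepend w a q $ i) = (\<Sum>q<length w. l i ^ q * t $ (w ! q) $ i)"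
      by (intro sum.cong) (auto simp: prepend_def)
    finally show ?thesis .
  qed
  then show ?thesis by (simp add: code_point_def word_map_def vec_eq_iff)
qed

text \<open>Taking the closure gives compactness at once; it is shown to be invariant because finite unions and the
  affine homeomorphisms commute with closures.\<close>

definition attractor :: "real ^ 'd ^ 'i::finite \<Rightarrow> (real ^ 'd) set" where
  "attractor t = closure (range (code_point l t))"

lemma code_point_in_attractor: "code_point l t a \<in> attractor t"
  unfolding attractor_def by (rule subsetD[OF closure_subset rangeI])

lemma attractor_bound:
  assumes "\<And>c i. \<bar>t $ c $ i\<bar> \<le> R" "x \<in> attractor t"
  shows "\<bar>x $ i\<bar> \<le> 2 * R"
proof -
  have "closed {x::real ^ 'd. \<bar>x $ i\<bar> \<le> 2 * R}"
    by (intro closed_Collect_le continuous_intros)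
  moreover have "range (code_point l t) \<subseteq> {x. \<bar>x $ i\<bar> \<le> 2 * R}"
    using code_point_bound[of t i R, OF assms(1)] by (intro image_subsetI) simp
  ultimately have "attractor t \<subseteq> {x. \<bar>x $ i\<bar> \<le> 2 * R}"
    unfolding attractor_def by (intro closure_minimal)
  then show ?thesis using assms(2) by auto
qed

lemma compact_attractor: "compact (attractor t)"
proof -
  have "attractor t \<subseteq> cbox (\<chi> i. - (2 * norm t)) (\<chi> i. 2 * norm t)"
  proof
    fix x assume "x \<in> attractor t"
    then have "\<bar>x $ i\<bar> \<le> 2 * norm t" for i by (rule attractor_bound[OF parameter_component_le])
    then show "x \<in> cbox (\<chi> i. - (2 * norm t)) (\<chi> i. 2 * norm t)"
      by (simp add: mem_box_cart abs_le_iff minus_le_iff)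
  qed
  then have "bounded (attractor t)" using bounded_cbox bounded_subset by blast
  then show ?thesis unfolding attractor_def by (simp add: compact_eq_bounded_closed)
qed

lemma word_map_preimage:
  "word_map l t w (\<chi> i. y $ i + (x $ i - word_map l t w y $ i) / l i ^ length w) = x" (is "word_map l t w ?x' = x")
proof -
  have "word_map l t w ?x' $ i - word_map l t w y $ i = x $ i - word_map l t w y $ i" for i
    using l_pos[of i] by (simp add: word_map_diff_nth)
  then show ?thesis by (simp add: vec_eq_iff)
qed

lemma closure_word_map_image: "word_map l t w ` closure Y = closure (word_map l t w ` Y)"
proof -
  define f where "f x = (\<chi> i. l i ^ length w * x $ i)" for x :: "real ^ 'd"
  define b where "b = (\<chi> i. \<Sum>q<length w. l i ^ q * t $ (w ! q) $ i)"
  have f: "linear f" by (rule linearI) (auto simp: f_def vec_eq_iff algebra_simps)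
  have inj: "inj f" using l_pos by (auto simp: inj_def f_def vec_eq_iff less_imp_neq[symmetric])
  have "word_map l t w = (+) b \<circ> f"
    by (simp add: fun_eq_iff word_map_def f_def b_def vec_eq_iff)
  then have eq: "word_map l t w ` Z = (+) b ` (f ` Z)" for Z
    by (simp add: image_comp)
  show ?thesis unfolding eq closure_translation by (simp add: closure_injective_linear_image[OF f inj])
qed

lemma closure_finite_UN: "finite I \<Longrightarrow> closure (\<Union>i\<in>I. F i) = (\<Union>i\<in>I. closure (F i))"
  by (induction I rule: finite_induct) simp_all

lemma attractor_invariant: "attractor t = (\<Union>c. word_map l t [c] ` attractor t)"
proof -
  have "range (code_point l t) = (\<Union>c. word_map l t [c] ` range (code_point l t))"
  proof (intro equalityI subsetI)
    fix x assume "x \<in> range (code_point l t)"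
    then obtain a where x: "x = code_point l t a" by auto
    have "a = prepend [a 0] (\<lambda>q. a (Suc q))" by (auto simp: prepend_def fun_eq_iff)
    then have "x = word_map l t [a 0] (code_point l t (\<lambda>q. a (Suc q)))"
      using x code_point_prepend[of t "[a 0]" "\<lambda>q. a (Suc q)"] by simp
    then show "x \<in> (\<Union>c. word_map l t [c] ` range (code_point l t))" by auto
  next
    fix x assume "x \<in> (\<Union>c. word_map l t [c] ` range (code_point l t))"
    then obtain c a where "x = word_map l t [c] (code_point l t a)" by auto
    then have "x = code_point l t (prepend [c] a)" by (simp only: code_point_prepend)
    then show "x \<in> range (code_point l t)" by simp
  qed
  then have "closure (range (code_point l t)) = closure (\<Union>c\<in>UNIV. word_map l t [c] ` range (code_point l t))"
    by (rule arg_cong)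
  also have "\<dots> = (\<Union>c\<in>UNIV. closure (word_map l t [c] ` range (code_point l t)))"
    by (rule closure_finite_UN) simp
  finally show ?thesis unfolding attractor_def closure_word_map_image .
qed

lemma invariant_decompose:
  assumes "Y = (\<Union>c. word_map l t [c] ` Y)" "x \<in> Y"
  shows "\<exists>v y. length v = m \<and> y \<in> Y \<and> x = word_map l t v y"
proof (induction m)
  case 0
  then show ?case using assms(2) by (intro exI[of _ "[]"]) auto
next
  case (Suc m)
  then obtain v y where vy: "length v = m" "y \<in> Y" "x = word_map l t v y" by blast
  have "y \<in> (\<Union>c. word_map l t [c] ` Y)" using vy(2) assms(1) by (rule subst[rotated])
  then obtain c y' where "y' \<in> Y" "y = word_map l t [c] y'" by blast
  then show ?case using vy by (intro exI[of _ "v @ [c]"] exI[of _ y']) (auto simp: word_map_append)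
qed

lemma invariant_word_map:
  assumes "Y = (\<Union>c. word_map l t [c] ` Y)" "y \<in> Y"
  shows "word_map l t v y \<in> Y"
proof (induction v)
  case (Cons c v)
  have "word_map l t (c # v) y = word_map l t [c] (word_map l t v y)"
    using word_map_append[of l t "[c]" v] by simp
  then have "word_map l t (c # v) y \<in> (\<Union>c. word_map l t [c] ` Y)" using Cons by blast
  then show ?case by (subst assms(1))
qed (use assms(2) in simp)

lemma norm_word_map_diff_le:
  "norm (word_map l t w x - word_map l t w y) \<le> (1 / 2) ^ length w * (\<Sum>i\<in>UNIV. \<bar>x $ i - y $ i\<bar>)"
proof -
  have "norm (word_map l t w x - word_map l t w y) \<le> (\<Sum>i\<in>UNIV. \<bar>(word_map l t w x - word_map l t w y) $ i\<bar>)"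
    by (rule norm_le_l1_cart)
  also have "\<dots> \<le> (\<Sum>i\<in>UNIV. (1 / 2) ^ length w * \<bar>x $ i - y $ i\<bar>)"
    using l_pos l_half
    by (intro sum_mono) (auto simp: word_map_diff_nth abs_mult power_abs less_imp_le intro!: mult_right_mono power_mono)
  finally show ?thesis by (simp add: sum_distrib_left)
qed

text \<open>Both sets are followed along the same word: the images of a point of \<open>Y\<close> and of a point of \<open>Z\<close> under a word of
  length \<open>m\<close> are within a constant times \<open>2 ^ -m\<close>. This gives the uniqueness of the attractor.\<close>

lemma invariant_subset:
  assumes Y: "Y = (\<Union>c. word_map l t [c] ` Y)" "bounded Y"
    and Z: "Z = (\<Union>c. word_map l t [c] ` Z)" "closed Z" "Z \<noteq> {}"
  shows "Y \<subseteq> Z"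
proof
  fix x assume x: "x \<in> Y"
  obtain z where z: "z \<in> Z" using Z by auto
  obtain B where B: "\<And>y. y \<in> Y \<Longrightarrow> norm y \<le> B" using Y(2) by (auto simp: bounded_iff)
  define D where "D = real CARD('d) * (B + norm z)"
  have D: "(\<Sum>i\<in>UNIV. \<bar>y $ i - z $ i\<bar>) \<le> D" if "y \<in> Y" for y
  proof -
    have "\<bar>y $ i - z $ i\<bar> \<le> B + norm z" for i
      using component_le_norm_cart[of y i] component_le_norm_cart[of z i] B[OF that] by linarith
    then have "(\<Sum>i\<in>(UNIV::'d set). \<bar>y $ i - z $ i\<bar>) \<le> (\<Sum>i\<in>(UNIV::'d set). B + norm z)" by (intro sum_mono)
    then show ?thesis by (simp add: D_def)
  qed
  have "x \<in> closure Z"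
    unfolding closure_approachable
  proof (intro allI impI)
    fix e :: real assume e: "0 < e"
    obtain m where m: "(1 / 2) ^ m * D < e"
      using power_times_eventually_small[of "1 / 2" e D] e by auto
    obtain v y where vy: "length v = m" "y \<in> Y" "x = word_map l t v y"
      using invariant_decompose[OF Y(1) x] by blast
    have "dist (word_map l t v z) x \<le> (1 / 2) ^ m * (\<Sum>i\<in>UNIV. \<bar>y $ i - z $ i\<bar>)"
      using norm_word_map_diff_le[of t v y z] vy by (simp add: dist_norm norm_minus_commute)
    also have "\<dots> \<le> (1 / 2) ^ m * D" using D[OF vy(2)] by (intro mult_left_mono) auto
    finally show "\<exists>z\<in>Z. dist z x < e" using m invariant_word_map[OF Z(1) z, of v] by (intro bexI[of _ "word_map l t v z"]) auto
  qed
  then show "x \<in> Z" using Z(2) by simp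
qed

context
  fixes A :: "'i::finite \<Rightarrow> real ^ 'd ^ 'd"
  assumes A: "\<And>c. A c = diag_matrix l"
begin

lemma S_map_eq: "S_map A t c = word_map l t [c]"
  by (rule ext) (simp add: S_map_def A vec_eq_iff diag_matrix_nth word_map_def)

lemma foldr_S_map: "foldr (S_map A t) w x = word_map l t w x"
proof (induction w)
  case (Cons c w)
  then show ?case using word_map_append[of l t "[c]" w x] by (simp add: S_map_eq)
qed simp

lemma fold_T_map: "fold (T_map A t) w (word_map l t w x) = x"
proof (induction w)
  case (Cons c w)
  have "inj (word_map l t [c])"
    using l_pos by (auto simp: inj_def word_map_def vec_eq_iff less_imp_neq[symmetric])
  then have "T_map A t c (word_map l t [c] y) = y" for y
    by (simp add: T_map_def S_map_eq)
  then show ?case using Cons word_map_append[of l t "[c]" w x] by simp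
qed simp

lemma self_affine_set_eq: "self_affine_set A t = attractor t"
  unfolding self_affine_set_def S_map_eq
proof (rule the_equality)
  show "attractor t \<noteq> {} \<and> compact (attractor t) \<and> attractor t = (\<Union>c. word_map l t [c] ` attractor t)"
    by (intro conjI compact_attractor attractor_invariant) (use code_point_in_attractor in auto)
  show "X = attractor t" if "X \<noteq> {} \<and> compact X \<and> X = (\<Union>c. word_map l t [c] ` X)" for X
  proof -
    have X: "X = (\<Union>c. word_map l t [c] ` X)" "compact X" "X \<noteq> {}" using that by - (elim conjE, assumption)+
    have ne: "attractor t \<noteq> {}" using code_point_in_attractor by auto
    show ?thesis
    proof
      show "X \<subseteq> attractor t"
        by (rule invariant_subset[OF X(1) compact_imp_bounded[OF X(2)] attractor_invariant
              compact_imp_closed[OF compact_attractor] ne])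
      show "attractor t \<subseteq> X"
        by (rule invariant_subset[OF attractor_invariant compact_imp_bounded[OF compact_attractor]
              X(1) compact_imp_closed[OF X(2)] X(3)])
    qed
  qed
qed

lemma proj_eq: "proj A t a = code_point l t a"
  unfolding proj_def
proof (rule limI)
  show "(\<lambda>n. foldr (S_map A t) (map a [0..<n]) 0) \<longlonglongrightarrow> code_point l t a"
  proof (rule vec_tendstoI)
    fix i
    have "(\<lambda>n. \<Sum>q<n. l i ^ q * t $ a q $ i) \<longlonglongrightarrow> (\<Sum>q. l i ^ q * t $ a q $ i)"
      by (rule summable_LIMSEQ[OF code_series_summable])
    then show "(\<lambda>n. foldr (S_map A t) (map a [0..<n]) 0 $ i) \<longlonglongrightarrow> code_point l t a $ i"
      by (simp add: foldr_S_map word_map_def code_point_def)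
  qed
qed

end

end

section \<open>Transversality\<close>

lemma emeasure_cbox_vec:
  fixes a b :: "real ^ 'd"
  assumes "\<And>i. a $ i \<le> b $ i"
  shows "emeasure lborel (cbox a b) = ennreal (\<Prod>i\<in>UNIV. b $ i - a $ i)"
proof -
  have "emeasure lborel (cbox a b) \<noteq> top" using emeasure_lborel_cbox_finite[of a b] by auto
  then have "emeasure lborel (cbox a b) = ennreal (leb (cbox a b))"
    by (rule emeasure_eq_ennreal_measure)
  then show ?thesis by (simp only: measure_cbox_vec[OF assms])
qed

context diagonal_contraction
begin

definition gap :: "'d \<Rightarrow> real" where
  "gap i = (1 - 2 * l i) / (1 - l i)"

lemma gap_pos: "0 < gap i"
  using l_pos[of i] l_half[of i] by (simp add: gap_def)

text \<open>The coefficient with which the translation \<open>t $ c\<close> enters coordinate \<open>i\<close> of the point with code \<open>a\<close>.\<close>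

definition letter_weight :: "'d \<Rightarrow> (nat \<Rightarrow> 'i) \<Rightarrow> 'i \<Rightarrow> real" where
  "letter_weight i a c = (\<Sum>q. l i ^ q * (if a q = c then 1 else 0))"

lemma letter_weight_summable: "summable (\<lambda>q. l i ^ q * (if a q = c then 1 else 0))"
  using sums_summable[OF geometric_sums_mult[of i 1]]
  by (rule summable_comparison_test'[where N = 0]) (use l_pos[of i] in simp)

text \<open>At the first place where two sequences differ the coefficient of the corresponding translation is
  \<open>l i ^ m\<close>, and because \<open>l i < 1 / 2\<close> all later places together cannot cancel it.\<close>

lemma letter_weight_gap:
  assumes "\<And>q. q < m \<Longrightarrow> a q = a' q" "a m \<noteq> a' m"
  shows "l i ^ m * gap i \<le> letter_weight i a (a m) - letter_weight i a' (a m)"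
proof -
  let ?c = "a m"
  let ?f = "\<lambda>q. l i ^ q * (if a q = ?c then 1 else 0) - l i ^ q * (if a' q = ?c then 1 else 0)"
  have sm: "summable ?f" by (intro summable_diff letter_weight_summable)
  have "letter_weight i a ?c - letter_weight i a' ?c = suminf ?f"
    unfolding letter_weight_def by (rule suminf_diff[OF letter_weight_summable letter_weight_summable])
  also have "\<dots> = (\<Sum>q. ?f (q + Suc m)) + (\<Sum>q<Suc m. ?f q)" by (rule suminf_split_initial_segment[OF sm])
  also have "(\<Sum>q<Suc m. ?f q) = l i ^ m" using assms by simp
  also have "(\<Sum>q. - (l i ^ Suc m * l i ^ q)) \<le> (\<Sum>q. ?f (q + Suc m))"
  proof (rule suminf_le)
    show "summable (\<lambda>q. ?f (q + Suc m))" by (rule summable_ignore_initial_segment[OF sm])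
    show "summable (\<lambda>q. - (l i ^ Suc m * l i ^ q))"
      using l_pos[of i] l_half[of i] by (intro summable_minus summable_mult summable_geometric) simp
    fix q
    have "0 \<le> l i ^ (q + Suc m)" using l_pos[of i] by simp
    then show "- (l i ^ Suc m * l i ^ q) \<le> ?f (q + Suc m)" by (auto simp: power_add mult_ac)
  qed
  moreover have "(\<Sum>q. - (l i ^ Suc m * l i ^ q)) = - (l i ^ Suc m * (1 / (1 - l i)))"
    using l_pos[of i] l_half[of i]
    by (intro sums_unique[symmetric] sums_minus sums_mult geometric_sums) simp
  moreover have "l i ^ m * gap i = - (l i ^ Suc m * (1 / (1 - l i))) + l i ^ m"
    using l_half[of i] l_pos[of i] by (simp add: gap_def field_simps)
  ultimately show ?thesis by linarith
qed

lemma code_point_shift: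
  "code_point l (axis c x + t) a $ i = code_point l t a $ i + letter_weight i a c * x $ i"
proof -
  have "(\<Sum>q. l i ^ q * (axis c x + t) $ a q $ i)
      = (\<Sum>q. l i ^ q * t $ a q $ i + l i ^ q * (if a q = c then 1 else 0) * x $ i)"
    by (intro arg_cong[where f = suminf] ext) (simp add: axis_def algebra_simps)
  also have "\<dots> = (\<Sum>q. l i ^ q * t $ a q $ i) + (\<Sum>q. l i ^ q * (if a q = c then 1 else 0) * x $ i)"
    by (rule suminf_add[symmetric, OF code_series_summable summable_mult2[OF letter_weight_summable]])
  also have "(\<Sum>q. l i ^ q * (if a q = c then 1 else 0) * x $ i) = letter_weight i a c * x $ i"
    unfolding letter_weight_def by (rule suminf_mult2[symmetric, OF letter_weight_summable])
  finally show ?thesis by (simp add: code_point_def)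
qed

lemma continuous_code_point: "continuous_on UNIV (\<lambda>t. code_point l t a)"
proof (rule linear_continuous_on)
  have "linear (\<lambda>t. code_point l t a)"
  proof (rule linearI)
    show "code_point l (t + t') a = code_point l t a + code_point l t' a" for t t'
      by (simp add: code_point_def vec_eq_iff distrib_left suminf_add[symmetric, OF code_series_summable code_series_summable])
    show "code_point l (r *\<^sub>R t) a = r *\<^sub>R code_point l t a" for r t
      by (simp add: code_point_def vec_eq_iff mult.left_commute[of _ r] suminf_mult[OF code_series_summable])
  qed
  then show "bounded_linear (\<lambda>t. code_point l t a)" by (simp add: linear_conv_bounded_linear)
qed

definition close_params :: "('d \<Rightarrow> real) \<Rightarrow> (nat \<Rightarrow> 'i) \<Rightarrow> (nat \<Rightarrow> 'i) \<Rightarrow> (real ^ 'd ^ 'i::finite) set" where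
  "close_params \<delta> a a' = {t. \<forall>i. \<bar>code_point l t a $ i - code_point l t a' $ i\<bar> \<le> \<delta> i}"

lemma close_params_borel [measurable]: "close_params \<delta> a a' \<in> sets borel"
proof -
  have "closed (close_params \<delta> a a')"
    unfolding close_params_def
    by (intro closed_Collect_all closed_Collect_le continuous_intros continuous_code_point)
  then show ?thesis by simp
qed

lemma nn_integral_lborel_shift:
  fixes f :: "'a::euclidean_space \<Rightarrow> ennreal"
  assumes [measurable]: "f \<in> borel_measurable borel"
  shows "(\<integral>\<^sup>+ t. f (v + t) \<partial>lborel) = (\<integral>\<^sup>+ t. f t \<partial>lborel)"
proof -
  have "(\<integral>\<^sup>+ t. f t \<partial>lborel) = (\<integral>\<^sup>+ t. f t \<partial>distr lborel borel ((+) v))"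
    by (simp add: lborel_distr_plus)
  also have "\<dots> = (\<integral>\<^sup>+ t. f (v + t) \<partial>lborel)" by (subst nn_integral_distr) auto
  finally show ?thesis by simp
qed

text \<open>The set of parameters is averaged over translations of the block \<open>a m\<close> by vectors of the unit cube.
  Along each such block the difference of the two code points is a diagonal affine map whose
  coefficients are bounded below by the gap, so its sublevel sets are boxes of known size.\<close>

lemma emeasure_close_params_le:
  fixes a a' :: "nat \<Rightarrow> 'i::finite"
  assumes "\<And>q. q < m \<Longrightarrow> a q = a' q" "a m \<noteq> a' m" "\<And>i. 0 \<le> \<delta> i"
  shows "emeasure lborel (close_params \<delta> a a' \<inter> ball 0 R)
     \<le> emeasure lborel (ball (0 :: real ^ 'd ^ 'i) (R + real CARD('d)))
        * ennreal (\<Prod>i\<in>UNIV. 2 * \<delta> i / (l i ^ m * gap i))"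
proof -
  define P where "P = close_params \<delta> a a'"
  define c where "c = a m"
  define B where "B i = letter_weight i a c - letter_weight i a' c" for i
  define \<beta> where "\<beta> i = l i ^ m * gap i" for i
  have \<beta>0: "0 < \<beta> i" for i using l_pos[of i] gap_pos[of i] by (simp add: \<beta>_def)
  have B: "\<beta> i \<le> B i" for i
    unfolding \<beta>_def B_def c_def by (rule letter_weight_gap[of m a a', OF assms(1,2)])
  have B0: "0 < B i" for i using B[of i] \<beta>0[of i] by linarith
  define K where "K = ennreal (\<Prod>i\<in>UNIV. 2 * \<delta> i / \<beta> i)"
  define Y where "Y = cbox (0::real ^ 'd) (\<chi> i. 1)"
  have Y: "emeasure lborel Y = 1" unfolding Y_def by (subst emeasure_cbox_vec) auto
  have [measurable]: "P \<in> sets borel" unfolding P_def by measurable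
  have [measurable]: "Y \<in> sets borel" unfolding Y_def by simp
  have [measurable]: "ball (0 :: real ^ 'd ^ 'i) \<rho> \<in> sets borel" for \<rho> by simp
  have cont_axis: "continuous_on UNIV (\<lambda>x::real ^ 'd. axis c x :: real ^ 'd ^ 'i)"
    by (rule linear_continuous_on) (auto simp: linear_conv_bounded_linear[symmetric] axis_def vec_eq_iff intro!: linearI)
  have [measurable]: "(\<lambda>x::real ^ 'd. axis c x :: real ^ 'd ^ 'i) \<in> borel_measurable borel"
    by (rule borel_measurable_continuous_onI[OF cont_axis])
  have slice: "emeasure lborel {x. axis c x + t \<in> P} \<le> K" for t
  proof -
    define D where "D i = code_point l t a $ i - code_point l t a' $ i" for i
    define lo hi :: "real ^ 'd" where "lo = (\<chi> i. (- \<delta> i - D i) / B i)" and "hi = (\<chi> i. (\<delta> i - D i) / B i)"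
    have "{x. axis c x + t \<in> P} = cbox lo hi"
    proof -
      have "code_point l (axis c x + t) a $ i - code_point l (axis c x + t) a' $ i = D i + B i * x $ i" for x i
        by (simp add: code_point_shift D_def B_def left_diff_distrib)
      then have "axis c x + t \<in> P \<longleftrightarrow> (\<forall>i. \<bar>D i + B i * x $ i\<bar> \<le> \<delta> i)" for x
        by (simp only: P_def close_params_def mem_Collect_eq)
      moreover have "\<bar>D i + B i * x $ i\<bar> \<le> \<delta> i \<longleftrightarrow> lo $ i \<le> x $ i \<and> x $ i \<le> hi $ i" for x i
        using B0[of i] by (auto simp: lo_def hi_def abs_le_iff field_simps)
      ultimately show ?thesis by (auto simp: mem_box_cart)
    qed
    moreover have "emeasure lborel (cbox lo hi) = ennreal (\<Prod>i\<in>UNIV. hi $ i - lo $ i)"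
    proof -
      have "lo $ i \<le> hi $ i" for i
        using B0[of i] assms(3)[of i] by (auto simp: lo_def hi_def intro!: divide_right_mono)
      then show ?thesis by (rule emeasure_cbox_vec)
    qed
    moreover have "(\<Prod>i\<in>UNIV. hi $ i - lo $ i) \<le> (\<Prod>i\<in>UNIV. 2 * \<delta> i / \<beta> i)"
    proof (intro prod_mono conjI)
      fix i
      have "hi $ i - lo $ i = 2 * \<delta> i / B i" by (simp add: hi_def lo_def diff_divide_distrib[symmetric])
      then show "0 \<le> hi $ i - lo $ i" "hi $ i - lo $ i \<le> 2 * \<delta> i / \<beta> i"
        using B[of i] \<beta>0[of i] B0[of i] assms(3)[of i] by (auto intro!: divide_left_mono)
    qed
    ultimately show ?thesis by (simp add: K_def ennreal_leI)
  qed
  let ?F = "\<lambda>x t. indicator Y x * indicator (P \<inter> ball 0 R) (axis c x + t) :: ennreal"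
  have "emeasure lborel (P \<inter> ball 0 R) = (\<integral>\<^sup>+ x. indicator Y x * emeasure lborel (P \<inter> ball 0 R) \<partial>lborel)"
    by (subst nn_integral_multc) (simp_all add: Y)
  also have "\<dots> = (\<integral>\<^sup>+ x. \<integral>\<^sup>+ t. ?F x t \<partial>lborel \<partial>lborel)"
  proof (rule nn_integral_cong)
    fix x
    have "emeasure lborel (P \<inter> ball 0 R) = (\<integral>\<^sup>+ t. indicator (P \<inter> ball 0 R) t \<partial>lborel)" by simp
    also have "\<dots> = (\<integral>\<^sup>+ t. indicator (P \<inter> ball 0 R) (axis c x + t) \<partial>lborel)"
      by (rule nn_integral_lborel_shift[symmetric]) measurable
    finally show "indicator Y x * emeasure lborel (P \<inter> ball 0 R)
        = (\<integral>\<^sup>+ t. ?F x t \<partial>lborel)"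
      by (simp add: nn_integral_cmult)
  qed
  also have "\<dots> = (\<integral>\<^sup>+ t. \<integral>\<^sup>+ x. ?F x t \<partial>lborel \<partial>lborel)"
    by (rule lborel_pair.Fubini') measurable
  also have "\<dots> \<le> (\<integral>\<^sup>+ t. K * indicator (ball (0 :: real ^ 'd ^ 'i) (R + real CARD('d))) t \<partial>lborel)"
  proof (rule nn_integral_mono)
    fix t :: "real ^ 'd ^ 'i"
    have "(\<integral>\<^sup>+ x. ?F x t \<partial>lborel)
        \<le> (\<integral>\<^sup>+ x. indicator (ball 0 (R + real CARD('d))) t * indicator {x. axis c x + t \<in> P} x \<partial>lborel)"
    proof (rule nn_integral_mono)
      fix x :: "real ^ 'd"
      have "t \<in> ball 0 (R + real CARD('d))" if "x \<in> Y" "axis c x + t \<in> ball 0 R"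
      proof -
        have "norm (axis c x :: real ^ 'd ^ 'i) \<le> (\<Sum>b\<in>UNIV. norm (axis c x $ b :: real ^ 'd))"
          unfolding norm_vec_def[of "axis c x"] by (rule L2_set_le_sum) simp
        also have "\<dots> = norm x" by (simp add: axis_def if_distrib[of norm] cong: if_cong)
        also have "\<dots> \<le> (\<Sum>i\<in>UNIV. \<bar>x $ i\<bar>)" by (rule norm_le_l1_cart)
        also have "\<dots> \<le> (\<Sum>i\<in>(UNIV::'d set). 1)"
          using that(1) by (intro sum_mono) (auto simp: Y_def mem_box_cart abs_le_iff intro: order_trans[of _ 0])
        finally have "norm (axis c x :: real ^ 'd ^ 'i) \<le> real CARD('d)" by simp
        moreover have "norm t \<le> norm (axis c x + t) + norm (axis c x :: real ^ 'd ^ 'i)"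
          using norm_triangle_ineq4[of "axis c x + t" "axis c x"] by simp
        ultimately show ?thesis using that(2) by simp
      qed
      then show "?F x t
          \<le> (indicator (ball 0 (R + real CARD('d))) t * indicator {x. axis c x + t \<in> P} x :: ennreal)"
        by (auto simp: indicator_def)
    qed
    also have "\<dots> = indicator (ball 0 (R + real CARD('d))) t * emeasure lborel {x. axis c x + t \<in> P}"
      by (subst nn_integral_cmult) auto
    also have "\<dots> \<le> K * indicator (ball 0 (R + real CARD('d))) t"
      using slice[of t] by (subst mult.commute) (rule mult_right_mono, auto)
    finally show "(\<integral>\<^sup>+ x. ?F x t \<partial>lborel)
        \<le> K * indicator (ball 0 (R + real CARD('d))) t" .
  qed
  also have "\<dots> = emeasure lborel (ball (0 :: real ^ 'd ^ 'i) (R + real CARD('d))) * K"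
    by (subst nn_integral_cmult) (auto simp: mult.commute)
  finally show ?thesis unfolding P_def K_def \<beta>_def .
qed


section \<open>Almost sure correlation bounds\<close>

definition close_pairs :: "nat \<Rightarrow> ('d \<Rightarrow> real) \<Rightarrow> (nat \<Rightarrow> 'i) \<Rightarrow> real ^ 'd ^ 'i \<Rightarrow> ('i::finite list \<times> 'i list) set" where
  "close_pairs n \<delta> a t = {(w, w'). length w = n \<and> length w' = n \<and> w \<noteq> w' \<and>
      t \<in> close_params \<delta> (prepend w a) (prepend w' a)}"

end

abbreviation words :: "nat \<Rightarrow> 'i list set" where
  "words n \<equiv> {w. length w = n}"

lemma finite_words: "finite (words n :: 'i::finite list set)"
  using finite_lists_length_eq[of "UNIV :: 'i set" n] by simp

lemma card_words: "card (words n :: 'i::finite list set) = CARD('i) ^ n"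
  using card_lists_length_eq[of "UNIV :: 'i set" n] by simp

lemma card_words_with_prefix:
  assumes "m \<le> n"
  shows "card {w' \<in> words n. take m w' = take m (w :: 'i::finite list)} \<le> CARD('i) ^ (n - m)"
proof -
  have "{w' \<in> words n. take m w' = take m w} \<subseteq> (\<lambda>v. take m w @ v) ` words (n - m)"
  proof
    fix w' assume w': "w' \<in> {w' \<in> words n. take m w' = take m w}"
    then have "w' = take m w @ drop m w'" using append_take_drop_id[of m w'] by simp
    then show "w' \<in> (\<lambda>v. take m w @ v) ` words (n - m)" using w' by (intro image_eqI) auto
  qed
  then have "card {w' \<in> words n. take m w' = take m w} \<le> card ((\<lambda>v. take m w @ v) ` words (n - m))"
    by (intro card_mono finite_imageI finite_words)
  also have "\<dots> \<le> CARD('i) ^ (n - m)"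
    using card_image_le[OF finite_words, of "\<lambda>v. take m w @ v"] by (simp add: card_words)
  finally show ?thesis .
qed

lemma first_difference:
  assumes "length w = n" "length w' = n" "w \<noteq> w'"
  shows "\<exists>m<n. take m w = take m w' \<and> w ! m \<noteq> w' ! m"
proof -
  have ex: "\<exists>m. m < n \<and> w ! m \<noteq> w' ! m" using assms by (auto simp: list_eq_iff_nth_eq)
  define m where "m = (LEAST m. m < n \<and> w ! m \<noteq> w' ! m)"
  have m: "m < n \<and> w ! m \<noteq> w' ! m" unfolding m_def using ex by (rule LeastI_ex)
  moreover have "w ! q = w' ! q" if "q < m" for q
    using not_less_Least[of q "\<lambda>m. m < n \<and> w ! m \<noteq> w' ! m"] that m unfolding m_def by auto
  then have "take m w = take m w'" using m assms by (auto simp: list_eq_iff_nth_eq)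
  ultimately show ?thesis by blast
qed

text \<open>There are \<open>k ^ (2 n - m)\<close> pairs of words that agree up to place \<open>m\<close>, and each costs
  \<open>\<Lambda> ^ -m\<close>: the geometric series over \<open>m\<close> converges exactly when \<open>k * \<Lambda> > 1\<close>.\<close>

lemma common_prefix_sum_le:
  fixes \<Lambda> :: real
  assumes "0 < \<Lambda>" "1 < real CARD('i::finite) * \<Lambda>"
  shows "(\<Sum>w\<in>(words n :: 'i list set). \<Sum>w'\<in>words n. \<Sum>m<n. if take m w' = take m w then (1 / \<Lambda>) ^ m else 0)
    \<le> real CARD('i) ^ (2 * n) * (1 / (1 - 1 / (real CARD('i) * \<Lambda>)))"
proof -
  let ?h = "\<lambda>w w' m. if take m w' = take m w then (1 / \<Lambda>) ^ m else 0"
  let ?k = "real CARD('i)"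
  have k: "0 < ?k" by simp
  have "(\<Sum>w'\<in>words n. \<Sum>m<n. ?h w w' m)
      \<le> ?k ^ n * (1 / (1 - 1 / (?k * \<Lambda>)))" for w :: "'i list"
  proof -
    have "(\<Sum>w'\<in>words n. \<Sum>m<n. ?h w w' m)
        = (\<Sum>m<n. \<Sum>w'\<in>words n. ?h w w' m)"
      by (rule sum.swap)
    also have "\<dots> = (\<Sum>m<n. real (card {w' \<in> words n. take m w' = take m w}) * (1 / \<Lambda>) ^ m)"
      by (intro sum.cong refl) (simp add: sum.inter_filter[symmetric] finite_words)
    also have "\<dots> \<le> (\<Sum>m<n. ?k ^ n * (1 / (?k * \<Lambda>)) ^ m)"
    proof (rule sum_mono)
      fix m assume m: "m \<in> {..<n}"
      have "real (card {w' \<in> words n. take m w' = take m w}) \<le> real (CARD('i) ^ (n - m))"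
        using card_words_with_prefix[of m n w] m by (simp only: of_nat_le_iff) simp
      then have "real (card {w' \<in> words n. take m w' = take m w}) * (1 / \<Lambda>) ^ m \<le> ?k ^ (n - m) * (1 / \<Lambda>) ^ m"
        using assms(1) by (intro mult_right_mono) simp_all
      also have "\<dots> = ?k ^ n * (1 / (?k * \<Lambda>)) ^ m"
        using m k by (simp add: power_diff power_divide power_mult_distrib)
      finally show "real (card {w' \<in> words n. take m w' = take m w}) * (1 / \<Lambda>) ^ m \<le> ?k ^ n * (1 / (?k * \<Lambda>)) ^ m" .
    qed
    also have "\<dots> = ?k ^ n * (\<Sum>m<n. (1 / (?k * \<Lambda>)) ^ m)" by (simp add: sum_distrib_left)
    also have "\<dots> \<le> ?k ^ n * (1 / (1 - 1 / (?k * \<Lambda>)))"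
      using assms by (intro mult_left_mono geometric_partial_sum_le) auto
    finally show ?thesis .
  qed
  then have "(\<Sum>w\<in>(words n :: 'i list set). \<Sum>w'\<in>words n. \<Sum>m<n. ?h w w' m)
      \<le> (\<Sum>w\<in>(words n :: 'i list set). ?k ^ n * (1 / (1 - 1 / (?k * \<Lambda>))))"
    by (intro sum_mono)
  also have "\<dots> = ?k ^ (2 * n) * (1 / (1 - 1 / (?k * \<Lambda>)))"
    by (simp add: card_words mult_2 power_add)
  finally show ?thesis .
qed

context diagonal_contraction
begin

text \<open>The bound is, up to the constant, the one for \<open>k ^ n\<close> independent uniformly distributed points.\<close>

lemma nn_integral_close_pairs:
  fixes a :: "nat \<Rightarrow> 'i::finite"
  assumes "1 < real CARD('i) * (\<Prod>i\<in>UNIV. l i)"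
  obtains C where "0 \<le> C"
    "\<And>n \<delta>. (\<And>i. 0 \<le> \<delta> i) \<Longrightarrow>
      (\<integral>\<^sup>+ t. of_nat (card (close_pairs n \<delta> a t)) * indicator (ball 0 R) t \<partial>lborel)
        \<le> ennreal (C * (\<Prod>i\<in>UNIV. \<delta> i) * real CARD('i) ^ (2 * n))"
proof -
  let ?cp = "\<lambda>\<delta> p. close_params \<delta> (prepend (fst p) a) (prepend (snd p) a)"
  define \<Lambda> where "\<Lambda> = (\<Prod>i\<in>UNIV. l i)"
  have \<Lambda>: "0 < \<Lambda>" unfolding \<Lambda>_def using l_pos by (intro prod_pos) auto
  define V where "V = leb (ball (0 :: real ^ 'd ^ 'i) (R + real CARD('d)))"
  define G where "G = (\<Prod>i\<in>UNIV. 2 / gap i)"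
  have G: "0 \<le> G" unfolding G_def using gap_pos by (intro prod_nonneg) (simp add: less_imp_le)
  define C where "C = V * G * (1 / (1 - 1 / (real CARD('i) * \<Lambda>)))"
  have L: "1 < real CARD('i) * \<Lambda>" using assms by (simp add: \<Lambda>_def)
  have "0 \<le> C" unfolding C_def V_def using G L by (intro mult_nonneg_nonneg) auto
  moreover have "(\<integral>\<^sup>+ t. of_nat (card (close_pairs n \<delta> a t)) * indicator (ball 0 R) t \<partial>lborel)
        \<le> ennreal (C * (\<Prod>i\<in>UNIV. \<delta> i) * real CARD('i) ^ (2 * n))" if \<delta>: "\<And>i. 0 \<le> \<delta> i" for n \<delta>
  proof -
    define W where "W = (words n :: 'i list set)"
    have W: "finite W" unfolding W_def by (rule finite_words)
    define D where "D = (\<Prod>i\<in>UNIV. \<delta> i)"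
    have D: "0 \<le> D" unfolding D_def using \<delta> by (intro prod_nonneg) auto
    define T where "T = {p \<in> W \<times> W. fst p \<noteq> snd p}"
    have T: "finite T" "T \<subseteq> W \<times> W" using W by (auto simp: T_def)
    define Q where "Q p = ?cp \<delta> p \<inter> ball 0 R" for p
    define h where "h p = (\<Sum>m<n. if take m (snd p) = take m (fst p) then (1 / \<Lambda>) ^ m else 0)" for p :: "'i list \<times> 'i list"
    have h0: "0 \<le> h p" for p unfolding h_def using \<Lambda> by (intro sum_nonneg) auto
    have Q: "emeasure lborel (Q p) \<le> ennreal (V * G * D * h p)" if p: "p \<in> T" for p
    proof -
      obtain m where m: "m < n" "take m (fst p) = take m (snd p)" "fst p ! m \<noteq> snd p ! m"
        using first_difference[of "fst p" n "snd p"] p by (auto simp: T_def W_def)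
      have len: "length (fst p) = n" "length (snd p) = n" using p by (auto simp: T_def W_def)
      have "emeasure lborel (Q p)
         \<le> emeasure lborel (ball (0 :: real ^ 'd ^ 'i) (R + real CARD('d)))
            * ennreal (\<Prod>i\<in>UNIV. 2 * \<delta> i / (l i ^ m * gap i))"
        unfolding Q_def
      proof (rule emeasure_close_params_le)
        fix q assume q: "q < m"
        then have "fst p ! q = snd p ! q" using m(2) nth_take by metis
        then show "prepend (fst p) a q = prepend (snd p) a q" using q m(1) len by (simp add: prepend_def)
      qed (use m len \<delta> in \<open>auto simp: prepend_def\<close>)
      also have "emeasure lborel (ball (0 :: real ^ 'd ^ 'i) (R + real CARD('d))) = ennreal V"
        unfolding V_def using emeasure_lborel_ball_finite by (intro emeasure_eq_ennreal_measure) (auto simp: less_top)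
      also have "(\<Prod>i\<in>UNIV. 2 * \<delta> i / (l i ^ m * gap i)) = G * D * (1 / \<Lambda>) ^ m"
      proof -
        have "(\<Prod>i\<in>UNIV. 2 * \<delta> i / (l i ^ m * gap i))
            = (\<Prod>i\<in>UNIV. 2 / gap i * \<delta> i * (1 / l i ^ m))"
        proof (intro prod.cong refl)
          fix i
          have "2 * d / (x * g) = 2 / g * d * (1 / x)" for d g x :: real by (simp add: mult.commute)
          then show "2 * \<delta> i / (l i ^ m * gap i) = 2 / gap i * \<delta> i * (1 / l i ^ m)" .
        qed
        also have "\<dots> = G * D * (\<Prod>i\<in>UNIV. 1 / l i ^ m)" by (simp only: prod.distrib G_def D_def)
        also have "(\<Prod>i\<in>UNIV. 1 / l i ^ m) = (1 / \<Lambda>) ^ m"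
          by (simp add: \<Lambda>_def prod_dividef power_divide prod_power_distrib)
        finally show ?thesis .
      qed
      also have "ennreal V * ennreal (G * D * (1 / \<Lambda>) ^ m) = ennreal (V * G * D * (1 / \<Lambda>) ^ m)"
        using G D \<Lambda> by (simp add: V_def ennreal_mult[symmetric] mult.assoc)
      also have "\<dots> \<le> ennreal (V * G * D * h p)"
      proof (intro ennreal_leI mult_left_mono)
        have "(1 / \<Lambda>) ^ m = (if take m (snd p) = take m (fst p) then (1 / \<Lambda>) ^ m else 0)" using m(2) by simp
        also have "\<dots> \<le> h p" unfolding h_def using m(1) \<Lambda> by (intro member_le_sum) auto
        finally show "(1 / \<Lambda>) ^ m \<le> h p" .
      qed (use G D in \<open>simp add: V_def\<close>)
      finally show ?thesis .
    qed
    have Qm [measurable]: "Q p \<in> sets borel" for p unfolding Q_def by measurable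
    have "(\<integral>\<^sup>+ t. of_nat (card (close_pairs n \<delta> a t)) * indicator (ball 0 R) t \<partial>lborel)
        = (\<integral>\<^sup>+ t. (\<Sum>p\<in>T. indicator (Q p) t) \<partial>lborel)"
    proof (rule nn_integral_cong)
      fix t
      have "close_pairs n \<delta> a t = {p \<in> T. t \<in> ?cp \<delta> p}"
        by (auto simp: close_pairs_def T_def W_def)
      then have "of_nat (card (close_pairs n \<delta> a t)) = (\<Sum>p\<in>T. if t \<in> ?cp \<delta> p then 1 else (0::ennreal))"
        using T by (simp add: sum.inter_filter[symmetric])
      then have "of_nat (card (close_pairs n \<delta> a t)) * indicator (ball 0 R) t
          = (\<Sum>p\<in>T. (if t \<in> ?cp \<delta> p then 1 else 0) * (indicator (ball 0 R) t :: ennreal))"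
        by (simp only: sum_distrib_right)
      also have "\<dots> = (\<Sum>p\<in>T. indicator (Q p) t)"
        by (intro sum.cong refl) (simp add: Q_def indicator_def)
      finally show "of_nat (card (close_pairs n \<delta> a t)) * indicator (ball 0 R) t = (\<Sum>p\<in>T. indicator (Q p) t :: ennreal)" .
    qed
    also have "\<dots> = (\<Sum>p\<in>T. emeasure lborel (Q p))" by (subst nn_integral_sum) auto
    also have "\<dots> \<le> (\<Sum>p\<in>T. ennreal (V * G * D * h p))" by (intro sum_mono Q)
    also have "\<dots> = ennreal (\<Sum>p\<in>T. V * G * D * h p)"
      using G D h0 by (intro sum_ennreal) (simp add: V_def)
    also have "\<dots> \<le> ennreal (C * D * real CARD('i) ^ (2 * n))"
    proof (rule ennreal_leI)
      have "(\<Sum>p\<in>T. h p) \<le> (\<Sum>p\<in>W \<times> W. h p)" using T W h0 by (intro sum_mono2) auto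
      also have "\<dots> = (\<Sum>w\<in>W. \<Sum>w'\<in>W. h (w, w'))" by (simp add: sum.cartesian_product)
      also have "\<dots> \<le> real CARD('i) ^ (2 * n) * (1 / (1 - 1 / (real CARD('i) * \<Lambda>)))"
        unfolding h_def W_def fst_conv snd_conv by (rule common_prefix_sum_le[OF \<Lambda> L])
      finally have "V * G * D * (\<Sum>p\<in>T. h p) \<le> V * G * D * (real CARD('i) ^ (2 * n) * (1 / (1 - 1 / (real CARD('i) * \<Lambda>))))"
        using G D by (intro mult_left_mono) (auto simp: V_def)
      also have "\<dots> = C * D * real CARD('i) ^ (2 * n)" by (simp add: C_def mult_ac)
      finally show "(\<Sum>p\<in>T. V * G * D * h p) \<le> C * D * real CARD('i) ^ (2 * n)"
        by (simp only: sum_distrib_left)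
    qed
    finally show ?thesis unfolding D_def .
  qed
  ultimately show ?thesis by (rule that)
qed

lemma borel_measurable_card_close_pairs [measurable]:
  fixes a :: "nat \<Rightarrow> 'i::finite"
  shows "(\<lambda>t. of_nat (card (close_pairs n \<delta> a t)) :: ennreal) \<in> borel_measurable borel"
proof -
  define T where "T = {p \<in> words n \<times> words n. fst p \<noteq> (snd p :: 'i list)}"
  have T: "finite T"
  proof (rule finite_subset)
    show "T \<subseteq> words n \<times> words n" by (auto simp: T_def)
    show "finite ((words n :: 'i list set) \<times> (words n :: 'i list set))" by (intro finite_cartesian_product finite_words)
  qed
  have "close_pairs n \<delta> a t = {p \<in> T. t \<in> close_params \<delta> (prepend (fst p) a) (prepend (snd p) a)}" for t
    by (auto simp: close_pairs_def T_def)
  then have "(\<lambda>t. of_nat (card (close_pairs n \<delta> a t)) :: ennreal)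
      = (\<lambda>t. \<Sum>p\<in>T. if t \<in> close_params \<delta> (prepend (fst p) a) (prepend (snd p) a) then 1 else 0)"
    using T by (simp add: sum.inter_filter[symmetric])
  also have "\<dots> \<in> borel_measurable borel" by measurable
  finally show ?thesis .
qed

lemma suminf_ennreal_geometric:
  assumes "0 \<le> c" "0 \<le> q" "q < 1"
  shows "(\<Sum>j. ennreal (c * q ^ j)) = ennreal (c / (1 - q))"
  using assms sums_mult[OF geometric_sums[of q], of c] by (intro suminf_ennreal_eq) auto

lemma term_le_suminf_ennreal: "f j \<le> (\<Sum>j. f j :: ennreal)"
  using sum_le_suminf[of f "{j}"] by simp

text \<open>Weighting the countably many scales geometrically makes the expectation of all normalised counts
  at once bounded in \<open>n\<close>; by Fatou's lemma the limit inferior is finite for almost every parameter,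
  so that infinitely many \<open>n\<close> share a common constant.\<close>

lemma ae_few_close_pairs:
  fixes a :: "nat \<Rightarrow> 'i::finite" and \<delta> :: "nat \<Rightarrow> nat \<Rightarrow> nat \<Rightarrow> 'd \<Rightarrow> real"
  assumes L: "1 < real CARD('i) * (\<Prod>i\<in>UNIV. l i)" and \<kappa>: "0 < \<kappa>" and \<delta>: "\<And>n m j i. 0 < \<delta> n m j i"
  shows "AE t in lborel. t \<in> ball 0 R \<longrightarrow> (\<exists>C\<ge>0. \<forall>N. \<exists>n\<ge>N. \<forall>m j.
     real (card (close_pairs n (\<delta> n m j) a t))
       \<le> C * 2 powr (\<kappa> * real (m + j)) * (\<Prod>i\<in>UNIV. \<delta> n m j i) * real CARD('i) ^ (2 * n))"
proof -
  let ?N = "\<lambda>n m j t. card (close_pairs n (\<delta> n m j) a t)"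
  obtain C where C: "0 \<le> C" and int: "\<And>n \<delta>. (\<And>i. 0 \<le> \<delta> i) \<Longrightarrow>
      (\<integral>\<^sup>+ t. of_nat (card (close_pairs n \<delta> a t)) * indicator (ball 0 R) t \<partial>lborel)
        \<le> ennreal (C * (\<Prod>i\<in>UNIV. \<delta> i) * real CARD('i) ^ (2 * n))"
    using nn_integral_close_pairs[OF L, of a R] by blast
  define q :: real where "q = 2 powr (- \<kappa>)"
  have q: "0 < q" "q < 1" using \<kappa> by (auto simp: q_def powr_less_one)
  define D where "D n m j = (\<Prod>i\<in>UNIV. \<delta> n m j i) * real CARD('i) ^ (2 * n)" for n m j
  have D: "0 < D n m j" for n m j unfolding D_def using \<delta> by (intro mult_pos_pos prod_pos) auto
  define f where "f n m j t = ennreal (q ^ m * q ^ j / D n m j) *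
      (of_nat (?N n m j t) * indicator (ball 0 R) t)" for n m j t
  have [measurable]: "ball (0 :: real ^ 'd ^ 'i) R \<in> sets borel" by simp
  have fm [measurable]: "f n m j \<in> borel_measurable borel" for n m j
    unfolding f_def by measurable
  define Z where "Z n t = (\<Sum>m. \<Sum>j. f n m j t)" for n t
  have [measurable]: "Z n \<in> borel_measurable borel" for n unfolding Z_def by measurable
  have Zint: "(\<integral>\<^sup>+ t. Z n t \<partial>lborel) \<le> ennreal (C / (1 - q) / (1 - q))" for n
  proof -
    have "(\<integral>\<^sup>+ t. f n m j t \<partial>lborel) \<le> ennreal (C * q ^ m * q ^ j)" for m j
    proof -
      have "(\<integral>\<^sup>+ t. f n m j t \<partial>lborel) = ennreal (q ^ m * q ^ j / D n m j) *
          (\<integral>\<^sup>+ t. of_nat (?N n m j t) * indicator (ball 0 R) t \<partial>lborel)"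
        unfolding f_def by (subst nn_integral_cmult) auto
      also have "\<dots> \<le> ennreal (q ^ m * q ^ j / D n m j) * ennreal (C * (\<Prod>i\<in>UNIV. \<delta> n m j i) * real CARD('i) ^ (2 * n))"
        using \<delta> by (intro mult_left_mono int) (auto intro: less_imp_le)
      also have "C * (\<Prod>i\<in>UNIV. \<delta> n m j i) * real CARD('i) ^ (2 * n) = C * D n m j"
        by (simp add: D_def)
      also have "ennreal (q ^ m * q ^ j / D n m j) * ennreal (C * D n m j) = ennreal (C * q ^ m * q ^ j)"
        using q C D[of n m j] by (subst ennreal_mult[symmetric]) (auto intro: less_imp_le)
      finally show ?thesis .
    qed
    then have "(\<Sum>m. \<Sum>j. \<integral>\<^sup>+ t. f n m j t \<partial>lborel) \<le> (\<Sum>m. \<Sum>j. ennreal (C * q ^ m * q ^ j))"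
      by (intro suminf_le summableI) 
    also have "\<dots> = (\<Sum>m. ennreal (C * q ^ m / (1 - q)))"
      using q C by (intro suminf_cong suminf_ennreal_geometric) auto
    also have "\<dots> = (\<Sum>m. ennreal (C / (1 - q) * q ^ m))" by simp
    also have "\<dots> = ennreal (C / (1 - q) / (1 - q))"
      using q C by (intro suminf_ennreal_geometric) auto
    finally show ?thesis unfolding Z_def by (simp add: nn_integral_suminf)
  qed
  have "(\<integral>\<^sup>+ t. liminf (\<lambda>n. Z n t) \<partial>lborel) \<le> liminf (\<lambda>n. \<integral>\<^sup>+ t. Z n t \<partial>lborel)"
    by (rule nn_integral_liminf) measurable
  also have "\<dots> \<le> liminf (\<lambda>n::nat. ennreal (C / (1 - q) / (1 - q)))"
    using Zint by (intro Liminf_mono) simp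
  also have "\<dots> < \<infinity>" by (simp add: Liminf_const)
  finally have "AE t in lborel. liminf (\<lambda>n. Z n t) \<noteq> \<infinity>"
    by (intro nn_integral_PInf_AE) auto
  then show ?thesis
  proof eventually_elim
    case (elim t)
    show ?case
    proof
      assume t: "t \<in> ball 0 R"
      obtain r where r: "0 \<le> r" "liminf (\<lambda>n. Z n t) = ennreal r"
        using elim by (cases "liminf (\<lambda>n. Z n t)") auto
      have freq: "\<exists>n\<ge>N. Z n t \<le> ennreal (r + 1)" for N
      proof (rule ccontr)
        assume "\<not> ?thesis"
        then have "\<forall>n\<ge>N. ennreal (r + 1) \<le> Z n t" by (meson linear)
        then have "eventually (\<lambda>n. ennreal (r + 1) \<le> Z n t) sequentially"
          by (auto simp: eventually_sequentially)
        then have "ennreal (r + 1) \<le> ennreal r" unfolding r(2)[symmetric] by (rule Liminf_bounded)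
        then show False using r(1) by simp
      qed
      have "real (?N n m j t)
          \<le> (r + 1) * 2 powr (\<kappa> * real (m + j)) * (\<Prod>i\<in>UNIV. \<delta> n m j i) * real CARD('i) ^ (2 * n)"
        if n: "Z n t \<le> ennreal (r + 1)" for n m j
      proof -
        have "f n m j t \<le> (\<Sum>j. f n m j t)" by (rule term_le_suminf_ennreal)
        also have "\<dots> \<le> Z n t" unfolding Z_def by (rule term_le_suminf_ennreal)
        also note n
        also have "f n m j t = ennreal (q ^ m * q ^ j / D n m j * real (?N n m j t))"
          using t q D[of n m j]
          by (simp add: f_def ennreal_of_nat_eq_real_of_nat less_imp_le flip: ennreal_mult)
        finally have "q ^ m * q ^ j / D n m j * real (?N n m j t) \<le> r + 1"
          using r(1) by (subst (asm) ennreal_le_iff) auto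
        moreover have "q ^ m * q ^ j = 1 / 2 powr (\<kappa> * real (m + j))"
          by (simp add: q_def powr_minus_divide power_divide powr_add[symmetric] powr_power algebra_simps)
        ultimately have "real (?N n m j t) / (2 powr (\<kappa> * real (m + j)) * D n m j) \<le> r + 1"
          by simp
        then have "real (?N n m j t) \<le> (r + 1) * (2 powr (\<kappa> * real (m + j)) * D n m j)"
          using D[of n m j] by (subst (asm) pos_divide_le_eq) simp_all
        then show ?thesis by (simp add: D_def mult.assoc)
      qed
      then show "\<exists>C\<ge>0. \<forall>N. \<exists>n\<ge>N. \<forall>m j. real (?N n m j t)
          \<le> C * 2 powr (\<kappa> * real (m + j)) * (\<Prod>i\<in>UNIV. \<delta> n m j i) * real CARD('i) ^ (2 * n)"
        using r(1) freq by (intro exI[of _ "r + 1"]) (auto, blast)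
    qed
  qed
qed

end

section \<open>Filling a box with small dyadic cells\<close>

lemma step_density_of_family:
  assumes "finite I" "\<And>x. x \<in> I \<Longrightarrow> 0 \<le> c x" "\<And>x i. x \<in> I \<Longrightarrow> a x $ i < b x $ i"
  shows "\<exists>S. step_valid S \<and> step_support S = (\<Union>x\<in>I. cbox (a x) (b x)) \<and>
     step_mass S = (\<lambda>Q. \<Sum>x\<in>I. c x * leb (cbox (a x) (b x) \<inter> Q))"
  using assms
proof (induction I rule: finite_induct)
  case empty
  then show ?case by (intro exI[of _ "[]"]) (auto simp: step_simps)
next
  case (insert x I)
  then obtain S where "step_valid S" "step_support S = (\<Union>x\<in>I. cbox (a x) (b x))"
    "step_mass S = (\<lambda>Q. \<Sum>x\<in>I. c x * leb (cbox (a x) (b x) \<inter> Q))" by auto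
  then show ?case using insert.hyps insert.prems
    by (intro exI[of _ "(c x, a x, b x) # S"]) (auto simp: step_simps)
qed

definition cells_inside :: "('d::finite \<Rightarrow> nat) \<Rightarrow> (real ^ 'd) set \<Rightarrow> ('d \<Rightarrow> int) set" where
  "cells_inside e B = {z. dyadic_box e z \<subseteq> B}"

definition cell_centre :: "('d::finite \<Rightarrow> nat) \<Rightarrow> ('d \<Rightarrow> int) \<Rightarrow> real ^ 'd" where
  "cell_centre e z = (\<chi> i. (real_of_int (z i) + 1 / 2) / 2 ^ e i)"

lemma mem_dyadic_box_near_centre:
  assumes "\<And>i. \<bar>x $ i - cell_centre e z $ i\<bar> < 1 / (2 * 2 ^ e i)"
  shows "x \<in> dyadic_box e z"
proof -
  have "\<lfloor>2 ^ e i * x $ i\<rfloor> = z i" for i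
  proof -
    have "2 ^ e i * \<bar>x $ i - cell_centre e z $ i\<bar> < 1 / 2"
      using assms[of i] by (simp add: field_simps)
    moreover have "2 ^ e i * \<bar>x $ i - cell_centre e z $ i\<bar> = \<bar>2 ^ e i * x $ i - (real_of_int (z i) + 1 / 2)\<bar>"
      by (simp add: cell_centre_def abs_mult_pos' right_diff_distrib abs_mult[symmetric] flip: abs_mult_pos)
    ultimately have "\<bar>2 ^ e i * x $ i - (real_of_int (z i) + 1 / 2)\<bar> < 1 / 2" by simp
    then have "real_of_int (z i) \<le> 2 ^ e i * x $ i" "2 ^ e i * x $ i < real_of_int (z i) + 1"
      by linarith+
    then show ?thesis by (simp add: floor_eq_iff)
  qed
  then show ?thesis by (simp add: dyadic_box_def)
qed

lemma cell_centre_mem: "cell_centre e z \<in> dyadic_box e z"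
  by (rule mem_dyadic_box_near_centre) simp

lemma finite_cells_inside: "finite (cells_inside e (cbox a b))"
proof (rule finite_subset)
  show "cells_inside e (cbox a b) \<subseteq> {z. \<forall>i. z i \<in> {\<lfloor>2 ^ e i * a $ i\<rfloor> - 1..\<lfloor>2 ^ e i * b $ i\<rfloor>}}"
  proof safe
    fix z i assume "z \<in> cells_inside e (cbox a b)"
    then have "cell_centre e z \<in> cbox a b" using cell_centre_mem by (auto simp: cells_inside_def)
    then have "a $ i \<le> cell_centre e z $ i" "cell_centre e z $ i \<le> b $ i" by (auto simp: mem_box_cart)
    then have "2 ^ e i * a $ i \<le> real_of_int (z i) + 1 / 2" "real_of_int (z i) + 1 / 2 \<le> 2 ^ e i * b $ i"
      by (auto simp: cell_centre_def field_simps)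
    then show "z i \<in> {\<lfloor>2 ^ e i * a $ i\<rfloor> - 1..\<lfloor>2 ^ e i * b $ i\<rfloor>}" by simp linarith
  qed
qed (rule finite_card_int_boxes, simp)

text \<open>All cells that meet the box shrunk by the largest side of a cell lie inside the box.\<close>

lemma cells_exhaust_box:
  fixes a b :: "real ^ 'd"
  assumes "\<And>i. a $ i < b $ i" "0 < \<epsilon>"
  shows "\<exists>h>0. \<forall>e. (\<forall>i. 1 / 2 ^ e i \<le> (h::real)) \<longrightarrow>
    leb (cbox a b) - (\<Sum>z\<in>cells_inside e (cbox a b). leb (dyadic_box e z)) \<le> \<epsilon>"
proof -
  let ?cells = "\<lambda>e. cells_inside e (cbox a b)"
  have "((\<lambda>h. \<Prod>i\<in>UNIV. (b $ i - h) - (a $ i + h)) \<longlongrightarrow> (\<Prod>i\<in>UNIV. (b $ i - 0) - (a $ i + 0))) (at_right 0)"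
    by (intro tendsto_prod tendsto_intros)
  then have "eventually (\<lambda>h. (\<Prod>i\<in>UNIV. (b $ i - 0) - (a $ i + 0)) - \<epsilon> < (\<Prod>i\<in>UNIV. (b $ i - h) - (a $ i + h))) (at_right 0)"
    using assms(2) by (intro order_tendstoD(1)) auto
  moreover have "eventually (\<lambda>h. \<forall>i. a $ i + h \<le> b $ i - h) (at_right (0::real))"
  proof (rule eventually_all_finite)
    fix i
    have "eventually (\<lambda>h. h < (b $ i - a $ i) / 2) (at_right (0::real))"
      using assms(1)[of i] by (intro order_tendstoD(2)[OF tendsto_ident_at]) auto
    then show "eventually (\<lambda>h. a $ i + h \<le> b $ i - h) (at_right (0::real))"
      by eventually_elim (simp add: field_simps)
  qed
  moreover have "eventually (\<lambda>h::real. 0 < h) (at_right 0)" by (rule eventually_at_right_less)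
  ultimately have "eventually (\<lambda>h. 0 < h \<and> (\<forall>i. a $ i + h \<le> b $ i - h) \<and>
      (\<Prod>i\<in>UNIV. b $ i - a $ i) - \<epsilon> < (\<Prod>i\<in>UNIV. (b $ i - h) - (a $ i + h))) (at_right (0::real))"
    by eventually_elim simp
  then obtain h where h: "0 < h" "\<And>i. a $ i + h \<le> b $ i - h"
      "(\<Prod>i\<in>UNIV. b $ i - a $ i) - \<epsilon> < (\<Prod>i\<in>UNIV. (b $ i - h) - (a $ i + h))"
    using eventually_happens'[OF trivial_limit_at_right_real] by blast
  show ?thesis
  proof (intro exI[of _ h] conjI allI impI)
    fix e :: "'d \<Rightarrow> nat" assume e: "\<forall>i. 1 / 2 ^ e i \<le> h"
    define a' b' :: "real ^ 'd" where "a' = (\<chi> i. a $ i + h)" and "b' = (\<chi> i. b $ i - h)"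
    have fin: "finite (?cells e)" by (rule finite_cells_inside)
    have "cbox a' b' \<subseteq> (\<Union>z\<in>?cells e. dyadic_box e z)"
    proof
      fix x assume x: "x \<in> cbox a' b'"
      define z where "z = (\<lambda>i. \<lfloor>2 ^ e i * x $ i\<rfloor>)"
      have xz: "x \<in> dyadic_box e z" by (simp add: dyadic_box_def z_def)
      have "dyadic_box e z \<subseteq> cbox a b"
      proof
        fix y assume y: "y \<in> dyadic_box e z"
        have "a $ i \<le> y $ i \<and> y $ i \<le> b $ i" for i
        proof -
          have "\<bar>y $ i - x $ i\<bar> < 1 / 2 ^ e i" by (rule dyadic_box_component_close[OF y xz])
          also have "\<dots> \<le> h" using e by simp
          finally have "\<bar>y $ i - x $ i\<bar> < h" .
          moreover have "a $ i + h \<le> x $ i" "x $ i \<le> b $ i - h"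
            using x by (auto simp: mem_box_cart a'_def b'_def)
          ultimately show ?thesis by linarith
        qed
        then show "y \<in> cbox a b" by (simp add: mem_box_cart)
      qed
      then show "x \<in> (\<Union>z\<in>?cells e. dyadic_box e z)" using xz by (auto simp: cells_inside_def)
    qed
    then have "leb (cbox a' b') \<le> leb (\<Union>z\<in>?cells e. dyadic_box e z)"
      using fin by (intro measure_mono_fmeasurable fmeasurable.finite_UN) auto
    also have "\<dots> \<le> (\<Sum>z\<in>?cells e. leb (dyadic_box e z))"
      using fin by (intro measure_UNION_le) auto
    finally have "leb (cbox a' b') \<le> (\<Sum>z\<in>?cells e. leb (dyadic_box e z))" .
    moreover have "leb (cbox a' b') = (\<Prod>i\<in>UNIV. (b $ i - h) - (a $ i + h))"
      using h(2) by (subst measure_cbox_vec) (auto simp: a'_def b'_def)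
    moreover have "leb (cbox a b) = (\<Prod>i\<in>UNIV. b $ i - a $ i)"
      using assms(1) by (subst measure_cbox_vec) (auto intro: less_imp_le)
    ultimately show "leb (cbox a b) - (\<Sum>z\<in>?cells e. leb (dyadic_box e z)) \<le> \<epsilon>"
      using h(3) by linarith
  qed (rule h(1))
qed

lemma sum_cells_le:
  assumes "finite Z" "Z \<subseteq> cells_inside e B" "B \<in> fmeasurable lborel"
  shows "(\<Sum>z\<in>Z. leb (dyadic_box e z)) \<le> leb B"
proof -
  have "(\<Sum>z\<in>Z. leb (dyadic_box e z)) = (\<Sum>z\<in>Z. leb (B \<inter> dyadic_box e z))"
    using assms(2) by (intro sum.cong refl arg_cong[where f = "leb"]) (auto simp: cells_inside_def)
  also have "\<dots> \<le> leb B" by (rule sum_measure_dyadic_le[OF assms(1,3)])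
  finally show ?thesis .
qed

text \<open>The exponent \<open>e i - j\<close> is a truncated subtraction: in the directions in which a cell is at least as
  long as the cube there is just one choice.\<close>

lemma card_cells_meeting_cube:
  fixes e :: "'d::finite \<Rightarrow> nat"
  shows "finite {z. dyadic_box e z \<inter> dyadic_cube j y \<noteq> {}}"
    and "real (card {z. dyadic_box e z \<inter> dyadic_cube j y \<noteq> {}}) \<le> (\<Prod>i\<in>UNIV. 2 ^ (e i - j))"
proof -
  define S where "S i = (if e i \<le> j then {y i div 2 ^ (j - e i)} else {y i * 2 ^ (e i - j)..<y i * 2 ^ (e i - j) + 2 ^ (e i - j)})" for i
  have fin: "finite (S i)" and card: "card (S i) = 2 ^ (e i - j)" for i
    by (auto simp: S_def nat_power_eq)
  have sub: "{z. dyadic_box e z \<inter> dyadic_cube j y \<noteq> {}} \<subseteq> {z. \<forall>i. z i \<in> S i}"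
  proof (intro subsetI CollectI allI)
    fix z i assume "z \<in> {z. dyadic_box e z \<inter> dyadic_cube j y \<noteq> {}}"
    then obtain x where x: "x \<in> dyadic_box e z" "x \<in> dyadic_cube j y" by auto
    have zi: "z i = \<lfloor>2 ^ e i * x $ i\<rfloor>" and yi: "y i = \<lfloor>2 ^ j * x $ i\<rfloor>" using x by (auto simp: dyadic_box_def)
    show "z i \<in> S i"
    proof (cases "e i \<le> j")
      case True
      then have "z i = y i div 2 ^ (j - e i)" unfolding zi yi by (rule floor_coarser_dyadic)
      then show ?thesis using True by (simp add: S_def)
    next
      case False
      then have eq: "(2::real) ^ e i = 2 ^ (e i - j) * 2 ^ j" by (simp flip: power_add)
      have "real_of_int (y i) \<le> 2 ^ j * x $ i" "2 ^ j * x $ i < real_of_int (y i) + 1"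
        unfolding yi by linarith+
      then have "2 ^ (e i - j) * real_of_int (y i) \<le> 2 ^ (e i - j) * (2 ^ j * x $ i)"
        "2 ^ (e i - j) * (2 ^ j * x $ i) < 2 ^ (e i - j) * (real_of_int (y i) + 1)" by simp_all
      then have "real_of_int (y i * 2 ^ (e i - j)) \<le> 2 ^ e i * x $ i"
        "2 ^ e i * x $ i < real_of_int (y i * 2 ^ (e i - j) + 2 ^ (e i - j))"
        unfolding eq by (simp_all add: algebra_simps)
      then show ?thesis using False unfolding S_def zi by (simp add: le_floor_iff floor_less_iff)
    qed
  qed
  then show "finite {z. dyadic_box e z \<inter> dyadic_cube j y \<noteq> {}}"
    by (rule finite_subset) (rule finite_card_int_boxes[OF fin])
  have "card {z. dyadic_box e z \<inter> dyadic_cube j y \<noteq> {}} \<le> (\<Prod>i\<in>UNIV. card (S i))"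
    using card_mono[OF finite_card_int_boxes(1)[OF fin] sub] finite_card_int_boxes(2)[of S, OF fin] by simp
  then have "real (card {z. dyadic_box e z \<inter> dyadic_cube j y \<noteq> {}}) \<le> real (\<Prod>i\<in>UNIV. card (S i))"
    by (simp only: of_nat_le_iff)
  then show "real (card {z. dyadic_box e z \<inter> dyadic_cube j y \<noteq> {}}) \<le> (\<Prod>i\<in>UNIV. 2 ^ (e i - j))"
    by (simp add: card)
qed

text \<open>Spreading the mass \<open>|g|\<close> of each cell \<open>g\<close> by a probability \<open>f z\<close> on it: the number of cells met by a
  cube is the only loss when the energies of the pieces are added up.\<close>

lemma cellwise_level_energy:
  fixes e :: "'d::finite \<Rightarrow> nat" and f :: "('d \<Rightarrow> int) \<Rightarrow> (real ^ 'd) set \<Rightarrow> real"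
  assumes Z: "finite Z" "Z \<subseteq> cells_inside e B" "B \<in> fmeasurable lborel" and "finite Y"
    and zero: "\<And>z Q. z \<in> Z \<Longrightarrow> dyadic_box e z \<inter> Q = {} \<Longrightarrow> f z Q = 0"
    and bound: "\<And>z. z \<in> Z \<Longrightarrow> (\<Sum>y\<in>Y. (f z (dyadic_cube j y))\<^sup>2) \<le> K" and "0 \<le> K"
  shows "(\<Sum>y\<in>Y. (\<Sum>z\<in>Z. leb (dyadic_box e z) * f z (dyadic_cube j y))\<^sup>2)
     \<le> (\<Prod>i\<in>UNIV. 2 ^ (e i - j) / 2 ^ e i) * leb B * K"
proof -
  define g where "g = (\<Prod>i\<in>(UNIV::'d set). 1 / (2::real) ^ e i)"
  have g0: "0 \<le> g" unfolding g_def by (intro prod_nonneg) auto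
  have g: "leb (dyadic_box e z) = g" for z by (simp add: g_def measure_dyadic_box)
  define N where "N = (\<Prod>i\<in>(UNIV::'d set). (2::real) ^ (e i - j))"
  have N0: "0 \<le> N" unfolding N_def by (intro prod_nonneg) auto
  have "(\<Sum>z\<in>Z. g * f z (dyadic_cube j y))\<^sup>2 \<le> N * (\<Sum>z\<in>Z. (g * f z (dyadic_cube j y))\<^sup>2)" for y
  proof -
    define T where "T = {z \<in> Z. dyadic_box e z \<inter> dyadic_cube j y \<noteq> {}}"
    have T: "finite T" "T \<subseteq> Z" using Z(1) by (auto simp: T_def)
    have "card T \<le> card {z. dyadic_box e z \<inter> dyadic_cube j y \<noteq> {}}"
      by (intro card_mono card_cells_meeting_cube(1)) (auto simp: T_def)
    then have cT: "real (card T) \<le> N"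
      using card_cells_meeting_cube(2)[of e j y] unfolding N_def by linarith
    have "(\<Sum>z\<in>Z. g * f z (dyadic_cube j y)) = (\<Sum>z\<in>T. g * f z (dyadic_cube j y))"
      using Z(1) zero by (intro sum.mono_neutral_right) (auto simp: T_def)
    then have "(\<Sum>z\<in>Z. g * f z (dyadic_cube j y))\<^sup>2 \<le> (\<Sum>z\<in>T. (g * f z (dyadic_cube j y))\<^sup>2) * real (card T)"
      using sum_squared_le_sum_of_squares[of "\<lambda>z. g * f z (dyadic_cube j y)" T] by simp
    also have "\<dots> \<le> (\<Sum>z\<in>Z. (g * f z (dyadic_cube j y))\<^sup>2) * N"
      using T Z(1) cT by (intro mult_mono sum_mono2 sum_nonneg) auto
    finally show ?thesis by (simp add: mult.commute)
  qed
  then have "(\<Sum>y\<in>Y. (\<Sum>z\<in>Z. g * f z (dyadic_cube j y))\<^sup>2) \<le> (\<Sum>y\<in>Y. N * (\<Sum>z\<in>Z. (g * f z (dyadic_cube j y))\<^sup>2))"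
    by (intro sum_mono)
  also have "\<dots> = N * g\<^sup>2 * (\<Sum>z\<in>Z. \<Sum>y\<in>Y. (f z (dyadic_cube j y))\<^sup>2)"
    by (subst sum.swap) (simp add: sum_distrib_left power_mult_distrib mult.assoc)
  also have "\<dots> \<le> N * g\<^sup>2 * (\<Sum>z\<in>Z. K)"
    using N0 bound by (intro mult_left_mono sum_mono) auto
  also have "\<dots> = N * g * (\<Sum>z\<in>Z. leb (dyadic_box e z)) * K"
    by (simp add: g power2_eq_square)
  also have "\<dots> \<le> N * g * leb B * K"
    using N0 g0 \<open>0 \<le> K\<close> by (intro mult_left_mono mult_right_mono sum_cells_le[OF Z]) auto
  also have "N * g = (\<Prod>i\<in>UNIV. 2 ^ (e i - j) / 2 ^ e i)"
    by (simp add: N_def g_def flip: prod.distrib)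
  finally show ?thesis by (simp add: g)
qed

section \<open>Energy of equidistributed word boxes\<close>

lemma measure_box_cube_le:
  fixes p :: "real ^ 'd"
  assumes "\<And>i. 0 < c i"
  shows "leb (cbox (\<chi> i. p $ i - c i) (\<chi> i. p $ i + c i) \<inter> dyadic_cube j y)
    \<le> (\<Prod>i\<in>UNIV. min (2 * c i) (1 / 2 ^ j))"
proof -
  define a b :: "real ^ 'd" where
    "a = (\<chi> i. max (p $ i - c i) (real_of_int (y i) / 2 ^ j))" and
    "b = (\<chi> i. min (p $ i + c i) ((real_of_int (y i) + 1) / 2 ^ j))"
  have pos: "0 \<le> (\<Prod>i\<in>UNIV. min (2 * c i) (1 / 2 ^ j))"
    using assms by (intro prod_nonneg) (auto intro: less_imp_le)
  have "cbox (\<chi> i. p $ i - c i) (\<chi> i. p $ i + c i) \<inter> dyadic_cube j y \<subseteq> cbox a b"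
    by (auto simp: mem_box_cart dyadic_box_alt a_def b_def less_imp_le)
  then have "leb (cbox (\<chi> i. p $ i - c i) (\<chi> i. p $ i + c i) \<inter> dyadic_cube j y) \<le> leb (cbox a b)"
    by (intro measure_mono_fmeasurable) auto
  also have "\<dots> \<le> (\<Prod>i\<in>UNIV. min (2 * c i) (1 / 2 ^ j))"
  proof (cases "\<forall>i. a $ i \<le> b $ i")
    case True
    have "b $ i - a $ i \<le> min (2 * c i) (1 / 2 ^ j)" for i
      by (auto simp: a_def b_def add_divide_distrib min_def max_def)
    then have "(\<Prod>i\<in>UNIV. b $ i - a $ i) \<le> (\<Prod>i\<in>UNIV. min (2 * c i) (1 / 2 ^ j))"
      using True by (intro prod_mono) auto
    then show ?thesis using measure_cbox_vec[of a b] True by simp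
  next
    case False
    then have "cbox a b = {}" by (auto simp: interval_eq_empty_cart not_le)
    then show ?thesis using pos by simp
  qed
  finally show ?thesis .
qed

context diagonal_contraction
begin

definition word_box :: "real ^ 'd ^ 'i::finite \<Rightarrow> (nat \<Rightarrow> 'i) \<Rightarrow> ('d \<Rightarrow> real) \<Rightarrow> 'i list \<Rightarrow> (real ^ 'd) set" where
  "word_box t a c w = cbox (\<chi> i. code_point l t (prepend w a) $ i - c i) (\<chi> i. code_point l t (prepend w a) $ i + c i)"

lemma mem_word_box: "x \<in> word_box t a c w \<longleftrightarrow> (\<forall>i. \<bar>x $ i - code_point l t (prepend w a) $ i\<bar> \<le> c i)"
  by (auto simp: word_box_def mem_box_cart abs_le_iff algebra_simps)

lemma word_box_fmeasurable [simp]: "word_box t a c w \<in> fmeasurable lborel"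
  by (simp add: word_box_def)

lemma measure_word_box:
  assumes "\<And>i. 0 < c i"
  shows "leb (word_box t a c w) = (\<Prod>i\<in>UNIV. 2 * c i)"
  using assms unfolding word_box_def by (subst measure_cbox_vec) (auto intro: less_imp_le)

text \<open>Two word boxes can only contribute to the same cube if their centres are close to each other, so the
  energy of the equidistributed boxes splits into the diagonal and the count of close pairs.\<close>

lemma word_boxes_level_energy:
  fixes t :: "real ^ 'd ^ 'i::finite" and a :: "nat \<Rightarrow> 'i" and c :: "'d \<Rightarrow> real" and v :: "'i list"
    and m n j :: nat and R :: real and Y :: "('d \<Rightarrow> int) set"
  assumes c: "\<And>i. 0 < c i" and R: "\<And>b i. \<bar>t $ b $ i\<bar> \<le> R" and v: "length v = m" and Y: "finite Y"
  defines "\<theta> \<equiv> \<lambda>Q. (\<Sum>w\<in>words n. leb (word_box t a c (v @ w) \<inter> Q) / (\<Prod>i\<in>UNIV. 2 * c i)) / real CARD('i) ^ n"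
    and "\<delta> \<equiv> \<lambda>i. min (4 * R) ((1 / 2 ^ j + 2 * c i) / l i ^ m)"
    and "\<gamma> \<equiv> \<Prod>i\<in>UNIV. min 1 (1 / 2 ^ j / (2 * c i))"
  shows "(\<Sum>y\<in>Y. (\<theta> (dyadic_cube j y))\<^sup>2)
     \<le> \<gamma> * (1 / real CARD('i) ^ n + real (card (close_pairs n \<delta> a t)) / real CARD('i) ^ (2 * n))"
proof -
  let ?\<Delta> = "\<lambda>w w' i. code_point l t (prepend w a) $ i - code_point l t (prepend w' a) $ i"
  let ?Q = "dyadic_cube j :: ('d \<Rightarrow> int) \<Rightarrow> _"
  define vol where "vol = (\<Prod>i\<in>UNIV. 2 * c i)"
  have vol: "0 < vol" unfolding vol_def using c by (intro prod_pos) auto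
  define f where "f w Q = leb (word_box t a c (v @ w) \<inter> Q) / vol" for w Q
  have f0: "0 \<le> f w Q" for w Q using vol by (simp add: f_def)
  have f\<gamma>: "f w (?Q y) \<le> \<gamma>" for w y
  proof -
    have "leb (word_box t a c (v @ w) \<inter> ?Q y) \<le> (\<Prod>i\<in>UNIV. min (2 * c i) (1 / 2 ^ j))"
      unfolding word_box_def by (rule measure_box_cube_le[OF c])
    also have "\<dots> = (\<Prod>i\<in>UNIV. min 1 (1 / 2 ^ j / (2 * c i)) * (2 * c i))"
    proof (intro prod.cong refl)
      fix i
      show "min (2 * c i) (1 / 2 ^ j) = min 1 (1 / 2 ^ j / (2 * c i)) * (2 * c i)"
        using c[of i] by (simp add: min_mult_distrib_right)
    qed
    also have "\<dots> = \<gamma> * vol" by (simp add: \<gamma>_def vol_def prod.distrib)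
    finally show ?thesis using vol by (simp add: f_def divide_le_eq)
  qed
  have \<gamma>0: "0 \<le> \<gamma>" using f0 f\<gamma> order_trans by blast
  have fsum: "(\<Sum>y\<in>Y. f w (?Q y)) \<le> 1" for w
  proof -
    have "(\<Sum>y\<in>Y. leb (word_box t a c (v @ w) \<inter> ?Q y)) \<le> vol"
      using sum_measure_dyadic_le[OF Y, of "word_box t a c (v @ w)" "\<lambda>_. j"] c
      by (simp add: measure_word_box vol_def)
    then show ?thesis using vol by (simp add: f_def sum_divide_distrib[symmetric])
  qed
  have pair: "(\<Sum>y\<in>Y. f w (?Q y) * f w' (?Q y)) \<le> \<gamma>" for w w'
  proof -
    have "(\<Sum>y\<in>Y. f w (?Q y) * f w' (?Q y)) \<le> (\<Sum>y\<in>Y. f w (?Q y) * \<gamma>)"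
      using f0 f\<gamma> by (intro sum_mono mult_left_mono)
    also have "\<dots> = (\<Sum>y\<in>Y. f w (?Q y)) * \<gamma>" by (simp add: sum_distrib_right)
    also have "\<dots> \<le> 1 * \<gamma>" using fsum \<gamma>0 by (intro mult_right_mono)
    finally show ?thesis by simp
  qed
  have far: "f w (?Q y) * f w' (?Q y) = 0"
    if w: "w \<in> words n" "w' \<in> words n" "w \<noteq> w'" "(w, w') \<notin> close_pairs n \<delta> a t" for w w' y
  proof (rule ccontr)
    assume "f w (?Q y) * f w' (?Q y) \<noteq> 0"
    then have "word_box t a c (v @ w) \<inter> ?Q y \<noteq> {}" "word_box t a c (v @ w') \<inter> ?Q y \<noteq> {}"
      by (auto simp: f_def)
    then obtain x x' where x: "x \<in> word_box t a c (v @ w)" "x \<in> ?Q y"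
      and x': "x' \<in> word_box t a c (v @ w')" "x' \<in> ?Q y" by blast
    have "\<bar>(?\<Delta> w w' i)\<bar> \<le> \<delta> i" for i
    proof -
      have 1: "\<bar>x $ i - x' $ i\<bar> < 1 / 2 ^ j" by (rule dyadic_box_component_close[OF x(2) x'(2)])
      have 2: "\<bar>x $ i - code_point l t (prepend (v @ w) a) $ i\<bar> \<le> c i"
        "\<bar>x' $ i - code_point l t (prepend (v @ w') a) $ i\<bar> \<le> c i"
        using x(1) x'(1) by (auto simp: mem_word_box)
      have "code_point l t (prepend (v @ w) a) $ i - code_point l t (prepend (v @ w') a) $ i
          = l i ^ m * (?\<Delta> w w' i)"
        by (simp add: prepend_append code_point_prepend[of t v] word_map_diff_nth v)
      then have "\<bar>l i ^ m * (?\<Delta> w w' i)\<bar> \<le> 1 / 2 ^ j + 2 * c i"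
        using 1 2 by linarith
      then have "\<bar>(?\<Delta> w w' i)\<bar> \<le> (1 / 2 ^ j + 2 * c i) / l i ^ m"
        using l_pos[of i] by (simp add: abs_mult power_abs pos_le_divide_eq mult.commute)
      moreover have "\<bar>(?\<Delta> w w' i)\<bar> \<le> 4 * R"
        using code_point_bound[of t i R "prepend w a"] code_point_bound[of t i R "prepend w' a"] R by simp
      ultimately show ?thesis by (simp add: \<delta>_def)
    qed
    then have "(w, w') \<in> close_pairs n \<delta> a t" using w by (simp add: close_pairs_def close_params_def)
    then show False using w(4) by simp
  qed
  let ?W = "words n :: 'i list set"
  have W: "finite ?W" by (rule finite_words)
  have k: "0 < real CARD('i)" by simp
  have "\<theta> Q = (\<Sum>w\<in>?W. f w Q) / real CARD('i) ^ n" for Q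
    by (simp add: \<theta>_def f_def vol_def)
  then have "(\<Sum>y\<in>Y. (\<theta> (?Q y))\<^sup>2)
      = (\<Sum>y\<in>Y. (\<Sum>w\<in>?W. \<Sum>w'\<in>?W. f w (?Q y) * f w' (?Q y))) / real CARD('i) ^ (2 * n)"
    by (simp add: power_divide sum_divide_distrib[symmetric] power2_eq_square sum_product mult_2 power_add)
  also have "(\<Sum>y\<in>Y. (\<Sum>w\<in>?W. \<Sum>w'\<in>?W. f w (?Q y) * f w' (?Q y)))
      = (\<Sum>p\<in>?W \<times> ?W. \<Sum>y\<in>Y. f (fst p) (?Q y) * f (snd p) (?Q y))"
    by (subst sum.swap) (simp add: sum.cartesian_product case_prod_unfold)
  also have "\<dots> \<le> (\<Sum>p\<in>?W \<times> ?W. (if p \<in> (\<lambda>w. (w, w)) ` ?W then \<gamma> else 0) + (if p \<in> close_pairs n \<delta> a t then \<gamma> else 0))"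
  proof (rule sum_mono)
    fix p assume p: "p \<in> ?W \<times> ?W"
    show "(\<Sum>y\<in>Y. f (fst p) (?Q y) * f (snd p) (?Q y))
        \<le> (if p \<in> (\<lambda>w. (w, w)) ` ?W then \<gamma> else 0) + (if p \<in> close_pairs n \<delta> a t then \<gamma> else 0)"
    proof (cases "fst p = snd p \<or> p \<in> close_pairs n \<delta> a t")
      case True
      then have "\<gamma> \<le> (if p \<in> (\<lambda>w. (w, w)) ` ?W then \<gamma> else 0) + (if p \<in> close_pairs n \<delta> a t then \<gamma> else 0)"
        using p \<gamma>0 by (cases p) (auto simp: image_iff)
      then show ?thesis using pair[of "fst p" "snd p"] by linarith
    next
      case False
      then have "(\<Sum>y\<in>Y. f (fst p) (?Q y) * f (snd p) (?Q y)) = 0"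
        using p far[of "fst p" "snd p"] by (intro sum.neutral) (cases p, auto)
      then show ?thesis using \<gamma>0 by simp
    qed
  qed
  also have "\<dots> = \<gamma> * (real CARD('i) ^ n + real (card (close_pairs n \<delta> a t)))"
  proof -
    have "(\<Sum>p\<in>?W \<times> ?W. if p \<in> (\<lambda>w. (w, w)) ` ?W then \<gamma> else 0) = \<gamma> * real (card ((\<lambda>w. (w, w)) ` ?W))"
      using W by (subst sum.inter_restrict[symmetric]) (auto simp: Int_absorb1 image_subset_iff)
    also have "card ((\<lambda>w. (w, w)) ` ?W) = CARD('i) ^ n"
      by (subst card_image) (auto simp: inj_on_def card_words)
    finally have 1: "(\<Sum>p\<in>?W \<times> ?W. if p \<in> (\<lambda>w. (w, w)) ` ?W then \<gamma> else 0) = \<gamma> * real CARD('i) ^ n" by simp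
    have "close_pairs n \<delta> a t \<subseteq> ?W \<times> ?W" by (auto simp: close_pairs_def)
    then have "(\<Sum>p\<in>?W \<times> ?W. if p \<in> close_pairs n \<delta> a t then \<gamma> else 0) = \<gamma> * real (card (close_pairs n \<delta> a t))"
      using W by (subst sum.inter_restrict[symmetric]) (auto simp: Int_absorb1)
    then show ?thesis using 1 by (simp add: sum.distrib algebra_simps)
  qed
  finally have "(\<Sum>y\<in>Y. (\<theta> (?Q y))\<^sup>2)
      \<le> \<gamma> * (real CARD('i) ^ n + real (card (close_pairs n \<delta> a t))) / real CARD('i) ^ (2 * n)"
    by (simp add: divide_right_mono)
  also have "\<dots> = \<gamma> * (1 / real CARD('i) ^ n + real (card (close_pairs n \<delta> a t)) / real CARD('i) ^ (2 * n))"
  proof -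
    have "\<gamma> * (X + N) / (X * X) = \<gamma> * (1 / X + N / (X * X))" if "X \<noteq> 0" for X N
      using that by (simp add: field_simps)
    from this[of "real CARD('i) ^ n"] show ?thesis using k by (simp add: mult_2 power_add)
  qed
  finally show ?thesis .
qed

end

text \<open>The contribution of one coordinate to the close pairs: the number of cells met by a cube, times their side, times the
  share of a box in the cube, times the separation allowed. Whatever the order of the three
  scales \<open>2 ^ -e\<close>, \<open>2 ^ -j\<close> and \<open>c\<close>, the result is at most a constant times the side of the cube.\<close>

lemma scale_factor_le:
  fixes R c r :: real and e j :: nat
  assumes "1 \<le> R" "0 < c" "0 < r" "1 / 2 ^ e \<le> 32 * R * r"
  shows "2 ^ (e - j) / 2 ^ e * min 1 (1 / 2 ^ j / (2 * c)) * min (4 * R) ((1 / 2 ^ j + 2 * c) / r) \<le> 64 * R * (1 / 2 ^ j)"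
proof (cases "j \<le> e")
  case True
  have "2 ^ (e - j) / 2 ^ e = 1 / (2::real) ^ j" using True by (simp add: power_diff)
  moreover have "1 / 2 ^ j * min 1 (1 / 2 ^ j / (2 * c)) * min (4 * R) ((1 / 2 ^ j + 2 * c) / r) \<le> 1 / 2 ^ j * 1 * (4 * R)"
    using assms by (intro mult_mono) auto
  moreover have "1 / 2 ^ j * 1 * (4 * R) \<le> 64 * R * (1 / 2 ^ j)" using assms(1) by (simp add: divide_right_mono)
  ultimately show ?thesis by simp
next
  case False
  define x :: real where "x = 1 / 2 ^ j"
  have x: "0 < x" by (simp add: x_def)
  have "min 1 (x / (2 * c)) * (x + 2 * c) \<le> 2 * x"
  proof (cases "2 * c \<le> x")
    case True
    have "min 1 (x / (2 * c)) * (x + 2 * c) \<le> 1 * (x + 2 * c)" using assms x by (intro mult_right_mono) auto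
    then show ?thesis using True by simp
  next
    case False
    have "min 1 (x / (2 * c)) * (x + 2 * c) \<le> x / (2 * c) * (2 * (2 * c))" using assms x False by (intro mult_mono) auto
    then show ?thesis using assms by simp
  qed
  then have *: "min 1 (x / (2 * c)) * ((x + 2 * c) / r) \<le> 2 * x / r"
    using assms(3) by (simp add: divide_right_mono)
  have "1 / 2 ^ e * (min 1 (x / (2 * c)) * min (4 * R) ((x + 2 * c) / r)) \<le> (32 * R * r) * (2 * x / r)"
  proof (rule mult_mono[OF assms(4)])
    have "min 1 (x / (2 * c)) * min (4 * R) ((x + 2 * c) / r) \<le> min 1 (x / (2 * c)) * ((x + 2 * c) / r)"
      using assms x by (intro mult_left_mono) auto
    then show "min 1 (x / (2 * c)) * min (4 * R) ((x + 2 * c) / r) \<le> 2 * x / r" using * by linarith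
  qed (use assms x in auto)
  also have "\<dots> = 64 * R * x" using assms(3) by simp
  finally show ?thesis using False by (simp add: x_def)
qed

lemma sum_if_split_le:
  fixes f g :: "nat \<Rightarrow> real"
  assumes "\<And>j. 0 \<le> f j" "\<And>j. 0 \<le> g j" "\<And>N. (\<Sum>j<N. g (J + j)) \<le> T"
  shows "(\<Sum>j<N. if j < J then f j else g j) \<le> (\<Sum>j<J. f j) + T"
proof -
  have "(\<Sum>j<N. if j < J then f j else g j) \<le> (\<Sum>j<J + N. if j < J then f j else g j)"
    using assms by (intro sum_mono2) auto
  also have "\<dots> = (\<Sum>j<J. if j < J then f j else g j) + (\<Sum>j=J..<J + N. if j < J then f j else g j)"
    unfolding lessThan_atLeast0 by (rule sum.atLeastLessThan_concat[symmetric]) simp_all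
  also have "(\<Sum>j<J. if j < J then f j else g j) = (\<Sum>j<J. f j)" by (intro sum.cong) auto
  also have "(\<Sum>j=J..<J + N. if j < J then f j else g j) = (\<Sum>j=J..<J + N. g j)" by (intro sum.cong) auto
  also have "\<dots> = (\<Sum>j<N. g (J + j))"
    using sum.shift_bounds_nat_ivl[of g 0 J N] by (simp add: lessThan_atLeast0 add.commute)
  finally show ?thesis using assms(3)[of N] by linarith
qed

context diagonal_contraction
begin

text \<open>Three kinds of levels are distinguished. Up to level \<open>J\<close> only the part of the box left uncovered by cells
  matters. Between \<open>J\<close> and the size of the cells the energy is at most that of Lebesgue measure. Beyond,
  the two energies are estimated separately; such levels satisfy \<open>2 ^ m \<le> 32 * R * 2 ^ j\<close>, which turns the loss
  \<open>2 powr (\<kappa> * m)\<close> in the number of close pairs into a loss in \<open>j\<close> and keeps the tail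
  bound independent of \<open>m\<close>. This allows the order of choice \<open>J\<close>, then \<open>m\<close>, then \<open>n\<close>.\<close>

lemma box_refinement:
  fixes t :: "real ^ 'd ^ 'i::finite" and a :: "nat \<Rightarrow> 'i" and \<rho> :: "nat \<Rightarrow> real" and lo hi :: "real ^ 'd"
  defines "c \<equiv> \<lambda>n i. l i ^ n * \<rho> n"
  assumes \<rho>: "\<And>n. 0 < \<rho> n" "\<And>n. \<rho> n \<le> 1"
    and R: "1 \<le> R" "\<And>b i. \<bar>t $ b $ i\<bar> \<le> R"
    and few: "\<And>N. \<exists>n\<ge>N. \<forall>m j.
        real (card (close_pairs n (\<lambda>i. min (4 * R) ((1 / 2 ^ j + 2 * c (m + n) i) / l i ^ m)) a t))
        \<le> Ct * 2 powr (\<kappa> * real (m + j)) * (\<Prod>i\<in>UNIV. min (4 * R) ((1 / 2 ^ j + 2 * c (m + n) i) / l i ^ m))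
           * real CARD('i) ^ (2 * n)"
    and diag: "\<And>\<epsilon>. 0 < \<epsilon> \<Longrightarrow> \<exists>N. \<forall>n\<ge>N. \<forall>J. (\<Sum>j<J. 2 powr (u * real j) *
        ((\<Prod>i\<in>UNIV. min 1 (1 / 2 ^ j / (2 * c n i))) / real CARD('i) ^ n)) \<le> \<epsilon>"
    and const: "0 \<le> Ct" "0 < \<kappa>" "u + 2 * \<kappa> < real CARD('d)"
    and box: "cbox lo hi \<subseteq> attractor t" "\<And>i. lo $ i < hi $ i" and \<epsilon>: "0 < \<epsilon>"
  shows "\<exists>S. step_valid S \<and>
     step_support S \<subseteq> cbox lo hi \<inter> (\<Union>w\<in>{w. n0 \<le> length w}. word_box t a (c (length w)) w) \<and>
     energy_close u (step_mass S) (\<lambda>Q. leb (cbox lo hi \<inter> Q)) \<epsilon>"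
proof -
  let ?\<Delta> = "\<lambda>w y i. code_point l t (prepend w a) $ i - y $ i"
  define B where "B = cbox lo hi"
  have Bm: "B \<in> fmeasurable lborel" by (simp add: B_def)
  define V where "V = leb B"
  have V: "0 \<le> V" by (simp add: V_def)
  define k where "k = real CARD('i)"
  have k: "0 < k" by (simp add: k_def)
  have c0: "0 < c n i" for n i using l_pos[of i] \<rho>(1)[of n] by (simp add: c_def)
  \<comment> \<open>One \<open>\<kappa>\<close> for the weight in \<open>j\<close> and one for the weight in \<open>m\<close> still leave a decaying tail.\<close>
  define x where "x = 2 powr (u + 2 * \<kappa> - real CARD('d))"
  have x: "0 < x" "x < 1" using const by (auto simp: x_def powr_less_one)
  define K where "K = V * (Ct * (64 * R) ^ CARD('d) * (32 * R) powr \<kappa> + 1)"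
  have K: "0 \<le> K" unfolding K_def using V const R by (intro mult_nonneg_nonneg add_nonneg_nonneg) auto
  \<comment> \<open>The square of the error is divided among the coarse levels, the fine levels and the diagonal.\<close>
  define e3 where "e3 = \<epsilon>\<^sup>2 / 3"
  have e3: "0 < e3" using \<epsilon> by (simp add: e3_def)

  \<comment> \<open>The levels from \<open>J\<close> on carry little energy, whatever the scale of the cells.\<close>
  obtain J where J: "x ^ J * (K / (1 - x)) < e3"
    using power_times_eventually_small[of x e3 "K / (1 - x)"] x e3 by auto
  define H where "H = (\<Sum>j<J. 2 powr (u * real j))"
  have H: "0 \<le> H" unfolding H_def by (intro sum_nonneg) auto
  define \<tau> where "\<tau> = sqrt (e3 / (H + 1))"
  have \<tau>: "0 < \<tau>" "\<tau>\<^sup>2 * H \<le> e3"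
  proof -
    show "0 < \<tau>" using e3 H by (simp add: \<tau>_def)
    have "\<tau>\<^sup>2 * H = e3 / (H + 1) * H" using e3 H by (simp add: \<tau>_def)
    also have "\<dots> \<le> e3" using e3 H by (simp add: divide_le_eq)
    finally show "\<tau>\<^sup>2 * H \<le> e3" .
  qed

  \<comment> \<open>The cells are so small that they fill the box up to \<open>\<tau>\<close> and are finer than the cubes of level \<open>J\<close>.\<close>
  obtain h where h: "0 < h" "\<And>e. (\<And>i. (1::real) / 2 ^ e i \<le> h) \<Longrightarrow>
      V - (\<Sum>z\<in>cells_inside e B. leb (dyadic_box e z)) \<le> \<tau>"
    using cells_exhaust_box[of lo hi \<tau>] box(2) \<tau>(1) unfolding V_def B_def by blast
  obtain m where "(1 / 2) ^ m * (32 * R) < min h (1 / 2 ^ J)"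
    using power_times_eventually_small[of "1 / 2" "min h (1 / 2 ^ J)" "32 * R"] h(1) by auto
  then have m: "32 * R * (1 / 2) ^ m < min h (1 / 2 ^ J)" by (simp add: mult.commute)
  have lm: "0 < l i ^ m" "l i ^ m \<le> (1 / 2) ^ m" for i
    using l_pos[of i] l_half[of i] by (auto intro!: power_mono)
  have "\<exists>e::nat. 16 * R * l i ^ m \<le> 1 / 2 ^ e \<and> 1 / 2 ^ e < 32 * R * l i ^ m" for i
  proof -
    have "(1::real) / 2 ^ J \<le> 1" by simp
    then have "32 * R * (1 / 2) ^ m \<le> 1" using m by linarith
    moreover have "16 * R * l i ^ m \<le> 16 * R * (1 / 2) ^ m" using lm(2)[of i] R by (intro mult_left_mono) auto
    ultimately have "16 * R * l i ^ m \<le> 1" by linarith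
    moreover have "0 < 16 * R * l i ^ m" using lm(1)[of i] R by simp
    ultimately show ?thesis using dyadic_scale_exists[of "16 * R * l i ^ m"] by auto
  qed
  then obtain e where e: "\<And>i. 16 * R * l i ^ m \<le> 1 / 2 ^ e i" "\<And>i. 1 / 2 ^ e i < 32 * R * l i ^ m"
    by metis
  have e_small: "1 / 2 ^ e i < 32 * R * (1 / 2) ^ m" for i
  proof -
    have "32 * R * l i ^ m \<le> 32 * R * (1 / 2) ^ m" using lm(2)[of i] R by (intro mult_left_mono) auto
    then show ?thesis using e(2)[of i] by linarith
  qed
  have Je: "J \<le> e i" for i
  proof (rule ccontr)
    assume "\<not> J \<le> e i"
    then have "(1::real) / 2 ^ J \<le> 1 / 2 ^ e i" by (intro divide_left_mono power_increasing) auto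
    then show False using e_small[of i] m by linarith
  qed
  define Z where "Z = cells_inside e B"
  have Z: "finite Z" "Z \<subseteq> cells_inside e B" by (auto simp: Z_def B_def finite_cells_inside)
  define g where "g = (\<Prod>i\<in>(UNIV::'d set). 1 / (2::real) ^ e i)"
  have g0: "0 < g" unfolding g_def by (intro prod_pos) auto
  have g: "leb (dyadic_box e z) = g" for z by (simp add: g_def measure_dyadic_box)
  have fill: "V - (\<Sum>z\<in>Z. leb (dyadic_box e z)) \<le> \<tau>"
    unfolding Z_def
  proof (rule h(2))
    show "1 / 2 ^ e i \<le> h" for i using e_small[of i] m by linarith
  qed

  \<comment> \<open>The centre of each cell lies in the attractor, which selects a word for the cell.\<close>
  have "\<exists>v. length v = m \<and> (\<exists>y\<in>attractor t. cell_centre e z = word_map l t v y)" if "z \<in> Z" for z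
  proof -
    have "cell_centre e z \<in> attractor t"
      using that cell_centre_mem[of e z] box(1) by (auto simp: Z_def cells_inside_def B_def)
    then show ?thesis using invariant_decompose[OF attractor_invariant] by blast
  qed
  then obtain v where v: "\<And>z. z \<in> Z \<Longrightarrow> length (v z) = m"
      "\<And>z. z \<in> Z \<Longrightarrow> \<exists>y\<in>attractor t. cell_centre e z = word_map l t (v z) y"
    by metis

  \<comment> \<open>Only now the length of the words is chosen; the diagonal term tends to \<open>0\<close> for fixed \<open>m\<close>.\<close>
  obtain N where N: "\<And>n J. N \<le> n \<Longrightarrow> (\<Sum>j<J. 2 powr (u * real j) *
        ((\<Prod>i\<in>UNIV. min 1 (1 / 2 ^ j / (2 * c n i))) / k ^ n)) \<le> e3 / (V * k ^ m + 1)"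
    using diag[of "e3 / (V * k ^ m + 1)"] e3 V k unfolding k_def by (auto simp: add_nonneg_pos)
  obtain n where n: "max N n0 \<le> n" and pairs: "\<And>m j.
        real (card (close_pairs n (\<lambda>i. min (4 * R) ((1 / 2 ^ j + 2 * c (m + n) i) / l i ^ m)) a t))
        \<le> Ct * 2 powr (\<kappa> * real (m + j)) * (\<Prod>i\<in>UNIV. min (4 * R) ((1 / 2 ^ j + 2 * c (m + n) i) / l i ^ m))
           * k ^ (2 * n)"
    using few[of "max N n0"] unfolding k_def by blast
  define C where "C = c (m + n)"
  have C: "0 < C i" for i using c0 by (simp add: C_def)
  define vol where "vol = (\<Prod>i\<in>UNIV. 2 * C i)"
  have vol: "0 < vol" unfolding vol_def using C by (intro prod_pos) auto
  define wb where "wb z w = word_box t a C (v z @ w)" for z w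
  have wb_vol: "leb (wb z w) = vol" for z w
    unfolding wb_def vol_def by (rule measure_word_box[OF C])
  have wb_cell: "wb z w \<subseteq> dyadic_box e z" if z: "z \<in> Z" for z w
  proof
    fix p assume p: "p \<in> wb z w"
    obtain y where y: "y \<in> attractor t" "cell_centre e z = word_map l t (v z) y" using v(2)[OF z] by blast
    show "p \<in> dyadic_box e z"
    proof (rule mem_dyadic_box_near_centre)
      fix i
      have "\<bar>p $ i - code_point l t (prepend (v z @ w) a) $ i\<bar> \<le> C i" using p by (simp add: wb_def mem_word_box)
      moreover have "C i \<le> l i ^ m"
      proof -
        have "C i = l i ^ m * (l i ^ n * \<rho> (m + n))" by (simp add: C_def c_def power_add)
        also have "\<dots> \<le> l i ^ m * (1 * 1)"
          using l_pos[of i] l_half[of i] \<rho>[of "m + n"] by (intro mult_left_mono mult_mono power_le_one) auto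
        finally show ?thesis by simp
      qed
      moreover have "code_point l t (prepend (v z @ w) a) $ i - cell_centre e z $ i
          = l i ^ m * (?\<Delta> w y i)"
        by (simp add: y(2) prepend_append code_point_prepend[of t "v z"] word_map_diff_nth v(1)[OF z])
      moreover have "\<bar>l i ^ m * (?\<Delta> w y i)\<bar> \<le> l i ^ m * (4 * R)"
      proof -
        have "\<bar>code_point l t (prepend w a) $ i\<bar> \<le> 2 * R" "\<bar>y $ i\<bar> \<le> 2 * R"
          using code_point_bound R(2) attractor_bound[OF R(2) y(1)] by blast+
        then have "\<bar>(?\<Delta> w y i)\<bar> \<le> 4 * R" by linarith
        then have "l i ^ m * \<bar>(?\<Delta> w y i)\<bar> \<le> l i ^ m * (4 * R)"
          using lm(1)[of i] by (intro mult_left_mono) auto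
        then show ?thesis using lm(1)[of i] l_pos[of i] by (simp add: abs_mult power_abs)
      qed
      moreover have "l i ^ m + l i ^ m * (4 * R) < 8 * R * l i ^ m"
      proof -
        have "l i ^ m * 1 \<le> l i ^ m * R" using lm(1)[of i] R(1) by (intro mult_left_mono) auto
        moreover have "0 < l i ^ m * R" using lm(1)[of i] R(1) by simp
        ultimately show ?thesis by (simp add: algebra_simps)
      qed
      moreover have "8 * R * l i ^ m \<le> 1 / (2 * 2 ^ e i)"
        using e(1)[of i] by simp
      ultimately show "\<bar>p $ i - cell_centre e z $ i\<bar> < 1 / (2 * 2 ^ e i)" by linarith
    qed
  qed
  define \<theta> where "\<theta> z Q = (\<Sum>w\<in>words n. leb (wb z w \<inter> Q) / vol) / k ^ n" for z Q
  have \<theta>_zero: "\<theta> z Q = 0" if "z \<in> Z" "dyadic_box e z \<inter> Q = {}" for z Q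
  proof -
    have "wb z w \<inter> Q = {}" for w using wb_cell[OF that(1)] that(2) by blast
    then show ?thesis by (simp add: \<theta>_def)
  qed
  have \<theta>_one: "\<theta> z Q = 1" if "z \<in> Z" "dyadic_box e z \<subseteq> Q" for z Q
  proof -
    have "wb z w \<inter> Q = wb z w" for w using wb_cell[OF that(1)] that(2) by blast
    then show ?thesis using vol k by (simp add: \<theta>_def wb_vol card_words k_def)
  qed
  have "\<exists>S. step_valid S \<and> step_support S = (\<Union>p\<in>Z \<times> words n. wb (fst p) (snd p)) \<and>
     step_mass S = (\<lambda>Q. \<Sum>p\<in>Z \<times> words n. g / (vol * k ^ n) * leb (wb (fst p) (snd p) \<inter> Q))"
    unfolding wb_def word_box_def
    by (rule step_density_of_family) (use Z finite_words g0 vol k C in auto)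
  then obtain S where S: "step_valid S" "step_support S = (\<Union>p\<in>Z \<times> words n. wb (fst p) (snd p))"
     "step_mass S = (\<lambda>Q. \<Sum>p\<in>Z \<times> words n. g / (vol * k ^ n) * leb (wb (fst p) (snd p) \<inter> Q))"
    by blast
  have mass: "step_mass S Q = (\<Sum>z\<in>Z. leb (dyadic_box e z) * \<theta> z Q)" for Q
    unfolding S(3) \<theta>_def g
    by (simp add: sum.cartesian_product[symmetric] case_prod_unfold[symmetric] sum_distrib_left sum_divide_distrib)
      (simp add: sum.cartesian_product case_prod_unfold mult_ac)
  have supp: "step_support S \<subseteq> B \<inter> (\<Union>w\<in>{w. n0 \<le> length w}. word_box t a (c (length w)) w)"
  proof
    fix p assume "p \<in> step_support S"
    then obtain z w where zw: "z \<in> Z" "length w = n" "p \<in> wb z w" unfolding S(2) by auto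
    have "p \<in> B" using wb_cell[OF zw(1)] zw by (auto simp: Z_def cells_inside_def)
    moreover have "p \<in> word_box t a (c (length (v z @ w))) (v z @ w)"
      using zw v(1) by (simp add: wb_def C_def)
    moreover have "n0 \<le> length (v z @ w)" using zw n by simp
    ultimately show "p \<in> B \<inter> (\<Union>w\<in>{w. n0 \<le> length w}. word_box t a (c (length w)) w)" by blast
  qed
  define \<gamma> where "\<gamma> j = (\<Prod>i\<in>UNIV. min 1 (1 / 2 ^ j / (2 * C i)))" for j :: nat
  have \<gamma>0: "0 \<le> \<gamma> j" for j unfolding \<gamma>_def using C by (intro prod_nonneg) (auto intro: less_imp_le)
  define E where "E j = (if j < J then \<tau>\<^sup>2 else K * (2 powr (2 * \<kappa> * real j) * (1 / 2 ^ CARD('d)) ^ j)) + V * k ^ m * (\<gamma> j / k ^ (m + n))" for j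
  have extra0: "0 \<le> V * k ^ m * (\<gamma> j / k ^ (m + n))" for j using V k \<gamma>0 by simp
  have "energy_close u (step_mass S) (\<lambda>Q. leb (B \<inter> Q)) \<epsilon>"
  proof (rule energy_close_by_levels)
    fix j and Y :: "('d \<Rightarrow> int) set" assume Y: "finite Y"
    let ?Q = "dyadic_cube j :: ('d \<Rightarrow> int) \<Rightarrow> _"
    let ?B = "\<lambda>y. leb (B \<inter> ?Q y)" and ?S = "\<lambda>y. step_mass S (?Q y)"
    let ?w = "2 powr (2 * \<kappa> * real j) * (1 / 2 ^ CARD('d)) ^ j"
    show "(\<Sum>y\<in>Y. (?S y - ?B y)\<^sup>2) \<le> E j"
    proof (cases "\<forall>i. j \<le> e i")
      case True
      \<comment> \<open>A cube of such a level is a union of cells, up to the uncovered part of the box.\<close>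
      have cell_mass: "leb (dyadic_box e z) * \<theta> z (?Q y) = leb (dyadic_box e z \<inter> ?Q y)" if z: "z \<in> Z" for z y
        using dyadic_box_subset_or_disjoint[of "\<lambda>_. j" e z y] True \<theta>_zero[OF z] \<theta>_one[OF z]
        by (auto simp: Int_absorb2)
      define G where "G = (\<Union>z\<in>Z. dyadic_box e z)"
      have Gm: "G \<in> fmeasurable lborel" unfolding G_def using Z by (intro fmeasurable.finite_UN) auto
      have GB: "G \<subseteq> B" using Z by (auto simp: G_def cells_inside_def)
      have G_int: "leb (G \<inter> Q) = (\<Sum>z\<in>Z. leb (dyadic_box e z \<inter> Q))" if "Q \<in> sets borel" for Q
      proof -
        have "G \<inter> Q = (\<Union>z\<in>Z. dyadic_box e z \<inter> Q)" by (auto simp: G_def)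
        also have "leb \<dots> = (\<Sum>z\<in>Z. leb (dyadic_box e z \<inter> Q))"
        proof (rule measure_finite_Union)
          show "disjoint_family_on (\<lambda>z. dyadic_box e z \<inter> Q) Z"
            using dyadic_box_disjoint by (force simp: disjoint_family_on_def)
          show "emeasure lborel (dyadic_box e z \<inter> Q) \<noteq> \<infinity>" for z
          proof -
            have "dyadic_box e z \<inter> Q \<in> fmeasurable lborel" using that by (intro fmeasurable_Int_fmeasurable) auto
            then show ?thesis by (auto simp: fmeasurable_def)
          qed
        qed (use Z that in auto)
        finally show ?thesis .
      qed
      define d where "d y = leb ((B - G) \<inter> ?Q y)" for y
      have diff: "?S y = ?B y - d y" for y
      proof -
        have "?S y = leb (G \<inter> ?Q y)"
          by (simp add: mass G_int cell_mass)
        moreover have "leb ((B \<inter> ?Q y) - (G \<inter> ?Q y))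
            = ?B y - leb (G \<inter> ?Q y)"
          using GB Bm Gm by (intro measurable_measure_Diff) (auto intro: fmeasurable_Int_fmeasurable)
        moreover have "(B \<inter> ?Q y) - (G \<inter> ?Q y) = (B - G) \<inter> ?Q y" by auto
        ultimately show ?thesis by (simp add: d_def)
      qed
      have d0: "0 \<le> d y" for y by (simp add: d_def)
      have d1: "d y \<le> ?B y" for y
        unfolding d_def using Bm Gm by (intro measure_mono_fmeasurable fmeasurable_Int_fmeasurable) auto
      have lhs: "(\<Sum>y\<in>Y. (?S y - ?B y)\<^sup>2) = (\<Sum>y\<in>Y. (d y)\<^sup>2)"
        by (simp add: diff)
      show ?thesis
      proof (cases "j < J")
        case True
        have "(\<Sum>y\<in>Y. d y) \<le> leb (B - G)"
          unfolding d_def using Y Bm Gm by (intro sum_measure_dyadic_le fmeasurable_Diff) auto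
        also have "\<dots> = V - leb G"
          unfolding V_def using GB Bm Gm by (intro measurable_measure_Diff) auto
        also have "leb G = (\<Sum>z\<in>Z. leb (dyadic_box e z))"
          using G_int[of UNIV] by simp
        also note fill
        finally have "(\<Sum>y\<in>Y. d y) \<le> \<tau>" .
        then have "(\<Sum>y\<in>Y. d y)\<^sup>2 \<le> \<tau>\<^sup>2" using d0 by (intro power_mono sum_nonneg) auto
        moreover have "(\<Sum>y\<in>Y. (d y)\<^sup>2) \<le> (\<Sum>y\<in>Y. d y)\<^sup>2"
          using L2_set_le_sum[of Y d] d0 by (simp add: L2_set_def real_sqrt_le_iff' sum_nonneg sqrt_le_D)
        ultimately show ?thesis using True extra0[of j] by (simp add: lhs E_def)
      next
        case False
        have "(\<Sum>y\<in>Y. (d y)\<^sup>2) \<le> (\<Sum>y\<in>Y. (?B y)\<^sup>2)"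
          using d0 d1 by (intro sum_mono power_mono) auto
        also have "\<dots> \<le> V * (1 / 2 ^ CARD('d)) ^ j" unfolding V_def by (rule box_level_energy[OF Y Bm])
        also have "\<dots> \<le> K * ?w"
        proof -
          have "0 \<le> Ct * (64 * R) ^ CARD('d) * (32 * R) powr \<kappa>" using const R by simp
          then have "V * 1 \<le> K" unfolding K_def using V by (intro mult_left_mono) auto
          moreover have "1 \<le> 2 powr (2 * \<kappa> * real j)" using const by (intro ge_one_powr_ge_zero) auto
          ultimately have "V * 1 * (1 * (1 / 2 ^ CARD('d)) ^ j) \<le> K * ?w"
            using V K by (intro mult_mono mult_right_mono) auto
          then show ?thesis by simp
        qed
        finally show ?thesis using False extra0[of j] by (simp add: lhs E_def)
      qed
    next
      case False
      then obtain i0 where i0: "e i0 < j" by (auto simp: not_le)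
      have Jj: "J \<le> j" using Je[of i0] i0 by simp
      define \<delta> where "\<delta> i = min (4 * R) ((1 / 2 ^ j + 2 * C i) / l i ^ m)" for i
      have \<delta>0: "0 \<le> \<delta> i" for i
        unfolding \<delta>_def using R C[of i] lm(1)[of i] by (intro min.boundedI divide_nonneg_nonneg) (auto intro: less_imp_le add_nonneg_nonneg)
      define P where "P = real (card (close_pairs n \<delta> a t)) / k ^ (2 * n)"
      have P: "0 \<le> P" "P \<le> Ct * 2 powr (\<kappa> * real (m + j)) * (\<Prod>i\<in>UNIV. \<delta> i)"
        using pairs[of j m] k unfolding P_def \<delta>_def C_def by (auto simp: divide_le_eq)
      have level: "(\<Sum>y\<in>Y. (?S y)\<^sup>2)
          \<le> (\<Prod>i\<in>UNIV. 2 ^ (e i - j) / 2 ^ e i) * V * (\<gamma> j * (1 / k ^ n + P))"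
        unfolding mass V_def
      proof (rule cellwise_level_energy[OF Z Bm Y \<theta>_zero])
        show "(\<Sum>y\<in>Y. (\<theta> z (?Q y))\<^sup>2) \<le> \<gamma> j * (1 / k ^ n + P)" if z: "z \<in> Z" for z
          using word_boxes_level_energy[OF C R(2) v(1)[OF z] Y, where n = n and j = j and a = a]
          unfolding \<theta>_def wb_def vol_def \<gamma>_def P_def \<delta>_def k_def .
        show "0 \<le> \<gamma> j * (1 / k ^ n + P)" using \<gamma>0[of j] k P by simp
      qed
      define q where "q = (\<Prod>i\<in>UNIV. 2 ^ (e i - j) / (2::real) ^ e i)"
      have q: "0 \<le> q" "q \<le> 1"
      proof -
        show "0 \<le> q" unfolding q_def by (intro prod_nonneg) auto
        show "q \<le> 1" unfolding q_def by (intro prod_le_1) (auto intro: power_increasing)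
      qed
      have q\<gamma>: "q * \<gamma> j * (\<Prod>i\<in>UNIV. \<delta> i) \<le> (64 * R) ^ CARD('d) * (1 / 2 ^ CARD('d)) ^ j"
      proof -
        have "q * \<gamma> j * (\<Prod>i\<in>UNIV. \<delta> i) = (\<Prod>i\<in>UNIV. 2 ^ (e i - j) / 2 ^ e i * min 1 (1 / 2 ^ j / (2 * C i)) * \<delta> i)"
          by (simp only: q_def \<gamma>_def prod.distrib)
        also have "\<dots> \<le> (\<Prod>i\<in>(UNIV::'d set). 64 * R * (1 / 2 ^ j))"
        proof (intro prod_mono conjI)
          fix i
          show "0 \<le> 2 ^ (e i - j) / 2 ^ e i * min 1 (1 / 2 ^ j / (2 * C i)) * \<delta> i"
            using \<delta>0[of i] C[of i] by (intro mult_nonneg_nonneg) (auto intro: less_imp_le)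
          show "2 ^ (e i - j) / 2 ^ e i * min 1 (1 / 2 ^ j / (2 * C i)) * \<delta> i \<le> 64 * R * (1 / 2 ^ j)"
            unfolding \<delta>_def by (rule scale_factor_le[OF R(1) C lm(1) less_imp_le[OF e(2)]])
        qed
        also have "\<dots> = (64 * R) ^ CARD('d) * (1 / 2 ^ CARD('d)) ^ j"
          by (simp add: power_divide power_mult_distrib flip: power_mult)
        finally show ?thesis .
      qed
      have mj: "2 powr (\<kappa> * real (m + j)) \<le> (32 * R) powr \<kappa> * 2 powr (2 * \<kappa> * real j)"
      proof -
        have "(1::real) / 2 ^ j \<le> 1 / 2 ^ e i0" using i0 by (intro divide_left_mono power_increasing) auto
        then have "1 / 2 ^ j < 32 * R * (1 / 2) ^ m" using e_small[of i0] by linarith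
        then have "2 ^ m \<le> 32 * R * (2::real) ^ j" by (simp add: field_simps)
        then have "(2 ^ m) powr \<kappa> \<le> (32 * R * 2 ^ j) powr \<kappa>" using const by (intro powr_mono2) auto
        then have "2 powr (\<kappa> * real m) \<le> (32 * R) powr \<kappa> * 2 powr (\<kappa> * real j)"
          by (simp add: powr_mult powr_realpow[symmetric] powr_powr mult.commute)
        then have "2 powr (\<kappa> * real m) * 2 powr (\<kappa> * real j) \<le> (32 * R) powr \<kappa> * 2 powr (\<kappa> * real j) * 2 powr (\<kappa> * real j)"
          by (rule mult_right_mono) simp
        then show ?thesis by (simp add: powr_add[symmetric] distrib_left mult.assoc)
      qed
      have "(\<Sum>y\<in>Y. (?S y - ?B y)\<^sup>2)
          \<le> (\<Sum>y\<in>Y. (?S y)\<^sup>2 + (?B y)\<^sup>2)"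
      proof (rule sum_mono)
        fix y
        have "0 \<le> ?S y"
          unfolding mass \<theta>_def using vol k by (intro sum_nonneg mult_nonneg_nonneg divide_nonneg_nonneg) auto
        then have "0 \<le> 2 * ?S y * ?B y" by simp
        then show "(?S y - ?B y)\<^sup>2
            \<le> (?S y)\<^sup>2 + (?B y)\<^sup>2"
          by (simp add: power2_diff)
      qed
      also have "\<dots> \<le> q * V * (\<gamma> j * (1 / k ^ n + P)) + V * (1 / 2 ^ CARD('d)) ^ j"
        unfolding sum.distrib q_def using level box_level_energy[OF Y Bm, of j] unfolding V_def by (intro add_mono)
      also have "q * V * (\<gamma> j * (1 / k ^ n + P)) = V * (q * \<gamma> j * P) + q * (V * \<gamma> j / k ^ n)"
        by (simp add: algebra_simps)
      also have "q * (V * \<gamma> j / k ^ n) \<le> 1 * (V * \<gamma> j / k ^ n)"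
        using q V \<gamma>0[of j] k by (intro mult_right_mono) auto
      also have "1 * (V * \<gamma> j / k ^ n) = V * k ^ m * (\<gamma> j / k ^ (m + n))" using k by (simp add: power_add)
      also have "V * (q * \<gamma> j * P) \<le> V * (Ct * (64 * R) ^ CARD('d) * (32 * R) powr \<kappa> * ?w)"
      proof (rule mult_left_mono[OF _ V])
        have "q * \<gamma> j * P \<le> q * \<gamma> j * (Ct * 2 powr (\<kappa> * real (m + j)) * (\<Prod>i\<in>UNIV. \<delta> i))"
          using q \<gamma>0[of j] P by (intro mult_left_mono) auto
        also have "\<dots> = Ct * 2 powr (\<kappa> * real (m + j)) * (q * \<gamma> j * (\<Prod>i\<in>UNIV. \<delta> i))" by (simp add: mult_ac)
        also have "\<dots> \<le> Ct * ((32 * R) powr \<kappa> * 2 powr (2 * \<kappa> * real j)) * ((64 * R) ^ CARD('d) * (1 / 2 ^ CARD('d)) ^ j)"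
        proof (rule mult_mono[OF mult_left_mono[OF mj const(1)] q\<gamma>])
          show "0 \<le> Ct * ((32 * R) powr \<kappa> * 2 powr (2 * \<kappa> * real j))" using const(1) by simp
          show "0 \<le> q * \<gamma> j * (\<Prod>i\<in>UNIV. \<delta> i)"
            using q(1) \<gamma>0[of j] \<delta>0 by (intro mult_nonneg_nonneg prod_nonneg) auto
        qed
        finally show "q * \<gamma> j * P \<le> Ct * (64 * R) ^ CARD('d) * (32 * R) powr \<kappa> * ?w"
          by (simp add: mult_ac)
      qed
      also have "V * (1 / 2 ^ CARD('d)) ^ j \<le> V * ?w"
      proof (rule mult_left_mono[OF _ V])
        have "1 \<le> 2 powr (2 * \<kappa> * real j)" using const by (intro ge_one_powr_ge_zero) auto
        then have "1 * (1 / 2 ^ CARD('d)) ^ j \<le> 2 powr (2 * \<kappa> * real j) * (1 / 2 ^ CARD('d)) ^ j"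
          by (intro mult_right_mono) auto
        then show "(1 / 2 ^ CARD('d)) ^ j \<le> 2 powr (2 * \<kappa> * real j) * (1 / 2 ^ CARD('d)) ^ j" by simp
      qed
      finally show ?thesis using Jj by (simp add: E_def K_def algebra_simps)
    qed
  next
    fix J' :: nat
    have split: "2 powr (u * real j) * E j = (if j < J then 2 powr (u * real j) * \<tau>\<^sup>2 else K * x ^ j)
        + V * k ^ m * (2 powr (u * real j) * (\<gamma> j / k ^ (m + n)))" for j
    proof -
      have "2 powr (u * real j) * (K * (2 powr (2 * \<kappa> * real j) * (1 / 2 ^ CARD('d)) ^ j))
          = K * (2 powr ((u + 2 * \<kappa>) * real j) * (1 / 2 ^ CARD('d)) ^ j)"
        by (simp add: distrib_right powr_add)
      also have "\<dots> = K * x ^ j" unfolding powr_mult_power_dim x_def ..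
      finally show ?thesis by (simp add: E_def distrib_left mult_ac)
    qed
    have "(\<Sum>j<J'. if j < J then 2 powr (u * real j) * \<tau>\<^sup>2 else K * x ^ j) \<le> (\<Sum>j<J. 2 powr (u * real j) * \<tau>\<^sup>2) + e3"
    proof (rule sum_if_split_le)
      fix N'
      have "(\<Sum>j<N'. K * x ^ (J + j)) = K * (x ^ J * (\<Sum>j<N'. x ^ j))"
        by (simp add: power_add sum_distrib_left mult_ac)
      also have "\<dots> \<le> K * (x ^ J * (1 / (1 - x)))"
        using K x by (intro mult_left_mono geometric_partial_sum_le) auto
      finally show "(\<Sum>j<N'. K * x ^ (J + j)) \<le> e3" using J by (simp add: mult_ac)
    qed (use K x in auto)
    also have "(\<Sum>j<J. 2 powr (u * real j) * \<tau>\<^sup>2) = \<tau>\<^sup>2 * H" by (simp add: H_def sum_distrib_left mult.commute)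
    also note \<tau>(2)
    finally have 1: "(\<Sum>j<J'. if j < J then 2 powr (u * real j) * \<tau>\<^sup>2 else K * x ^ j) \<le> e3 + e3" by simp
    have "V * k ^ m * (\<Sum>j<J'. 2 powr (u * real j) * (\<gamma> j / k ^ (m + n))) \<le> V * k ^ m * (e3 / (V * k ^ m + 1))"
      unfolding \<gamma>_def C_def using V k n by (intro mult_left_mono N) auto
    also have "\<dots> \<le> e3"
    proof -
      have "0 \<le> V * k ^ m" using V k by simp
      then show ?thesis using e3 by (simp add: divide_le_eq)
    qed
    finally have 2: "V * k ^ m * (\<Sum>j<J'. 2 powr (u * real j) * (\<gamma> j / k ^ (m + n))) \<le> e3" .
    have "(\<Sum>j<J'. 2 powr (u * real j) * E j) \<le> e3 + e3 + e3"
      unfolding split sum.distrib sum_distrib_left[symmetric] using 1 2 by linarith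
    then show "(\<Sum>j<J'. 2 powr (u * real j) * E j) \<le> \<epsilon>\<^sup>2" by (simp add: e3_def)
  qed (use \<epsilon> in simp)
  then show ?thesis using S(1) supp unfolding B_def by blast
qed

end

section \<open>The exponent\<close>

text \<open>The convex piecewise linear function of \<open>q\<close> on the right has its minimum at a breakpoint \<open>p = b i\<close>,
  namely where its slope, which is \<open>-u\<close> plus the number of breakpoints passed, changes sign.\<close>

lemma convex_exponent_gap:
  fixes b :: "'d::finite \<Rightarrow> real"
  assumes u: "0 \<le> u" "u < real CARD('d)"
    and at_breaks: "\<And>i. u * b i < \<sigma> + (\<Sum>k\<in>UNIV. max 0 (b i - b k))"
  shows "\<exists>\<eta>>0. \<forall>q. \<eta> \<le> \<sigma> - u * q + (\<Sum>k\<in>UNIV. max 0 (q - b k))"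
proof -
  define I where "I = {i. u < real (card {k. b k \<le> b i})}"
  have ne: "I \<noteq> {}"
  proof -
    have "Max (range b) \<in> range b" by (rule Max_in) auto
    then obtain i where i: "Max (range b) = b i" by (rule rangeE)
    have "b k \<le> b i" for k unfolding i[symmetric] by (rule Max_ge) auto
    then have "{k. b k \<le> b i} = UNIV" by auto
    then have "i \<in> I" using u by (simp add: I_def)
    then show ?thesis by auto
  qed
  define p where "p = Min (b ` I)"
  have "p \<in> b ` I" unfolding p_def using ne by (intro Min_in) auto
  then obtain i0 where i0: "i0 \<in> I" "p = b i0" by auto
  have up: "u < real (card {k. b k \<le> p})" using i0 by (simp add: I_def)
  have low: "real (card {k. b k < p}) \<le> u"
  proof (rule ccontr)
    assume "\<not> ?thesis"
    then have big: "u < real (card {k. b k < p})" by simp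
    then have "{k. b k < p} \<noteq> {}" using u(1) by (metis card.empty of_nat_0 not_less)
    then have "Max (b ` {k. b k < p}) \<in> b ` {k. b k < p}" by (intro Max_in) auto
    then obtain i1 where i1: "b i1 < p" "b i1 = Max (b ` {k. b k < p})" by auto
    have "{k. b k < p} \<subseteq> {k. b k \<le> b i1}" unfolding i1(2) by auto
    then have "card {k. b k < p} \<le> card {k. b k \<le> b i1}" by (intro card_mono) auto
    then have "i1 \<in> I" using big by (simp add: I_def)
    then have "p \<le> b i1" unfolding p_def by (intro Min_le) auto
    then show False using i1(1) by simp
  qed
  define \<eta> where "\<eta> = \<sigma> - u * p + (\<Sum>k\<in>UNIV. max 0 (p - b k))"
  have "0 < \<eta>" using at_breaks[of i0] i0(2) by (simp add: \<eta>_def)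
  moreover have "\<eta> \<le> \<sigma> - u * q + (\<Sum>k\<in>UNIV. max 0 (q - b k))" for q
  proof (cases "p \<le> q")
    case True
    have "(\<Sum>k\<in>UNIV. max 0 (p - b k) + (if b k \<le> p then q - p else 0)) \<le> (\<Sum>k\<in>UNIV. max 0 (q - b k))"
      using True by (intro sum_mono) auto
    then have "(\<Sum>k\<in>UNIV. max 0 (p - b k)) + real (card {k. b k \<le> p}) * (q - p) \<le> (\<Sum>k\<in>UNIV. max 0 (q - b k))"
      by (simp add: sum.distrib flip: sum.inter_filter)
    moreover have "u * (q - p) \<le> real (card {k. b k \<le> p}) * (q - p)" using up True by (intro mult_right_mono) auto
    ultimately show ?thesis by (simp add: \<eta>_def algebra_simps)
  next
    case False
    have "(\<Sum>k\<in>UNIV. max 0 (p - b k) - (if b k < p then p - q else 0)) \<le> (\<Sum>k\<in>UNIV. max 0 (q - b k))"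
      using False by (intro sum_mono) auto
    then have "(\<Sum>k\<in>UNIV. max 0 (p - b k)) - real (card {k. b k < p}) * (p - q) \<le> (\<Sum>k\<in>UNIV. max 0 (q - b k))"
      by (simp add: sum_subtractf flip: sum.inter_filter)
    moreover have "real (card {k. b k < p}) * (p - q) \<le> u * (p - q)" using low False by (intro mult_right_mono) auto
    ultimately show ?thesis by (simp add: \<eta>_def algebra_simps)
  qed
  ultimately show ?thesis by blast
qed

text \<open>The term of \<^const>\<open>dim_bound\<close> at \<open>p\<close>.\<close>

definition dim_value :: "real \<Rightarrow> real \<Rightarrow> ('d::finite \<Rightarrow> real) \<Rightarrow> real \<Rightarrow> real" where
  "dim_value s L l p =
     real (card (K1 (a_coeff L l) p))
     + real (card (K2 s (a_coeff L l) p)) * (1 - (s - 1) / (real CARD('d) * p))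
     + real (card (K3 s (a_coeff L l) p)) / (real CARD('d) * p)
     + (\<Sum>i\<in>K3 s (a_coeff L l) p. ln (l i) / (p * ln (inverse L)))"

lemma dim_bound_le_value:
  assumes "p \<in> P_set s (a_coeff L l)"
  shows "dim_bound s L l \<le> dim_value s L l p"
  unfolding dim_bound_def dim_value_def Let_def
  by (rule Min_le) (use assms in \<open>auto simp: P_set_def\<close>)

lemma a_coeff_pos:
  fixes l :: "'d::finite \<Rightarrow> real"
  assumes "1 < L" "0 < l i" "l i < 1"
  shows "0 < a_coeff L l i"
proof -
  have "0 \<le> ln (l i) / ln (inverse L)"
    using assms by (intro divide_nonpos_nonpos) (auto simp: ln_inverse)
  then show ?thesis unfolding a_coeff_def by (intro add_nonneg_pos) auto
qed

text \<open>Multiplied by \<open>p\<close>, an index contributes \<open>p \<le> a i\<close>, or \<open>p - (s - 1) / d = a i + (p - b i)\<close>, or \<open>a i\<close>, according as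
  it lies in \<^const>\<open>K1\<close>, \<^const>\<open>K2\<close> or \<^const>\<open>K3\<close>.\<close>

lemma dim_value_times:
  fixes l :: "'d::finite \<Rightarrow> real"
  assumes "1 < s" "0 < p"
  shows "p * dim_value s L l p \<le> (\<Sum>i\<in>UNIV. a_coeff L l i) + (\<Sum>i\<in>UNIV. max 0 (p - (a_coeff L l i + (s - 1) / real CARD('d))))"
proof -
  define a where "a = a_coeff L l"
  define \<tau> where "\<tau> = (s - 1) / real CARD('d)"
  have \<tau>: "0 < \<tau>" using assms by (simp add: \<tau>_def)
  have disj: "K1 a p \<inter> K2 s a p = {}" using \<tau> by (auto simp: K1_def K2_def \<tau>_def)
  have K3: "K3 s a p = UNIV - (K1 a p \<union> K2 s a p)" by (simp add: K3_def)
  have "p * (ln (l i) / (p * ln (inverse L))) = a i - 1 / real CARD('d)" for i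
    using assms(2) by (simp add: a_def a_coeff_def)
  then have "p * (\<Sum>i\<in>K3 s a p. ln (l i) / (p * ln (inverse L))) = (\<Sum>i\<in>K3 s a p. a i - 1 / real CARD('d))"
    by (simp add: sum_distrib_left)
  moreover have "p * (real (card (K3 s a p)) / (real CARD('d) * p)) = (\<Sum>i\<in>K3 s a p. 1 / real CARD('d))"
    using assms(2) by simp
  moreover have "p * (real (card (K2 s a p)) * (1 - (s - 1) / (real CARD('d) * p))) = (\<Sum>i\<in>K2 s a p. p - \<tau>)"
    using assms(2) by (simp add: \<tau>_def field_simps)
  moreover have "p * real (card (K1 a p)) = (\<Sum>i\<in>K1 a p. p)" by simp
  ultimately have "p * dim_value s L l p = (\<Sum>i\<in>K1 a p. p) + (\<Sum>i\<in>K2 s a p. p - \<tau>) + (\<Sum>i\<in>K3 s a p. a i)"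
    unfolding dim_value_def a_def[symmetric] by (simp only: distrib_left sum_subtractf)
  also have "\<dots> \<le> (\<Sum>i\<in>K1 a p. a i + max 0 (p - (a i + \<tau>))) + (\<Sum>i\<in>K2 s a p. a i + max 0 (p - (a i + \<tau>)))
      + (\<Sum>i\<in>K3 s a p. a i + max 0 (p - (a i + \<tau>)))"
    by (intro add_mono sum_mono) (auto simp: K1_def K2_def \<tau>_def)
  also have "\<dots> = (\<Sum>i\<in>K1 a p \<union> K2 s a p. a i + max 0 (p - (a i + \<tau>))) + (\<Sum>i\<in>K3 s a p. a i + max 0 (p - (a i + \<tau>)))"
    using disj by (simp add: sum.union_disjoint)
  also have "\<dots> = (\<Sum>i\<in>UNIV. a i + max 0 (p - (a i + \<tau>)))"
    unfolding K3 by (subst add.commute, rule sum.subset_diff[symmetric]) auto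
  finally show ?thesis by (simp add: a_def \<tau>_def sum.distrib)
qed

text \<open>At \<open>p = Min (range a)\<close> every index lies in \<^const>\<open>K1\<close>.\<close>

lemma dim_bound_le_card:
  fixes l :: "'d::finite \<Rightarrow> real"
  assumes "1 < s"
  shows "dim_bound s L l \<le> real CARD('d)"
proof -
  define a where "a = a_coeff L l"
  define p where "p = Min (range a)"
  have "p \<in> range a" unfolding p_def by (rule Min_in) auto
  then have "p \<in> P_set s a" by (auto simp: P_set_def)
  then have "dim_bound s L l \<le> dim_value s L l p" unfolding a_def by (rule dim_bound_le_value)
  also have "dim_value s L l p = real CARD('d)"
  proof -
    have "p \<le> a i" for i unfolding p_def by (rule Min_le) auto
    then have "K1 a p = UNIV" by (auto simp: K1_def)
    moreover have "K2 s a p = {}"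
    proof -
      have "0 < (s - 1) / real CARD('d)" using assms by simp
      then have "p < a i + (s - 1) / real CARD('d)" for i
        using \<open>p \<le> a i\<close> by linarith
      then show ?thesis by (auto simp: K2_def not_le)
    qed
    ultimately show ?thesis unfolding dim_value_def a_def[symmetric] by (simp add: K3_def)
  qed
  finally show ?thesis .
qed

lemma exponent_gap_below_dim_bound:
  fixes l :: "'d::finite \<Rightarrow> real"
  assumes "1 < L" "1 < s" "\<And>i. 0 < l i" "\<And>i. l i < 1" "0 \<le> u" "u < dim_bound s L l"
  defines "a \<equiv> a_coeff L l"
  shows "\<exists>\<eta>>0. \<forall>q. \<eta> \<le> (\<Sum>i\<in>UNIV. a i) - u * q + (\<Sum>i\<in>UNIV. max 0 (q - (a i + (s - 1) / real CARD('d))))"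
proof (rule convex_exponent_gap)
  show "u < real CARD('d)" using assms(6) dim_bound_le_card[OF assms(2), of L l] by linarith
  fix i
  define b where "b k = a k + (s - 1) / real CARD('d)" for k
  have b: "0 < b i" unfolding b_def a_def using assms a_coeff_pos[OF assms(1,3,4)] by (intro add_pos_pos) auto
  have "b i \<in> P_set s (a_coeff L l)" by (auto simp: P_set_def b_def a_def)
  then have "u < dim_value s L l (b i)" using dim_bound_le_value[of "b i" s L l] assms(6) by linarith
  then have "b i * u < b i * dim_value s L l (b i)" using b by simp
  also have "\<dots> \<le> (\<Sum>i\<in>UNIV. a i) + (\<Sum>k\<in>UNIV. max 0 (b i - b k))"
    unfolding a_def b_def using dim_value_times[OF assms(2) b, of L l] by (simp add: a_def b_def)
  finally show "u * (a i + (s - 1) / real CARD('d)) < (\<Sum>i\<in>UNIV. a i) + (\<Sum>k\<in>UNIV. max 0 (a i + (s - 1) / real CARD('d) - (a k + (s - 1) / real CARD('d))))"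
    by (simp add: b_def mult.commute)
qed (rule assms(5))

text \<open>In powers of \<open>L\<close> the diagonal term at the scale \<open>2 ^ j = L powr (n * q)\<close> is at most a constant times \<open>L\<close> to the
  power \<open>- n\<close> times the function of the preceding lemma.\<close>

lemma diagonal_energy_small:
  fixes l :: "'d::finite \<Rightarrow> real" and k :: real
  assumes L: "1 < L" "L = k * (\<Prod>i\<in>UNIV. l i)" and s: "1 < s" and l: "\<And>i. 0 < l i" "\<And>i. l i < 1"
    and u: "0 \<le> u" "u < dim_bound s L l" and "0 < \<epsilon>"
  defines "\<rho> \<equiv> \<lambda>n. L powr (- (s / real CARD('d)) * real n) / real CARD('d)"
  shows "\<exists>N. \<forall>n\<ge>N. \<forall>J. (\<Sum>j<J. 2 powr (u * real j) *
      ((\<Prod>i\<in>UNIV. min 1 (1 / 2 ^ j / (2 * (l i ^ n * \<rho> n)))) / k ^ n)) \<le> \<epsilon>"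
proof -
  let ?\<Gamma> = "\<lambda>n j. (\<Prod>i\<in>UNIV. min 1 (1 / 2 ^ j / (2 * (l i ^ n * \<rho> n))))"
  define d where "d = real CARD('d)"
  have d: "1 \<le> d" unfolding d_def by (simp add: Suc_leI)
  define a where "a = a_coeff L l"
  define b where "b i = a i + (s - 1) / d" for i
  let ?m = "\<lambda>q. (\<Sum>i\<in>UNIV. max 0 (q - b i))"
  define \<sigma> where "\<sigma> = (\<Sum>i\<in>UNIV. a i)"
  define u' where "u' = (u + dim_bound s L l) / 2"
  have u': "u < u'" "u' < dim_bound s L l" using u by (auto simp: u'_def)
  obtain \<eta> where \<eta>: "0 < \<eta>" "\<And>q. \<eta> \<le> \<sigma> - u' * q + (?m q)"
  proof -
    have "0 \<le> u'" using u u' by linarith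
    from exponent_gap_below_dim_bound[OF L(1) s l this u'(2)] that show ?thesis
      unfolding a_def b_def \<sigma>_def d_def by blast
  qed
  have lnL: "0 < ln L" using L(1) by simp
  define \<alpha> where "\<alpha> i = ln (l i) / ln (inverse L)" for i
  have l_powr: "l i = L powr (- \<alpha> i)" for i
    using l(1)[of i] L(1) lnL by (simp add: \<alpha>_def powr_def ln_inverse)
  have a_eq: "a i = \<alpha> i + 1 / d" for i by (simp add: a_def a_coeff_def \<alpha>_def d_def)
  have k_powr: "k = L powr \<sigma>"
  proof -
    have "(\<Prod>i\<in>UNIV. l i) = L powr (- (\<Sum>i\<in>UNIV. \<alpha> i))"
      using L(1) by (subst l_powr) (simp add: powr_sum[symmetric] sum_negf)
    moreover have "\<sigma> = (\<Sum>i\<in>UNIV. \<alpha> i) + 1"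
      by (simp add: \<sigma>_def a_eq sum.distrib d_def)
    ultimately have "L powr \<sigma> * (\<Prod>i\<in>UNIV. l i) = L" using L(1) by (simp flip: powr_add)
    moreover have "0 < (\<Prod>i\<in>UNIV. l i)" using l(1) by (intro prod_pos) auto
    ultimately show ?thesis using L(2) by (metis less_irrefl mult_right_cancel)
  qed
  have c_powr: "l i ^ n * \<rho> n = L powr (- (real n * b i)) / d" for i n
  proof -
    have "l i ^ n = L powr (- \<alpha> i * real n)"
      using L(1) by (subst l_powr) (simp add: powr_powr flip: powr_realpow)
    then have "l i ^ n * \<rho> n = L powr (- \<alpha> i * real n + - (s / d) * real n) / d"
      by (simp only: \<rho>_def d_def powr_add times_divide_eq_right)
    also have "- \<alpha> i * real n + - (s / d) * real n = - (real n * b i)"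
      using d by (simp add: b_def a_eq field_simps)
    finally show ?thesis .
  qed
  define x where "x = 2 powr (u - u')"
  have x: "0 < x" "x < 1" using u' by (auto simp: x_def powr_less_one)
  have level_le: "2 powr (u * real j) * (?\<Gamma> n j / k ^ n)
      \<le> d ^ CARD('d) * L powr (- \<eta> * real n) * x ^ j" if n: "0 < n" for n j
  proof -
    define q where "q = real j * ln 2 / (real n * ln L)"
    have pow2: "2 powr (v * real j) = L powr (real n * (v * q))" for v
      using n lnL L(1) by (simp add: q_def powr_def)
    have inv2: "1 / 2 ^ j = L powr (- (real n * q))"
      using pow2[of "-1"] by (simp add: powr_minus_divide powr_realpow)
    have min_le: "min 1 (1 / 2 ^ j / (2 * (l i ^ n * \<rho> n))) \<le> d * L powr (- (real n * max 0 (q - b i)))" for i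
    proof -
      have "1 / 2 ^ j / (2 * (l i ^ n * \<rho> n)) = d / 2 * L powr (- (real n * (q - b i)))"
        unfolding inv2 c_powr using d L(1) by (simp add: powr_diff[symmetric] divide_powr_uminus algebra_simps flip: powr_add)
      also have "\<dots> \<le> d * L powr (- (real n * (q - b i)))" using d by (intro mult_right_mono) auto
      finally have "min 1 (1 / 2 ^ j / (2 * (l i ^ n * \<rho> n))) \<le> min (d * 1) (d * L powr (- (real n * (q - b i))))"
        using d by (auto simp: min_def)
      then show ?thesis using d L(1) by (cases "q \<le> b i") (simp_all add: max_def)
    qed
    have "?\<Gamma> n j \<le> (\<Prod>i\<in>UNIV. d * L powr (- (real n * max 0 (q - b i))))"
      using min_le L(1) d by (intro prod_mono conjI) (auto simp: c_powr)
    also have "\<dots> = d ^ CARD('d) * L powr (- (real n * (?m q)))"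
      using L(1) by (simp add: prod.distrib powr_sum[symmetric] sum_negf sum_distrib_left)
    finally have pr: "?\<Gamma> n j
        \<le> d ^ CARD('d) * L powr (- (real n * (?m q)))" .
    have "2 powr (u * real j) * (?\<Gamma> n j / k ^ n)
        = x ^ j * (L powr (real n * (u' * q)) * ?\<Gamma> n j * L powr (- (real n * \<sigma>)))"
    proof -
      have xj: "x ^ j = 2 powr ((u - u') * real j)"
        by (simp add: x_def powr_realpow[symmetric] powr_powr)
      have 1: "2 powr (u * real j) = x ^ j * 2 powr (u' * real j)"
        unfolding xj powr_add[symmetric] by (simp add: left_diff_distrib)
      have "k ^ n = L powr (real n * \<sigma>)"
        using L(1) by (simp add: k_powr powr_realpow[symmetric] powr_powr mult.commute)
      then have 2: "Y / k ^ n = Y * L powr (- (real n * \<sigma>))" for Y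
        by (simp add: powr_minus_divide)
      show ?thesis unfolding 1 2 pow2[of u'] by (simp only: mult.assoc)
    qed
    also have "\<dots> \<le> x ^ j * (L powr (real n * (u' * q)) * (d ^ CARD('d) * L powr (- (real n * (?m q)))) * L powr (- (real n * \<sigma>)))"
      by (intro mult_left_mono mult_right_mono pr) (use x in simp_all)
    also have "\<dots> = x ^ j * (d ^ CARD('d) * L powr (- (real n * (\<sigma> - u' * q + (?m q)))))"
    proof -
      have "- (real n * (\<sigma> - u' * q + (?m q)))
          = real n * (u' * q) + - (real n * (?m q)) + - (real n * \<sigma>)"
        by (simp add: algebra_simps)
      then show ?thesis by (simp only: powr_add) (simp only: mult_ac)
    qed
    also have "\<dots> \<le> x ^ j * (d ^ CARD('d) * L powr (- (real n * \<eta>)))"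
    proof -
      have "real n * \<eta> \<le> real n * (\<sigma> - u' * q + (?m q))"
        by (intro mult_left_mono \<eta>(2)) simp
      then show ?thesis using x d L(1) by (intro mult_left_mono powr_mono) auto
    qed
    finally show ?thesis by (simp add: mult_ac)
  qed
  obtain N where N: "\<And>n. N \<le> n \<Longrightarrow> (L powr (- \<eta>)) ^ n * (d ^ CARD('d) * (1 / (1 - x))) < \<epsilon>"
    using power_times_eventually_small[of "L powr (- \<eta>)" \<epsilon> "d ^ CARD('d) * (1 / (1 - x))"] L(1) \<eta>(1) \<open>0 < \<epsilon>\<close>
    by (auto simp: powr_less_one)
  show ?thesis
  proof (intro exI[of _ "Suc N"] allI impI)
    fix n J assume n: "Suc N \<le> n"
    have "(\<Sum>j<J. 2 powr (u * real j) * (?\<Gamma> n j / k ^ n))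
        \<le> (\<Sum>j<J. d ^ CARD('d) * L powr (- \<eta> * real n) * x ^ j)"
      using n by (intro sum_mono level_le) simp
    also have "\<dots> = d ^ CARD('d) * L powr (- \<eta> * real n) * (\<Sum>j<J. x ^ j)" by (simp add: sum_distrib_left)
    also have "\<dots> \<le> d ^ CARD('d) * L powr (- \<eta> * real n) * (1 / (1 - x))"
      using x d by (intro mult_left_mono geometric_partial_sum_le) auto
    also have "L powr (- \<eta> * real n) = (L powr (- \<eta>)) ^ n"
      using L(1) by (simp add: powr_powr flip: powr_realpow)
    also have "d ^ CARD('d) * (L powr (- \<eta>)) ^ n * (1 / (1 - x)) \<le> \<epsilon>" using N[of n] n by (simp add: mult_ac)
    finally show "(\<Sum>j<J. 2 powr (u * real j) * (?\<Gamma> n j / k ^ n)) \<le> \<epsilon>" .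
  qed
qed

section \<open>The shrinking target set\<close>

lemma hausdorff_measure_mono:
  assumes "E \<subseteq> F"
  shows "hausdorff_measure s E \<le> hausdorff_measure s F"
proof -
  have "hausdorff_premeasure s \<delta> E \<le> hausdorff_premeasure s \<delta> F" for \<delta>
    unfolding hausdorff_premeasure_def using assms by (intro INF_superset_mono) auto
  then show ?thesis unfolding hausdorff_measure_def by (intro SUP_mono) auto
qed

lemma hausdorff_dim_geI:
  assumes "\<And>u \<sigma>. u \<in> \<rat> \<Longrightarrow> 0 < u \<Longrightarrow> u < D \<Longrightarrow> 0 \<le> \<sigma> \<Longrightarrow> \<sigma> \<le> u \<Longrightarrow> hausdorff_measure \<sigma> E \<noteq> 0"
  shows "ereal D \<le> hausdorff_dim E"
  unfolding hausdorff_dim_def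
proof (rule Inf_greatest)
  fix y assume "y \<in> ereal ` {\<sigma>. 0 \<le> \<sigma> \<and> hausdorff_measure \<sigma> E = 0}"
  then obtain \<sigma> where \<sigma>: "y = ereal \<sigma>" "0 \<le> \<sigma>" "hausdorff_measure \<sigma> E = 0" by auto
  have "D \<le> \<sigma>"
  proof (rule ccontr)
    assume "\<not> D \<le> \<sigma>"
    then obtain u where "u \<in> \<rat>" "\<sigma> < u" "u < D" using Rats_dense_in_real[of \<sigma> D] by auto
    then show False using assms[of u \<sigma>] \<sigma> by auto
  qed
  then show "ereal D \<le> y" using \<sigma>(1) by simp
qed

context diagonal_contraction
begin

text \<open>A piece of the attractor near \<open>z\<close> is an affine copy of the whole, which contains a box.\<close>

lemma attractor_contains_small_box:
  assumes "interior (attractor t) \<noteq> {}" "z \<in> attractor t" "0 < r"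
  shows "\<exists>lo hi. (\<forall>i. lo $ i < hi $ i) \<and> cbox lo hi \<subseteq> attractor t \<inter> cball z r"
proof -
  have R: "\<bar>t $ c $ i\<bar> \<le> norm t" for c i by (rule parameter_component_le)
  obtain p where "p \<in> interior (attractor t)" using assms(1) by auto
  then obtain \<epsilon> where \<epsilon>: "0 < \<epsilon>" "ball p \<epsilon> \<subseteq> attractor t" by (auto simp: mem_interior)
  define h where "h = \<epsilon> / (2 * real CARD('d))"
  have h: "0 < h" using \<epsilon>(1) by (simp add: h_def)
  define a b where "a = (\<chi> i. p $ i - h)" and "b = (\<chi> i. p $ i + h)"
  have ab: "cbox a b \<subseteq> attractor t"
  proof
    fix x assume x: "x \<in> cbox a b"
    have "norm (x - p) \<le> (\<Sum>i\<in>UNIV. \<bar>(x - p) $ i\<bar>)" by (rule norm_le_l1_cart)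
    also have "\<dots> \<le> (\<Sum>i\<in>(UNIV::'d set). h)"
    proof (rule sum_mono)
      fix i
      have "p $ i - h \<le> x $ i" "x $ i \<le> p $ i + h" using x by (auto simp: mem_box_cart a_def b_def)
      then show "\<bar>(x - p) $ i\<bar> \<le> h" by (simp add: abs_le_iff)
    qed
    also have "\<dots> < \<epsilon>" using \<epsilon>(1) by (simp add: h_def)
    finally show "x \<in> attractor t" using \<epsilon>(2) by (auto simp: dist_norm norm_minus_commute)
  qed
  obtain m where m: "(1 / 2) ^ m * (\<Sum>i\<in>(UNIV::'d set). 4 * norm t) < r"
    using power_times_eventually_small[of "1 / 2" r "\<Sum>i\<in>(UNIV::'d set). 4 * norm t"] assms(3) by auto
  obtain v y where vy: "length v = m" "y \<in> attractor t" "z = word_map l t v y"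
    using invariant_decompose[OF attractor_invariant assms(2)] by blast
  define lo hi where "lo = word_map l t v a" and "hi = word_map l t v b"
  have "lo $ i < hi $ i" for i
  proof -
    have "hi $ i - lo $ i = l i ^ m * (b $ i - a $ i)" unfolding lo_def hi_def word_map_diff_nth vy(1) ..
    also have "0 < \<dots>" using l_pos[of i] h by (simp add: a_def b_def)
    finally show ?thesis by simp
  qed
  moreover have "cbox lo hi \<subseteq> attractor t \<inter> cball z r"
  proof
    fix x assume x: "x \<in> cbox lo hi"
    define x' where "x' = (\<chi> i. a $ i + (x $ i - lo $ i) / l i ^ m)"
    have lm: "0 < l i ^ m" for i using l_pos[of i] by simp
    have x_eq: "x = word_map l t v x'" unfolding x'_def lo_def vy(1)[symmetric] word_map_preimage ..
    have "x' \<in> cbox a b"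
    proof -
      have "a $ i \<le> x' $ i \<and> x' $ i \<le> b $ i" for i
      proof -
        have "lo $ i \<le> x $ i" "x $ i \<le> hi $ i" using x by (auto simp: mem_box_cart)
        moreover have "hi $ i - lo $ i = l i ^ m * (b $ i - a $ i)" unfolding lo_def hi_def word_map_diff_nth vy(1) ..
        ultimately have "0 \<le> (x $ i - lo $ i) / l i ^ m" "(x $ i - lo $ i) / l i ^ m \<le> b $ i - a $ i"
          using lm[of i] by (auto simp: pos_divide_le_eq mult.commute)
        then show ?thesis by (simp add: x'_def)
      qed
      then show ?thesis by (simp add: mem_box_cart)
    qed
    then have x': "x' \<in> attractor t" using ab by blast
    have "dist z x \<le> (1 / 2) ^ m * (\<Sum>i\<in>UNIV. \<bar>y $ i - x' $ i\<bar>)"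
      using norm_word_map_diff_le[of t v y x'] by (simp add: dist_norm x_eq vy)
    also have "\<dots> \<le> (1 / 2) ^ m * (\<Sum>i\<in>(UNIV::'d set). 4 * norm t)"
    proof (intro mult_left_mono sum_mono)
      show "\<bar>y $ i - x' $ i\<bar> \<le> 4 * norm t" for i
        using attractor_bound[OF R vy(2), of i] attractor_bound[OF R x', of i] by linarith
    qed simp
    finally have "dist z x \<le> r" using m by linarith
    moreover have "x \<in> attractor t" unfolding x_eq by (rule invariant_word_map[OF attractor_invariant x'])
    ultimately show "x \<in> attractor t \<inter> cball z r" by simp
  qed
  ultimately show ?thesis by blast
qed

text \<open>A word box of half-widths \<open>l i ^ n * \<rho>\<close> lies in the image under the word of the Euclidean ball with radius
  \<open>CARD('d) * \<rho>\<close>, since the Euclidean norm is at most the sum of the coordinates.\<close>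

lemma word_box_pulled_back:
  fixes A :: "'i::finite \<Rightarrow> real ^ 'd ^ 'd"
  assumes A: "\<And>c. A c = diag_matrix l" and x: "x \<in> word_box t a (\<lambda>i. l i ^ length w * \<rho>) w"
  shows "fold (T_map A t) w x \<in> cball (code_point l t a) (real CARD('d) * \<rho>)"
proof -
  define y where "y = code_point l t a"
  define p where "p = word_map l t w y"
  define x' where "x' = (\<chi> i. y $ i + (x $ i - p $ i) / l i ^ length w)"
  have ln: "0 < l i ^ length w" for i using l_pos[of i] by simp
  have "x = word_map l t w x'" unfolding x'_def p_def word_map_preimage ..
  then have "fold (T_map A t) w x = x'" using fold_T_map[OF A] by simp
  moreover have "norm (y - x') \<le> real CARD('d) * \<rho>"
  proof -
    have "norm (y - x') \<le> (\<Sum>i\<in>UNIV. \<bar>(y - x') $ i\<bar>)" by (rule norm_le_l1_cart)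
    also have "\<dots> \<le> (\<Sum>i\<in>(UNIV::'d set). \<rho>)"
    proof (rule sum_mono)
      fix i
      have "\<bar>x $ i - p $ i\<bar> \<le> l i ^ length w * \<rho>" using x by (simp add: mem_word_box code_point_prepend p_def y_def)
      then show "\<bar>(y - x') $ i\<bar> \<le> \<rho>" using ln[of i] by (simp add: x'_def abs_divide pos_divide_le_eq mult.commute)
    qed
    finally show ?thesis by simp
  qed
  ultimately show ?thesis by (simp add: y_def dist_norm)
qed

text \<open>The constant in the almost sure count of close pairs depends on the parameter ball, and so do the separations
  \<open>\<delta>\<close>; the count is therefore used on the balls of all integer radii at once.\<close>

lemma ae_hausdorff_measure_nonzero:
  fixes A :: "'i::finite \<Rightarrow> real ^ 'd ^ 'd" and a :: "nat \<Rightarrow> 'i"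
  assumes A: "\<And>c. A c = diag_matrix l" and L: "1 < lambda_sum A" and s: "1 < s"
    and u: "0 < u" "u < dim_bound s (lambda_sum A) l"
  shows "AE t in lborel. interior (attractor t) \<noteq> {} \<longrightarrow> (\<forall>z\<in>attractor t. \<forall>r>0. \<forall>\<sigma>. 0 \<le> \<sigma> \<longrightarrow> \<sigma> \<le> u \<longrightarrow>
    hausdorff_measure \<sigma> (W_set s A t (code_point l t a) \<inter> cball z r) \<noteq> 0)"
proof -
  define \<Lambda> where "\<Lambda> = lambda_sum A"
  have \<Lambda>: "1 < \<Lambda>" "\<Lambda> = real CARD('i) * (\<Prod>i\<in>UNIV. l i)"
  proof -
    show "1 < \<Lambda>" using L by (simp add: \<Lambda>_def)
    have "0 \<le> (\<Prod>i\<in>UNIV. l i)" using l_pos by (intro prod_nonneg) (auto intro: less_imp_le)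
    then show "\<Lambda> = real CARD('i) * (\<Prod>i\<in>UNIV. l i)"
      by (simp add: \<Lambda>_def lambda_sum_def A det_diag_matrix)
  qed
  have l1: "l i < 1" for i using l_half[of i] by simp
  have ud: "u < real CARD('d)" using u(2) dim_bound_le_card[OF s, of "lambda_sum A" l] by linarith
  define \<kappa> where "\<kappa> = (real CARD('d) - u) / 4"
  have \<kappa>: "0 < \<kappa>" "u + 2 * \<kappa> < real CARD('d)" using ud by (auto simp: \<kappa>_def field_simps)
  \<comment> \<open>The target radius, divided by the dimension so that a cube of this half-width fits into the ball.\<close>
  define \<rho> where "\<rho> n = \<Lambda> powr (- (s / real CARD('d)) * real n) / real CARD('d)" for n
  have \<rho>: "0 < \<rho> n" "\<rho> n \<le> 1" for n
  proof -
    show "0 < \<rho> n" using \<Lambda>(1) by (simp add: \<rho>_def)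
    have "\<Lambda> powr (- (s / real CARD('d)) * real n) \<le> \<Lambda> powr 0"
      using \<Lambda>(1) s by (intro powr_mono) auto
    then show "\<rho> n \<le> 1" using \<Lambda>(1) by (simp add: \<rho>_def divide_le_eq order_trans[of _ 1] Suc_leI)
  qed
  define c where "c n i = l i ^ n * \<rho> n" for n i
  define \<delta> where "\<delta> R n m j i = min (4 * real (Suc R)) ((1 / 2 ^ j + 2 * c (m + n) i) / l i ^ m)" for R n m j i
  have \<delta>: "0 < \<delta> R n m j i" for R n m j i
    using l_pos[of i] \<rho>(1)[of "m + n"] by (auto simp: \<delta>_def c_def intro!: divide_pos_pos add_pos_pos)
  define few where "few R t \<longleftrightarrow> (\<exists>C\<ge>0. \<forall>N. \<exists>n\<ge>N. \<forall>m j. real (card (close_pairs n (\<delta> R n m j) a t))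
      \<le> C * 2 powr (\<kappa> * real (m + j)) * (\<Prod>i\<in>UNIV. \<delta> R n m j i) * real CARD('i) ^ (2 * n))" for R t
  have "AE t in lborel. t \<in> ball 0 (real (Suc R)) \<longrightarrow> few R t" for R
    unfolding few_def by (rule ae_few_close_pairs[OF _ \<kappa>(1) \<delta>]) (use \<Lambda> in simp)
  then have "AE t in lborel. \<forall>R. t \<in> ball 0 (real (Suc R)) \<longrightarrow> few R t"
    by (subst AE_all_countable) blast
  then show ?thesis
  proof eventually_elim
    case (elim t)
    show ?case
    proof (intro impI ballI allI)
      fix z r \<sigma>
      assume int: "interior (attractor t) \<noteq> {}" and z: "z \<in> attractor t" and r: "(0::real) < r" and \<sigma>: "0 \<le> \<sigma>" "\<sigma> \<le> u"
      define R where "R = nat \<lceil>norm t\<rceil>"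
      have Rt: "norm t < real (Suc R)" unfolding R_def by linarith
      then have "few R t" using elim by simp
      then obtain C where C: "0 \<le> C" and pairs: "\<And>N. \<exists>n\<ge>N. \<forall>m j. real (card (close_pairs n (\<delta> R n m j) a t))
          \<le> C * 2 powr (\<kappa> * real (m + j)) * (\<Prod>i\<in>UNIV. \<delta> R n m j i) * real CARD('i) ^ (2 * n)"
        unfolding few_def by blast
      have tR: "\<bar>t $ b $ i\<bar> \<le> real (Suc R)" for b i
        using parameter_component_le[of t b i] Rt by linarith
      obtain lo hi where box: "\<And>i. lo $ i < hi $ i" "cbox lo hi \<subseteq> attractor t" "cbox lo hi \<subseteq> cball z r"
        using attractor_contains_small_box[OF int z r] by blast
      define G where "G n = (\<Union>w\<in>{w. n \<le> length w}. word_box t a (c (length w)) w)" for n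
      have "hausdorff_measure \<sigma> (cbox lo hi \<inter> (\<Inter>n. G n)) \<noteq> 0"
      proof (rule hausdorff_measure_nonzero_of_refinement[OF _ box(2,1) u(1) ud \<sigma>])
        fix lo' hi' \<epsilon> n
        assume "cbox lo' hi' \<subseteq> attractor t" "\<And>i. lo' $ i < hi' $ i" "(0::real) < \<epsilon>"
        then show "\<exists>S. step_valid S \<and> step_support S \<subseteq> cbox lo' hi' \<inter> G n \<and>
            energy_close u (step_mass S) (\<lambda>Q. leb (cbox lo' hi' \<inter> Q)) \<epsilon>"
          unfolding G_def c_def
        proof (rule box_refinement[OF \<rho> _ tR _ _ C \<kappa>, rotated 3])
          show "1 \<le> real (Suc R)" by simp
          show "\<exists>n\<ge>N. \<forall>m j. real (card (close_pairs n (\<lambda>i. min (4 * real (Suc R)) ((1 / 2 ^ j + 2 * (l i ^ (m + n) * \<rho> (m + n))) / l i ^ m)) a t))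
            \<le> C * 2 powr (\<kappa> * real (m + j)) * (\<Prod>i\<in>UNIV. min (4 * real (Suc R)) ((1 / 2 ^ j + 2 * (l i ^ (m + n) * \<rho> (m + n))) / l i ^ m)) * real CARD('i) ^ (2 * n)" for N
            using pairs[of N] unfolding \<delta>_def c_def .
          show "\<exists>N. \<forall>n\<ge>N. \<forall>J. (\<Sum>j<J. 2 powr (u * real j) * ((\<Prod>i\<in>UNIV. min 1 (1 / 2 ^ j / (2 * (l i ^ n * \<rho> n)))) / real CARD('i) ^ n)) \<le> \<epsilon>'"
            if "0 < \<epsilon>'" for \<epsilon>'
            unfolding \<rho>_def
            by (rule diagonal_energy_small[OF \<Lambda> s l_pos l1 less_imp_le[OF u(1)] _ that]) (use u(2) in \<open>simp add: \<Lambda>_def\<close>)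
        qed
      qed
      moreover have "cbox lo hi \<inter> (\<Inter>n. G n) \<subseteq> W_set s A t (code_point l t a) \<inter> cball z r"
      proof
        fix x assume x: "x \<in> cbox lo hi \<inter> (\<Inter>n. G n)"
        define H where "H = {w. w \<noteq> [] \<and> fold (T_map A t) w x
            \<in> cball (code_point l t a) ((1 / lambda_sum A powr (s * real (length w))) powr (1 / real CARD('d)))}"
        have "\<exists>w\<in>H. n \<le> length w" for n
        proof -
          have "x \<in> G (Suc n)" using x by blast
          then obtain w where w: "Suc n \<le> length w" "x \<in> word_box t a (\<lambda>i. l i ^ length w * \<rho> (length w)) w"
            unfolding G_def c_def by auto
          have "real CARD('d) * \<rho> (length w) = (1 / lambda_sum A powr (s * real (length w))) powr (1 / real CARD('d))"
            using \<Lambda>(1) by (simp add: \<rho>_def \<Lambda>_def powr_powr flip: powr_minus_divide)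
          then have "w \<in> H" using word_box_pulled_back[OF A w(2)] w(1) by (auto simp: H_def)
          then show ?thesis using w(1) by (intro bexI[of _ w]) auto
        qed
        then have unbounded: "\<exists>w\<in>H. n \<le> length w" for n .
        have "infinite H"
        proof
          assume fin: "finite H"
          obtain w where w: "w \<in> H" "Suc (Max (length ` H)) \<le> length w" using unbounded by blast
          then have "length w \<le> Max (length ` H)" using fin by (intro Max_ge) auto
          then show False using w(2) by simp
        qed
        then show "x \<in> W_set s A t (code_point l t a) \<inter> cball z r"
          using x box unfolding W_set_def H_def self_affine_set_eq[OF A] by auto
      qed
      ultimately show "hausdorff_measure \<sigma> (W_set s A t (code_point l t a) \<inter> cball z r) \<noteq> 0"
        using hausdorff_measure_mono by (metis le_zero_eq)
    qed
  qed
qed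

end

theorem theorem2p4:
  fixes A :: "'i::finite \<Rightarrow> real ^ 'd ^ 'd"
    and D :: "real ^ 'd ^ 'd"
    and l :: "'d \<Rightarrow> real"
    and U :: "(real ^ 'd ^ 'i) set"
    and s :: real
    and j :: "nat \<Rightarrow> 'i"
  assumes "\<And>i. invertible (A i)"
    and "\<And>k. 0 < l k"
    and "D = diag_matrix l"
    and "\<And>i. A i = D"
    and "onorm ((*v) D) < 1 / 2"
    and "lambda_sum A > 1"
    and "open U"
    and "AE t in lebesgue. t \<in> U \<longrightarrow> interior (self_affine_set A t) \<noteq> {}"
    and "s > 1"
  shows "AE t in lebesgue. t \<in> U \<longrightarrow>
           (\<forall>z \<in> self_affine_set A t. \<forall>r > 0.
              hausdorff_dim (W_set s A t (proj A t j) \<inter> cball z r)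
                \<ge> ereal (dim_bound s (lambda_sum A) l))"
proof -
  have half: "l i < 1 / 2" for i
  proof -
    have "\<bar>D $ i $ i\<bar> \<le> onorm ((*v) D)" by (rule matrix_component_le_onorm)
    then show ?thesis using assms(2)[of i] assms(5) by (simp add: assms(3) diag_matrix_def)
  qed
  interpret diagonal_contraction l by unfold_locales (rule assms(2) half)+
  have A: "A c = diag_matrix l" for c using assms(3,4) by simp
  \<comment> \<open>The exceptional null set depends on the exponent \<open>u\<close>; rational exponents suffice to approach the bound.\<close>
  define bad where "bad u t \<longleftrightarrow> (\<exists>z\<in>attractor t. \<exists>r>0. \<exists>\<sigma>\<ge>0. \<sigma> \<le> u \<and>
      hausdorff_measure \<sigma> (W_set s A t (code_point l t j) \<inter> cball z r) = 0)" for u t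
  have "AE t in lborel. 0 < u \<longrightarrow> u < dim_bound s (lambda_sum A) l \<longrightarrow> interior (attractor t) \<noteq> {} \<longrightarrow> \<not> bad u t" for u
  proof (cases "0 < u \<and> u < dim_bound s (lambda_sum A) l")
    case True
    then have "0 < u" "u < dim_bound s (lambda_sum A) l" by auto
    from ae_hausdorff_measure_nonzero[OF A assms(6,9) this, of j] show ?thesis
      by eventually_elim (auto simp: bad_def)
  qed auto
  then have "AE t in lborel. \<forall>u\<in>\<rat>. 0 < u \<longrightarrow> u < dim_bound s (lambda_sum A) l \<longrightarrow> interior (attractor t) \<noteq> {} \<longrightarrow> \<not> bad u t"
    by (intro AE_ball_countable'[OF _ countable_rat])
  then have "AE t in lebesgue. \<forall>u\<in>\<rat>. 0 < u \<longrightarrow> u < dim_bound s (lambda_sum A) l \<longrightarrow> interior (attractor t) \<noteq> {} \<longrightarrow> \<not> bad u t"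
    by (rule AE_completion)
  with assms(8) show ?thesis
  proof eventually_elim
    case (elim t)
    show ?case
    proof (intro impI ballI allI)
      fix z r assume t: "t \<in> U" and z: "z \<in> self_affine_set A t" and r: "(0::real) < r"
      have int: "interior (attractor t) \<noteq> {}" and z': "z \<in> attractor t"
        using elim(1) t z by (simp_all add: self_affine_set_eq[OF A])
      have good: "\<not> bad u t" if "u \<in> \<rat>" "0 < u" "u < dim_bound s (lambda_sum A) l" for u
        using elim(2) that int by blast
      show "hausdorff_dim (W_set s A t (proj A t j) \<inter> cball z r) \<ge> ereal (dim_bound s (lambda_sum A) l)"
        unfolding proj_eq[OF A]
      proof (rule hausdorff_dim_geI)
        fix u \<sigma> assume "u \<in> \<rat>" "0 < u" "u < dim_bound s (lambda_sum A) l" "0 \<le> \<sigma>" "\<sigma> \<le> u"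
        then show "hausdorff_measure \<sigma> (W_set s A t (code_point l t j) \<inter> cball z r) \<noteq> 0"
          using good[of u] z' r unfolding bad_def by blast
      qed
    qed
  qed
qed

end
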